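(* The following problem is decidable: given $d\ge 1$, $q<\omega$, a characteristic $\sigma\in\Sigma_d^+(q)$, and an ordinal $\alpha$ presented by its Cantor normal form, decide whether there exists a $d$-colored ordinal of order type exactly $\alpha$ satisfying $\sigma$.
   Context: A $d$-colored ordinal is a structure $(A,<,C_0,\dots,C_{d-1})$ where $(A,<)$ is an ordinal and the unary predicates $C_i$ partition $A$. $\equiv_q$ means agreement on all first-order sentences of quantifier rank at most $q$. $\Sigma_d^+(q)$ is a finite set containing, for each $\equiv_q$-class of $d$-colored ordinals that has a nonempty representative, exactly one $q$-characteristic sentence, i.e. a sentence of quantifier rank at most $q$ whose $d$-colored ordinal models are exactly the members of that class. Presentation of inputs: the ordinal is presented by its Cantor normal form with effective notations for the relevant exponents and cofinalities; in particular, writing $\alpha=\alpha_0+\theta$ with $\alpha_0$ the sum of the terms with exponent $\ge\omega$ and $\theta<\omega^\omega$ the sum of the terms with finite exponent, one can effectively read off from the presentation the Cantor normal form of $\theta$, whether $\alpha_0=0$, and, if $\alpha_0>0$, whether $\operatorname{cf}(\alpha_0)=\omega$ or $\operatorname{cf}(\alpha_0)>\omega$. *)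

theory Defs
  imports "HOL-Library.Nat_Bijection" "HOL-Library.Disjoint_Sets"
begin

unbundle cardinal_syntax

section \<open>Colored ordinals and first-order logic\<close>

text \<open>
  As usual in the library, an ordinal is a reflexive well-order relation, considered up to the
  isomorphism \<open>=o\<close>; the domain is its field. A structure is a pair of such a
  relation and a family of unary predicates, of which only the first \<open>d\<close> matter.
\<close>

type_synonym 'a struct = "'a rel \<times> (nat \<Rightarrow> 'a set)"

definition colored_ordinal :: "nat \<Rightarrow> 'a struct \<Rightarrow> bool" where
  "colored_ordinal d M \<longleftrightarrow>
     Well_order (fst M) \<and>
     (\<Union>i<d. snd M i) = Field (fst M) \<and>
     disjoint_family_on (snd M) {..<d}"

text \<open>
  Formulas use de Bruijn indices. \<open>Bot\<close> is needed because the signature has no constants: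
  without it there would be no sentence of quantifier rank 0.
\<close>

datatype fm =
    Bot
  | Eq nat nat
  | Less nat nat
  | Color nat nat
  | Neg fm
  | Conj fm fm
  | Ex fm

primrec sat :: "'a struct \<Rightarrow> (nat \<Rightarrow> 'a) \<Rightarrow> fm \<Rightarrow> bool" where
  "sat M e Bot \<longleftrightarrow> False"
| "sat M e (Eq x y) \<longleftrightarrow> e x = e y"
| "sat M e (Less x y) \<longleftrightarrow> (e x, e y) \<in> fst M \<and> e x \<noteq> e y"
| "sat M e (Color i x) \<longleftrightarrow> e x \<in> snd M i"
| "sat M e (Neg \<phi>) \<longleftrightarrow> \<not> sat M e \<phi>"
| "sat M e (Conj \<phi> \<psi>) \<longleftrightarrow> sat M e \<phi> \<and> sat M e \<psi>"
| "sat M e (Ex \<phi>) \<longleftrightarrow> (\<exists>a\<in>Field (fst M). sat M (case_nat a e) \<phi>)"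

primrec qrank :: "fm \<Rightarrow> nat" where
  "qrank Bot = 0"
| "qrank (Eq x y) = 0"
| "qrank (Less x y) = 0"
| "qrank (Color i x) = 0"
| "qrank (Neg \<phi>) = qrank \<phi>"
| "qrank (Conj \<phi> \<psi>) = max (qrank \<phi>) (qrank \<psi>)"
| "qrank (Ex \<phi>) = Suc (qrank \<phi>)"

text \<open>\<open>formula d n \<phi>\<close>: the free variables are below \<open>n\<close> and the color predicates below \<open>d\<close>.\<close>

primrec formula :: "nat \<Rightarrow> nat \<Rightarrow> fm \<Rightarrow> bool" where
  "formula d n Bot \<longleftrightarrow> True"
| "formula d n (Eq x y) \<longleftrightarrow> x < n \<and> y < n"
| "formula d n (Less x y) \<longleftrightarrow> x < n \<and> y < n"
| "formula d n (Color i x) \<longleftrightarrow> i < d \<and> x < n"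
| "formula d n (Neg \<phi>) \<longleftrightarrow> formula d n \<phi>"
| "formula d n (Conj \<phi> \<psi>) \<longleftrightarrow> formula d n \<phi> \<and> formula d n \<psi>"
| "formula d n (Ex \<phi>) \<longleftrightarrow> formula d (Suc n) \<phi>"

definition sentences :: "nat \<Rightarrow> nat \<Rightarrow> fm set" where
  "sentences d q = {\<phi>. formula d 0 \<phi> \<and> qrank \<phi> \<le> q}"

text \<open>Only used for sentences, whose truth does not depend on the assignment.\<close>

definition models :: "'a struct \<Rightarrow> fm \<Rightarrow> bool" (infix \<open>\<Turnstile>\<close> 50) where
  "M \<Turnstile> \<phi> \<longleftrightarrow> sat M (\<lambda>_. undefined) \<phi>"

definition equiv_q :: "nat \<Rightarrow> nat \<Rightarrow> 'a struct \<Rightarrow> 'b struct \<Rightarrow> bool" where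
  "equiv_q d q M N \<longleftrightarrow> (\<forall>\<phi>\<in>sentences d q. M \<Turnstile> \<phi> \<longleftrightarrow> N \<Turnstile> \<phi>)"

text \<open>
  The \<open>d\<close>-colored ordinals on the type \<open>'a\<close> play the role of the class of all
  \<open>d\<close>-colored ordinals. For infinite \<open>'a\<close> this changes neither the equivalence classes nor the
  characteristic sentences: by Loewenheim-Skolem every colored ordinal is elementarily
  equivalent to a countable one, and countable ordinals have copies on \<open>'a\<close>.
\<close>

definition characteristic_of :: "nat \<Rightarrow> nat \<Rightarrow> 'a struct \<Rightarrow> fm \<Rightarrow> bool" where
  "characteristic_of d q M \<sigma> \<longleftrightarrow>
     \<sigma> \<in> sentences d q \<and>
     (\<forall>N :: 'a struct. colored_ordinal d N \<longrightarrow> (N \<Turnstile> \<sigma> \<longleftrightarrow> equiv_q d q M N))"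

definition characteristic_set :: "'a itself \<Rightarrow> nat \<Rightarrow> nat \<Rightarrow> fm set \<Rightarrow> bool" where
  "characteristic_set _ d q S \<longleftrightarrow>
     finite S \<and>
     (\<forall>\<sigma>\<in>S. \<exists>M :: 'a struct.
        colored_ordinal d M \<and> Field (fst M) \<noteq> {} \<and> characteristic_of d q M \<sigma>) \<and>
     (\<forall>M :: 'a struct. colored_ordinal d M \<and> Field (fst M) \<noteq> {} \<longrightarrow>
        (\<exists>!\<sigma>. \<sigma> \<in> S \<and> characteristic_of d q M \<sigma>))"


section \<open>Cantor normal forms\<close>

text \<open>
  The power \<open>\<omega>\<^sup>\<beta>\<close>: functions from \<open>\<beta>\<close> to \<open>\<omega>\<close> of finite support, compared at the largest
  argument where they differ.
\<close>

definition fin_supp :: "'a rel \<Rightarrow> ('a \<Rightarrow> nat) set" where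
  "fin_supp \<beta> = {f. finite {x. f x \<noteq> 0} \<and> {x. f x \<noteq> 0} \<subseteq> Field \<beta>}"

definition omega_power :: "'a rel \<Rightarrow> ('a \<Rightarrow> nat) rel" where
  "omega_power \<beta> =
     {(f, g). f \<in> fin_supp \<beta> \<and> g \<in> fin_supp \<beta> \<and>
        (f = g \<or> (\<exists>x\<in>Field \<beta>. f x < g x \<and> (\<forall>y. (x, y) \<in> \<beta> \<and> y \<noteq> x \<longrightarrow> f y = g y)))}"

text \<open>
  The list \<open>[(\<beta>\<^sub>0, c\<^sub>0), \<dots>, (\<beta>\<^sub>k, c\<^sub>k)]\<close> stands for \<open>\<omega>\<^sup>\<beta>\<^sub>0 \<cdot> c\<^sub>0 + \<dots> + \<omega>\<^sup>\<beta>\<^sub>k \<cdot> c\<^sub>k\<close>. The triple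
  \<open>(i, j, f)\<close> is the point \<open>f\<close> in the \<open>j\<close>-th copy of \<open>\<omega>\<^sup>\<beta>\<^sub>i\<close>.
\<close>

type_synonym 'a cnf = "('a rel \<times> nat) list"

definition cnf_points :: "'a cnf \<Rightarrow> (nat \<times> nat \<times> ('a \<Rightarrow> nat)) set" where
  "cnf_points cs =
     {(i, j, f). i < length cs \<and> j < snd (cs ! i) \<and> f \<in> fin_supp (fst (cs ! i))}"

definition cnf_ord :: "'a cnf \<Rightarrow> (nat \<times> nat \<times> ('a \<Rightarrow> nat)) rel" where
  "cnf_ord cs =
     {((i, j, f), (i', j', f')).
        (i, j, f) \<in> cnf_points cs \<and> (i', j', f') \<in> cnf_points cs \<and>
        (i < i' \<or> i = i' \<and> (j < j' \<or> j = j' \<and> (f, f') \<in> omega_power (fst (cs ! i))))}"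

definition is_cnf :: "'a cnf \<Rightarrow> bool" where
  "is_cnf cs \<longleftrightarrow>
     (\<forall>(\<beta>, c)\<in>set cs. Well_order \<beta> \<and> c \<ge> 1) \<and>
     sorted_wrt (\<lambda>(\<beta>, _) (\<gamma>, _). \<gamma> <o \<beta>) cs"

text \<open>The summands of \<open>\<alpha> = \<alpha>\<^sub>0 + \<theta>\<close>; \<open>natLeq\<close> is the ordinal \<open>\<omega>\<close>.\<close>

definition infinite_terms :: "'a cnf \<Rightarrow> 'a cnf" where
  "infinite_terms cs = filter (\<lambda>(\<beta>, _). natLeq \<le>o \<beta>) cs"

definition finite_terms :: "'a cnf \<Rightarrow> 'a cnf" where
  "finite_terms cs = filter (\<lambda>(\<beta>, _). \<beta> <o natLeq) cs"

definition theta_cnf :: "'a cnf \<Rightarrow> (nat \<times> nat) list" where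
  "theta_cnf cs = map (\<lambda>(\<beta>, c). (card (Field \<beta>), c)) (finite_terms cs)"

text \<open>
  The least cardinality of a cofinal subset. Since \<open>cofinal\<close> is strict, this is meant for limit
  ordinals only, such as a nonzero sum of terms with infinite exponents.
\<close>

definition cofinality :: "'a rel \<Rightarrow> 'a rel" where
  "cofinality r = card_of (SOME A. A \<subseteq> Field r \<and> cofinal A r \<and>
     (\<forall>B. B \<subseteq> Field r \<and> cofinal B r \<longrightarrow> card_of A \<le>o card_of B))"


section \<open>Computability\<close>

text \<open>
  The total recursive functions of arity \<open>n\<close>, as functions on lists of length \<open>n\<close> (values on
  other lists are irrelevant): minimization is restricted to regular functions, which yields
  exactly the total ones among the partial recursive functions.
\<close>

inductive recursive :: "nat \<Rightarrow> (nat list \<Rightarrow> nat) \<Rightarrow> bool" where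
  zero: "recursive n (\<lambda>_. 0)"
| succ: "recursive 1 (\<lambda>xs. Suc (xs ! 0))"
| proj: "i < n \<Longrightarrow> recursive n (\<lambda>xs. xs ! i)"
| comp: "recursive (length hs) g \<Longrightarrow> \<forall>h\<in>set hs. recursive n h \<Longrightarrow>
    recursive n (\<lambda>xs. g (map (\<lambda>h. h xs) hs))"
| prim_rec: "recursive n g \<Longrightarrow> recursive (Suc (Suc n)) h \<Longrightarrow>
    recursive (Suc n)
      (\<lambda>xs. rec_nat (g (tl xs)) (\<lambda>y r. h (y # r # tl xs)) (hd xs))"
| mu: "recursive (Suc n) g \<Longrightarrow> \<forall>xs. length xs = n \<longrightarrow> (\<exists>y. g (y # xs) = 0) \<Longrightarrow>
    recursive n (\<lambda>xs. LEAST y. g (y # xs) = 0)"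
| ext: "recursive n f \<Longrightarrow> \<forall>xs. length xs = n \<longrightarrow> f xs = g xs \<Longrightarrow> recursive n g"

primrec fm_encode :: "fm \<Rightarrow> nat" where
  "fm_encode Bot = prod_encode (0, 0)"
| "fm_encode (Eq x y) = prod_encode (1, prod_encode (x, y))"
| "fm_encode (Less x y) = prod_encode (2, prod_encode (x, y))"
| "fm_encode (Color i x) = prod_encode (3, prod_encode (i, x))"
| "fm_encode (Neg \<phi>) = prod_encode (4, fm_encode \<phi>)"
| "fm_encode (Conj \<phi> \<psi>) = prod_encode (5, prod_encode (fm_encode \<phi>, fm_encode \<psi>))"
| "fm_encode (Ex \<phi>) = prod_encode (6, fm_encode \<phi>)"

lemma inj_fm_encode: "inj fm_encode"
proof (rule injI)
  fix \<phi> \<psi> assume "fm_encode \<phi> = fm_encode \<psi>"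
  then show "\<phi> = \<psi>"
    by (induction \<phi> arbitrary: \<psi>) (case_tac \<psi>; simp)+
qed

definition theta_code :: "'a cnf \<Rightarrow> nat" where
  "theta_code cs = list_encode (map prod_encode (theta_cnf cs))"

text \<open>
  A system of presentations: every \<open>p \<in> P\<close> names an ordinal \<open>\<alpha> p\<close> together with its Cantor
  normal form \<open>cnf p\<close>. The data required to be effective are those that determine \<open>\<theta>\<close>, whether
  \<open>\<alpha>\<^sub>0 = 0\<close>, and whether \<open>cf \<alpha>\<^sub>0\<close> is \<open>\<omega>\<close> or larger. How the exponents themselves are named is
  left open.
\<close>

definition effective_presentation ::
  "nat set \<Rightarrow> (nat \<Rightarrow> 'a rel) \<Rightarrow> (nat \<Rightarrow> 'a cnf) \<Rightarrow> bool" where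
  "effective_presentation P \<alpha> cnf \<longleftrightarrow>
     (\<forall>p\<in>P. Well_order (\<alpha> p) \<and> is_cnf (cnf p) \<and> \<alpha> p =o cnf_ord (cnf p)) \<and>
     (\<exists>T. recursive 1 T \<and> (\<forall>p\<in>P. T [p] = theta_code (cnf p))) \<and>
     (\<exists>Z. recursive 1 Z \<and>
        (\<forall>p\<in>P. Z [p] = (if Field (cnf_ord (infinite_terms (cnf p))) = {} then 1 else 0))) \<and>
     (\<exists>K. recursive 1 K \<and>
        (\<forall>p\<in>P. Field (cnf_ord (infinite_terms (cnf p))) \<noteq> {} \<longrightarrow>
          (cofinality (cnf_ord (infinite_terms (cnf p))) =o natLeq \<longrightarrow> K [p] = 0) \<and>
          (natLeq <o cofinality (cnf_ord (infinite_terms (cnf p))) \<longrightarrow> K [p] = 1)))"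

end

theory Submission
  imports Defs Complex_Main "HOL-Library.Ramsey"
begin

text \<open>
  By the Ehrenfeucht-Fraisse game, the first-order type of rank \<open>q + 1\<close> of a colored linear order
  is determined by the set of triples (type of rank \<open>q\<close> of the part below \<open>x\<close>, color of \<open>x\<close>, type of
  rank \<open>q\<close> of the part above \<open>x\<close>), where \<open>x\<close> runs through the points: after the move \<open>x\<close> the
  game continues independently on the two sides. With finite sets coded as numbers, the types of a
  given rank over finitely many colors form a finite, computable set. Concatenation of orders and
  repetition along \<open>\<omega>\<close> act on types as computable operations \<open>s + t\<close> (\<open>tadd\<close>) and \<open>e \<cdot> \<omega>\<close> (\<open>tomega\<close>).
  The truth of a sentence can be computed from a type of slightly larger rank
  (\<open>truth_correct\<close>), so it remains to compute the set of types of the colorings of \<open>\<alpha>\<close>.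

  The power \<open>\<omega>\<^sup>n\<^sup>+\<^sup>1\<close> is an \<open>\<omega>\<close>-sum of copies of \<open>\<omega>\<^sup>n\<close>. By Ramsey's theorem its colorings have exactly
  the types \<open>s + e \<cdot> \<omega>\<close>, where \<open>s\<close> and \<open>e\<close> are finite sums of types of colorings of \<open>\<omega>\<^sup>n\<close>
  (\<open>qtypes_omega\<close>). Thus the sets \<open>S\<^sub>n\<close> of types of colorings of \<open>\<omega>\<^sup>n\<close> are computable one after the
  other. Being subsets of a finite set they repeat, and because \<open>\<omega>\<^sup>m + \<omega>\<^sup>n = \<omega>\<^sup>n\<close> for \<open>m < n\<close> a repetition
  forces two consecutive ones to agree (\<open>power_types_collapse\<close>). From then on, say from \<open>N\<close>, they
  are a constant set \<open>E\<close>, with \<open>E + E = E\<close> and closed under \<open>\<omega>\<close>-sums.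

  All exponents of \<open>\<alpha>\<^sub>0\<close> are infinite, so \<open>\<alpha>\<^sub>0\<close> is a well-ordered sum of copies of \<open>\<omega>\<^sup>N\<close>. Induction on
  the length of such a sum shows that the set of types of its colorings is \<open>E\<close> if the cofinality
  is countable, and \<open>U = {s + g | s, g \<in> E, g \<cdot> \<omega> = g}\<close> otherwise (\<open>qtypes_blocks\<close>). Three facts
  carry the induction. In uncountable cofinality a chain of elementary substructures
  shows that some tail of the coloring has a type \<open>g\<close> with \<open>g \<cdot> \<omega> = g\<close> (\<open>idempotent_tail\<close>).
  Conversely, such a \<open>g\<close> is the type of every well-ordered sum of pieces of type \<open>g\<close>
  (\<open>qtype_absorb\<close>). Finally \<open>U + E = E\<close> (\<open>U_E\<close>), which makes a block of uncountable cofinality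
  invisible as soon as something follows it: every type in \<open>E\<close>
  contains a summand \<open>g\<close> with \<open>g \<cdot> \<omega> = g\<close>, by an argument on chains of divisors.

  The decision procedure computes \<open>E\<close> or \<open>U\<close> according to the cofinality of \<open>\<alpha>\<^sub>0\<close>, adds the sets
  \<open>S\<^sub>n\<close> for the terms of \<open>\<theta>\<close>, and evaluates \<open>\<sigma>\<close> on the finitely many types obtained. It is shown to be
  recursive by a calculus in which finite sets are obtained by minimization: the least
  code of a set that contains \<open>F\<close> is the code of \<open>F\<close> (\<open>computable_set_encode\<close>).
\<close>

section \<open>Codes of types\<close>

abbreviation els :: "nat \<Rightarrow> nat set" where "els \<equiv> set_decode"

definition pfst :: "nat \<Rightarrow> nat" where "pfst z = fst (prod_decode z)"
definition psnd :: "nat \<Rightarrow> nat" where "psnd z = snd (prod_decode z)"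

lemma pfst_pair [simp]: "pfst (prod_encode (a, b)) = a"
  and psnd_pair [simp]: "psnd (prod_encode (a, b)) = b"
  and pair_pfst_psnd [simp]: "prod_encode (pfst z, psnd z) = z"
  by (simp_all add: pfst_def psnd_def)

text \<open>
  A point of a colored order cuts it into two parts. The element \<open>cut l c r\<close> of a type records the
  types of the two parts and the color of the point.
\<close>

definition cut :: "nat \<Rightarrow> nat \<Rightarrow> nat \<Rightarrow> nat" where
  "cut l c r = prod_encode (l, prod_encode (c, r))"

definition cut_left :: "nat \<Rightarrow> nat" where "cut_left w = pfst w"
definition cut_color :: "nat \<Rightarrow> nat" where "cut_color w = pfst (psnd w)"
definition cut_right :: "nat \<Rightarrow> nat" where "cut_right w = psnd (psnd w)"

lemma cut_simps [simp]: "cut_left (cut l c r) = l" "cut_color (cut l c r) = c" "cut_right (cut l c r) = r"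
  "cut (cut_left w) (cut_color w) (cut_right w) = w"
  by (simp_all add: cut_def cut_left_def cut_color_def cut_right_def)

lemma cut_inject [simp]: "cut l c r = cut l' c' r' \<longleftrightarrow> l = l' \<and> c = c' \<and> r = r'"
  by (simp add: cut_def)

lemma set_encode_mono: "A \<subseteq> B \<Longrightarrow> finite B \<Longrightarrow> set_encode A \<le> set_encode B"
  unfolding set_encode_def by (rule sum_mono2) auto

lemma els_eq_iff: "(els x = els y) = (x = y)"
  by (metis set_decode_inverse)

text \<open>
  The passage from a type of rank \<open>k + 1\<close> to the induced type of rank \<open>k\<close>.
\<close>

primrec trunc :: "nat \<Rightarrow> nat \<Rightarrow> nat" where
  "trunc 0 t = 0"
| "trunc (Suc k) t =
     set_encode ((\<lambda>w. cut (trunc k (cut_left w)) (cut_color w) (trunc k (cut_right w))) ` els t)"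

text \<open>
  A point of a concatenation lies in one of the two summands, and the other summand joins its
  right or left part, with rank lowered by one.
\<close>

primrec tadd :: "nat \<Rightarrow> nat \<Rightarrow> nat \<Rightarrow> nat" where
  "tadd 0 s t = 0"
| "tadd (Suc k) s t = set_encode
     ((\<lambda>w. cut (cut_left w) (cut_color w) (tadd k (cut_right w) (trunc k t))) ` els s \<union>
      (\<lambda>w. cut (tadd k (trunc k s) (cut_left w)) (cut_color w) (cut_right w)) ` els t)"

text \<open>
  A finite set that contains all types of rank \<open>k\<close> over the color set \<open>C\<close>. Some of its elements are
  types of no order; it serves as a bound for searches.
\<close>

primrec universe :: "nat \<Rightarrow> nat \<Rightarrow> nat" where
  "universe C 0 = set_encode {0}"
| "universe C (Suc k) = set_encode {y. els y \<subseteq>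
     {w. cut_left w \<in> els (universe C k) \<and> cut_color w \<in> els C \<and> cut_right w \<in> els (universe C k)}}"

declare universe.simps [simp del]

text \<open>
  The code of the closure of \<open>A\<close> under addition, see \<open>els_tclosure\<close>. The least code belongs to the
  least set, since the code is monotone in the set. The guard by the universe provides a solution
  for arbitrary arguments, so that the minimization is total.
\<close>

definition tclosure :: "nat \<Rightarrow> nat \<Rightarrow> nat \<Rightarrow> nat" where
  "tclosure C k A = (LEAST y. els A \<subseteq> els y \<and>
     (\<forall>s\<in>els y. \<forall>t\<in>els A. tadd k s t \<in> els (universe C k) \<longrightarrow> tadd k s t \<in> els y))"

text \<open>
  The type of \<open>\<omega>\<close> copies of an order of type \<open>e\<close>. A point has finitely many copies of \<open>e\<close>, perhaps none,
  to the left of its own copy and \<open>\<omega>\<close> copies to the right. The types of the finite sums are the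
  closure of the single type \<open>e\<close> under addition; together with \<open>0\<close>, the type of the empty order, they account
  for the left part.
\<close>

primrec tomega :: "nat \<Rightarrow> nat \<Rightarrow> nat \<Rightarrow> nat" where
  "tomega C 0 e = 0"
| "tomega C (Suc k) e = set_encode
     (\<Union>s\<in>insert 0 (els (tclosure C k (set_encode {trunc k e}))).
        (\<lambda>w. cut (tadd k s (cut_left w)) (cut_color w) (tadd k (cut_right w) (tomega C k (trunc k e)))) ` els e)"

text \<open>
  The type of rank \<open>k\<close> of the order \<open>lt\<close> on \<open>X\<close> with coloring \<open>c\<close>. At rank \<open>0\<close> nothing is recorded.
\<close>

primrec qtype :: "('a \<Rightarrow> 'a \<Rightarrow> bool) \<Rightarrow> ('a \<Rightarrow> nat) \<Rightarrow> nat \<Rightarrow> 'a set \<Rightarrow> nat" where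
  "qtype lt c 0 X = 0"
| "qtype lt c (Suc k) X = set_encode
     ((\<lambda>x. cut (qtype lt c k {y\<in>X. lt y x}) (c x) (qtype lt c k {y\<in>X. lt x y})) ` X)"

section \<open>The finite universe of types\<close>

lemma finite_triples: "finite {w. cut_left w \<in> els A \<and> cut_color w \<in> els C \<and> cut_right w \<in> els B}"
proof (rule finite_subset)
  show "{w. cut_left w \<in> els A \<and> cut_color w \<in> els C \<and> cut_right w \<in> els B} \<subseteq>
     (\<lambda>(l, c, r). cut l c r) ` (els A \<times> els C \<times> els B)"
    by (auto simp: image_iff) (metis cut_simps(4))
qed simp

lemma finite_codes: "finite V \<Longrightarrow> finite {y. els y \<subseteq> V}"
proof (rule finite_subset)
  show "{y. els y \<subseteq> V} \<subseteq> set_encode ` Pow V"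
    by (metis (no_types, lifting) Pow_iff image_eqI mem_Collect_eq set_decode_inverse subsetI)
qed auto

lemma els_universe_0: "els (universe C 0) = {0}"
  using set_encode_inverse[of "{0::nat}"] by (simp add: universe.simps del: set_encode_insert)

lemma els_universe_Suc: "els (universe C (Suc k)) = {y. els y \<subseteq>
     {w. cut_left w \<in> els (universe C k) \<and> cut_color w \<in> els C \<and> cut_right w \<in> els (universe C k)}}"
  unfolding universe.simps by (rule set_encode_inverse) (intro finite_codes finite_triples)

lemma zero_universe: "0 \<in> els (universe C k)"
  by (cases k) (simp_all add: els_universe_0 els_universe_Suc)

lemma universe_parts:
  assumes "u \<in> els (universe C (Suc k))" "w \<in> els u"
  shows "cut_left w \<in> els (universe C k)" "cut_color w \<in> els C" "cut_right w \<in> els (universe C k)"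
  using assms unfolding els_universe_Suc by blast+

lemma universe_SucI:
  assumes "finite T" "\<And>w. w \<in> T \<Longrightarrow> cut_left w \<in> els (universe C k) \<and> cut_color w \<in> els C \<and> cut_right w \<in> els (universe C k)"
  shows "set_encode T \<in> els (universe C (Suc k))"
  using assms unfolding els_universe_Suc by (simp add: set_encode_inverse subset_iff)

lemma trunc_universe: "t \<in> els (universe C (Suc k)) \<Longrightarrow> trunc k t \<in> els (universe C k)"
proof (induction k arbitrary: t)
  case 0 show ?case unfolding trunc.simps els_universe_0 by simp
next
  case (Suc k)
  show ?case unfolding trunc.simps
    by (rule universe_SucI) (auto simp: universe_parts[OF Suc.prems] intro!: Suc.IH)
qed

lemma tadd_universe: "s \<in> els (universe C k) \<Longrightarrow> t \<in> els (universe C k) \<Longrightarrow> tadd k s t \<in> els (universe C k)"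
proof (induction k arbitrary: s t)
  case 0 show ?case unfolding tadd.simps els_universe_0 by simp
next
  case (Suc k)
  show ?case unfolding tadd.simps
    by (rule universe_SucI)
      (auto simp: universe_parts[OF Suc.prems(1)] universe_parts[OF Suc.prems(2)] trunc_universe Suc.prems intro!: Suc.IH)
qed

text \<open>
  The types of nonempty finite sums of orders whose types are in \<open>A\<close>.
\<close>

inductive_set tsums :: "nat \<Rightarrow> nat set \<Rightarrow> nat set" for k A where
  base: "x \<in> A \<Longrightarrow> x \<in> tsums k A"
| step: "s \<in> tsums k A \<Longrightarrow> t \<in> A \<Longrightarrow> tadd k s t \<in> tsums k A"

lemma tsums_universe: "x \<in> tsums k A \<Longrightarrow> A \<subseteq> els (universe C k) \<Longrightarrow> x \<in> els (universe C k)"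
  by (induction rule: tsums.induct) (auto intro: tadd_universe)

lemma els_tclosure:
  assumes "els A \<subseteq> els (universe C k)"
  shows "els (tclosure C k A) = tsums k (els A)"
proof -
  let ?P = "\<lambda>y. els A \<subseteq> els y \<and>
     (\<forall>s\<in>els y. \<forall>t\<in>els A. tadd k s t \<in> els (universe C k) \<longrightarrow> tadd k s t \<in> els y)"
  have sub: "tsums k (els A) \<subseteq> els (universe C k)" using tsums_universe assms by blast
  then have fin: "finite (tsums k (els A))" by (rule finite_subset) simp
  let ?y = "set_encode (tsums k (els A))"
  have y: "els ?y = tsums k (els A)" using fin by (rule set_encode_inverse)
  have P: "?P ?y" unfolding y by (auto intro: tsums.intros)
  have least: "?y \<le> y" if "?P y" for y
  proof -
    have "x \<in> els y" if "x \<in> tsums k (els A)" for x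
      using that
    proof (induction rule: tsums.induct)
      case (step s t)
      then show ?case using \<open>?P y\<close> sub tsums.step by blast
    qed (use \<open>?P y\<close> in blast)
    then show ?thesis using set_encode_mono[of "tsums k (els A)" "els y"]
      by (metis finite_set_decode set_decode_inverse subsetI)
  qed
  have "tclosure C k A = ?y" unfolding tclosure_def using P least by (rule Least_equality)
  then show ?thesis using y by simp
qed

section \<open>Types of colored orders\<close>

lemma qtype_universe: "c ` X \<subseteq> els C \<Longrightarrow> qtype lt c k X \<in> els (universe C k)"
proof (induction k arbitrary: X)
  case 0 then show ?case by (simp add: els_universe_0)
next
  case (Suc k)
  let ?I = "(\<lambda>x. cut (qtype lt c k {y\<in>X. lt y x}) (c x) (qtype lt c k {y\<in>X. lt x y})) ` X"
  have I: "?I \<subseteq> {w. cut_left w \<in> els (universe C k) \<and> cut_color w \<in> els C \<and> cut_right w \<in> els (universe C k)}"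
  proof -
    have cX: "c x \<in> els C" if "x \<in> X" for x using Suc.prems that by blast
    have "qtype lt c k {y\<in>X. P y} \<in> els (universe C k)" for P
      by (rule Suc.IH) (use cX in blast)
    then show ?thesis using cX by (auto simp del: universe.simps)
  qed
  then have "finite ?I" by (rule finite_subset) (rule finite_triples)
  with I show ?case unfolding els_universe_Suc by (simp add: set_encode_inverse)
qed

lemma els_qtype_Suc:
  assumes "finite (c ` X)"
  shows "els (qtype lt c (Suc k) X) =
    (\<lambda>x. cut (qtype lt c k {y\<in>X. lt y x}) (c x) (qtype lt c k {y\<in>X. lt x y})) ` X"
proof -
  let ?I = "(\<lambda>x. cut (qtype lt c k {y\<in>X. lt y x}) (c x) (qtype lt c k {y\<in>X. lt x y})) ` X"
  obtain C where C: "els C = c ` X" using set_encode_inverse[OF assms] by blast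
  have "?I \<subseteq> {w. cut_left w \<in> els (universe C k) \<and> cut_color w \<in> els C \<and> cut_right w \<in> els (universe C k)}"
  proof -
    have cX: "c x \<in> els C" if "x \<in> X" for x using C that by blast
    have "qtype lt c k {y\<in>X. P y} \<in> els (universe C k)" for P
      by (rule qtype_universe) (use cX in blast)
    then show ?thesis using cX by (auto simp del: universe.simps)
  qed
  then have "finite ?I" by (rule finite_subset) (rule finite_triples)
  then show ?thesis by (simp add: set_encode_inverse)
qed

lemma qtype_cong: "(\<And>x. x \<in> X \<Longrightarrow> c x = c' x) \<Longrightarrow> qtype lt c k X = qtype lt c' k X"
proof (induction k arbitrary: X)
  case (Suc k)
  have "qtype lt c k {y\<in>X. P y} = qtype lt c' k {y\<in>X. P y}" for P
    using Suc.prems by (intro Suc.IH) auto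
  then show ?case using Suc.prems by simp
qed simp

lemma finite_image_sub: "finite (c ` X) \<Longrightarrow> finite (c ` {y\<in>X. P y})"
  by (rule finite_subset[of _ "c ` X"]) auto

lemma trunc_qtype: "finite (c ` X) \<Longrightarrow> trunc k (qtype lt c (Suc k) X) = qtype lt c k X"
proof (induction k arbitrary: X)
  case (Suc k)
  have eq: "trunc k (qtype lt c (Suc k) {y\<in>X. P y}) = qtype lt c k {y\<in>X. P y}" for P
    by (rule Suc.IH) (rule finite_image_sub[OF Suc.prems])
  show ?case unfolding trunc.simps els_qtype_Suc[OF Suc.prems] image_image cut_simps eq
    by simp
qed simp

lemma qtype_empty [simp]: "qtype lt c k {} = 0"
  by (cases k) auto

lemma qtype_eq_mono:
  assumes "finite (c ` X)" "finite (c ` Y)" "qtype lt c k X = qtype lt c k Y" "r \<le> k"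
  shows "qtype lt c r X = qtype lt c r Y"
  using assms(4,3)
proof (induction k)
  case (Suc n)
  show ?case
  proof (cases "r = Suc n")
    case False
    have "trunc n (qtype lt c (Suc n) X) = trunc n (qtype lt c (Suc n) Y)" using Suc.prems(2) by simp
    then have "qtype lt c n X = qtype lt c n Y" using assms(1,2) by (simp add: trunc_qtype del: qtype.simps)
    with False show ?thesis using Suc by simp
  qed (use Suc in simp)
qed simp

lemma qtype_iso:
  assumes "inj_on h X" "\<And>x y. x \<in> X \<Longrightarrow> y \<in> X \<Longrightarrow> lt x y \<longleftrightarrow> lt' (h x) (h y)"
    and "\<And>x. x \<in> X \<Longrightarrow> c x = c' (h x)"
  shows "qtype lt c k X = qtype lt' c' k (h ` X)"
  using assms
proof (induction k arbitrary: X)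
  case (Suc k)
  have IH: "qtype lt c k {y\<in>X. P y} = qtype lt' c' k (h ` {y\<in>X. P y})" for P
    using Suc.prems by (intro Suc.IH) (auto simp: inj_on_def)
  have "h ` {y\<in>X. lt y x} = {y\<in>h ` X. lt' y (h x)}" "h ` {y\<in>X. lt x y} = {y\<in>h ` X. lt' (h x) y}"
    if "x \<in> X" for x using that Suc.prems(2) by auto
  then show ?case using Suc.prems(3) by (simp add: IH image_image cong: image_cong)
qed simp

definition before :: "('a \<Rightarrow> 'a \<Rightarrow> bool) \<Rightarrow> 'a set \<Rightarrow> 'a set \<Rightarrow> bool" where
  "before lt A B \<longleftrightarrow> (\<forall>a\<in>A. \<forall>b\<in>B. lt a b)"

text \<open>
  Sums are represented inside one fixed order, by sets that lie one after the other.
\<close>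

locale strict_order =
  fixes lt :: "'a \<Rightarrow> 'a \<Rightarrow> bool" (infix "\<sqsubset>" 50)
  assumes irr: "\<not> x \<sqsubset> x" and tr: "x \<sqsubset> y \<Longrightarrow> y \<sqsubset> z \<Longrightarrow> x \<sqsubset> z"
begin

lemma asym: "x \<sqsubset> y \<Longrightarrow> \<not> y \<sqsubset> x"
  using irr tr by blast

lemma qtype_Un:
  assumes "finite (range c)" "before lt A B"
  shows "qtype lt c k (A \<union> B) = tadd k (qtype lt c k A) (qtype lt c k B)"
  using assms(2)
proof (induction k arbitrary: A B)
  case (Suc k)
  have fin: "finite (c ` X)" for X by (rule finite_subset[OF _ assms(1)]) auto
  have lt: "a \<sqsubset> b" "\<not> b \<sqsubset> a" if "a \<in> A" "b \<in> B" for a b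
    using Suc.prems that asym unfolding before_def by blast+
  have eq: "{y \<in> A \<union> B. y \<sqsubset> x} = {y \<in> A. y \<sqsubset> x}" "{y \<in> A \<union> B. x \<sqsubset> y} = {y \<in> A. x \<sqsubset> y} \<union> B"
    if "x \<in> A" for x using that lt by blast+
  have eq': "{y \<in> A \<union> B. y \<sqsubset> x} = A \<union> {y \<in> B. y \<sqsubset> x}" "{y \<in> A \<union> B. x \<sqsubset> y} = {y \<in> B. x \<sqsubset> y}"
    if "x \<in> B" for x using that lt by blast+
  have IH: "qtype lt c k ({y \<in> A. P y} \<union> B) = tadd k (qtype lt c k {y \<in> A. P y}) (qtype lt c k B)"
    "qtype lt c k (A \<union> {y \<in> B. P y}) = tadd k (qtype lt c k A) (qtype lt c k {y \<in> B. P y})" for P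
    by (rule Suc.IH; use lt in \<open>auto simp: before_def\<close>)+
  show ?case
    unfolding tadd.simps els_qtype_Suc[OF fin] image_image cut_simps trunc_qtype[OF fin]
    unfolding qtype.simps(2) image_Un
    by (intro arg_cong[of _ _ set_encode] arg_cong2[of _ _ _ _ "(\<union>)"] image_cong refl)
      (simp_all only: eq eq' IH)
qed simp

lemma els_tomega:
  assumes "e \<in> els (universe C (Suc k))"
  shows "els (tomega C (Suc k) e) =
     (\<Union>s\<in>insert 0 (tsums k {trunc k e}).
        (\<lambda>w. cut (tadd k s (cut_left w)) (cut_color w) (tadd k (cut_right w) (tomega C k (trunc k e)))) ` els e)"
proof -
  have *: "els (set_encode {trunc k e}) = {trunc k e}"
    by (rule set_encode_inverse) simp
  have "els (tclosure C k (set_encode {trunc k e})) = tsums k {trunc k e}"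
    using els_tclosure[of "set_encode {trunc k e}" C k] trunc_universe[OF assms] unfolding * by simp
  moreover have "finite (tsums k {trunc k e})"
    using tsums_universe[of _ k "{trunc k e}" C] trunc_universe[OF assms]
    by (intro finite_subset[of "tsums k {trunc k e}" "els (universe C k)"]) auto
  ultimately show ?thesis
    unfolding tomega.simps by (subst set_encode_inverse) auto
qed

text \<open>
  The left parts of the points in an \<open>\<omega>\<close>-sum realize exactly the finite sums, which justifies
  the definition of \<open>tomega\<close>.
\<close>

lemma qtype_UN_lessThan:
  assumes "range c \<subseteq> els C" "\<And>i j. i < j \<Longrightarrow> before lt (A i) (A j)"
    and "\<And>i::nat. qtype lt c k (A i) = e"
  shows "qtype lt c k (\<Union>j<i. A j) \<in> insert 0 (tsums k {e})"
    and "s \<in> insert 0 (tsums k {e}) \<Longrightarrow> \<exists>i. s = qtype lt c k (\<Union>j<i. A j)"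
proof -
  have fin: "finite (range c)" by (rule finite_subset[OF assms(1)]) simp
  have st: "qtype lt c k (\<Union>j<Suc i. A j) = tadd k (qtype lt c k (\<Union>j<i. A j)) e" for i
  proof -
    have "(\<Union>j<Suc i. A j) = (\<Union>j<i. A j) \<union> A i" by (auto simp: lessThan_Suc)
    moreover have b: "before lt (\<Union>j<i. A j) (A i)" using assms(2) by (auto simp: before_def)
    ultimately show ?thesis by (simp only: qtype_Un[OF fin b] assms(3))
  qed
  have one: "(\<Union>j<Suc 0. A j) = A 0" by auto
  have in_pl: "qtype lt c k (\<Union>j<Suc i. A j) \<in> tsums k {e}" for i
  proof (induction i)
    case 0 show ?case unfolding one assms(3) by (rule tsums.base) simp
  next
    case (Suc i) show ?case unfolding st[of "Suc i"] by (rule tsums.step[OF Suc]) simp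
  qed
  show "qtype lt c k (\<Union>j<i. A j) \<in> insert 0 (tsums k {e})"
  proof (cases i)
    case (Suc j)
    show ?thesis unfolding Suc using in_pl by blast
  qed simp
  have "\<exists>i. s = qtype lt c k (\<Union>j<i. A j)" if "s \<in> tsums k {e}"
    using that
  proof (induction rule: tsums.induct)
    case (base x)
    then have "x = qtype lt c k (\<Union>j<Suc 0. A j)" unfolding one using assms(3) by simp
    then show ?case by blast
  next
    case (step s t)
    then obtain i where i: "s = qtype lt c k (\<Union>j<i. A j)" by blast
    have "tadd k s t = qtype lt c k (\<Union>j<Suc i. A j)" unfolding st i using step.hyps by simp
    then show ?case by blast
  qed
  moreover have "0 = qtype lt c k (\<Union>j<(0::nat). A j)" by simp
  ultimately show "s \<in> insert 0 (tsums k {e}) \<Longrightarrow> \<exists>i. s = qtype lt c k (\<Union>j<i. A j)" by blast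
qed

lemma qtype_UN_omega:
  assumes "range c \<subseteq> els C" "\<And>i j::nat. i < j \<Longrightarrow> before lt (A i) (A j)"
    and "\<And>i. qtype lt c k (A i) = e"
  shows "qtype lt c k (\<Union>i. A i) = tomega C k e"
  using assms(2,3)
proof (induction k arbitrary: A e)
  case (Suc k)
  have fin: "finite (range c)" by (rule finite_subset[OF assms(1)]) simp
  have fin': "finite (c ` X)" for X by (rule finite_subset[OF _ fin]) auto
  have e: "e \<in> els (universe C (Suc k))" using qtype_universe[of c "A 0" C lt "Suc k"] Suc.prems(2) assms(1) by auto
  have tk: "qtype lt c k (A i) = trunc k e" for i
    using trunc_qtype[OF fin', of k lt "A i"] unfolding Suc.prems(2) by simp
  let ?U = "\<Union>i. A i"
  have lt: "a \<sqsubset> b" "\<not> b \<sqsubset> a" if "a \<in> A i" "b \<in> A j" "i < j" for a b i j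
    using Suc.prems(1)[OF that(3)] that asym unfolding before_def by blast+
  let ?f = "\<lambda>i w. cut (tadd k (qtype lt c k (\<Union>j<i. A j)) (cut_left w)) (cut_color w) (tadd k (cut_right w) (tomega C k (trunc k e)))"
  have point: "cut (qtype lt c k {y\<in>?U. y \<sqsubset> x}) (c x) (qtype lt c k {y\<in>?U. x \<sqsubset> y}) =
     ?f i (cut (qtype lt c k {y\<in>A i. y \<sqsubset> x}) (c x) (qtype lt c k {y\<in>A i. x \<sqsubset> y}))"
    if x: "x \<in> A i" for x i
  proof -
    have "j < i \<or> y \<in> A i" if "y \<in> A j" "y \<sqsubset> x" for y j
      using lt(2)[OF x that(1)] that by (cases i j rule: linorder_cases) auto
    then have "{y\<in>?U. y \<sqsubset> x} = (\<Union>j<i. A j) \<union> {y\<in>A i. y \<sqsubset> x}"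
      using lt(1)[OF _ x] by blast
    moreover have "before lt (\<Union>j<i. A j) {y\<in>A i. y \<sqsubset> x}" using lt by (auto simp: before_def)
    moreover have "{y\<in>?U. x \<sqsubset> y} = {y\<in>A i. x \<sqsubset> y} \<union> (\<Union>j. A (Suc i + j))"
    proof -
      have "\<exists>j'. y \<in> A (Suc (i + j'))" if "y \<in> A j" "x \<sqsubset> y" "y \<notin> A i" for y j
      proof -
        have "i < j" using lt(2)[OF that(1) x] that by (cases i j rule: linorder_cases) auto
        then obtain j' where "j = Suc (i + j')" using less_iff_Suc_add by auto
        then show ?thesis using that by blast
      qed
      moreover have "x \<sqsubset> y" if "y \<in> A (Suc (i + j))" for y j using lt(1)[OF x that] by simp
      ultimately show ?thesis by (auto, blast)
    qed
    moreover have "before lt {y\<in>A i. x \<sqsubset> y} (\<Union>j. A (Suc i + j))" using lt by (auto simp: before_def)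
    moreover have "qtype lt c k (\<Union>j. A (Suc i + j)) = tomega C k (trunc k e)"
      by (rule Suc.IH) (use Suc.prems(1) tk in auto)
    ultimately show ?thesis by (simp add: qtype_Un[OF fin])
  qed
  have elA: "els e = (\<lambda>x. cut (qtype lt c k {y\<in>A i. y \<sqsubset> x}) (c x) (qtype lt c k {y\<in>A i. x \<sqsubset> y})) ` A i" for i
    using els_qtype_Suc[OF fin'[of "A i"], of lt k] unfolding Suc.prems(2) .
  have "els (qtype lt c (Suc k) ?U) = (\<Union>i. ?f i ` els e)"
  proof -
    have "(\<Union>i. ?f i ` els e) = (\<Union>i. (\<lambda>x. cut (qtype lt c k {y\<in>?U. y \<sqsubset> x}) (c x) (qtype lt c k {y\<in>?U. x \<sqsubset> y})) ` A i)"
    proof (rule SUP_cong[OF refl])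
      fix i
      show "?f i ` els e = (\<lambda>x. cut (qtype lt c k {y\<in>?U. y \<sqsubset> x}) (c x) (qtype lt c k {y\<in>?U. x \<sqsubset> y})) ` A i"
        unfolding elA[of i] image_image by (rule image_cong[OF refl]) (simp only: point)
    qed
    then show ?thesis unfolding els_qtype_Suc[OF fin'] image_UN by (rule sym)
  qed
  also have "\<dots> = els (tomega C (Suc k) e)"
    unfolding els_tomega[OF e]
  proof (intro subset_antisym UN_least subsetI)
    fix i w assume "w \<in> ?f i ` els e"
    moreover have "qtype lt c k (\<Union>j<i. A j) \<in> insert 0 (tsums k {trunc k e})"
      by (rule qtype_UN_lessThan(1)[where A=A, OF assms(1) Suc.prems(1) tk])
    ultimately show "w \<in> (\<Union>s\<in>insert 0 (tsums k {trunc k e}).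
        (\<lambda>w. cut (tadd k s (cut_left w)) (cut_color w) (tadd k (cut_right w) (tomega C k (trunc k e)))) ` els e)" by blast
  next
    fix s w assume s: "s \<in> insert 0 (tsums k {trunc k e})"
      and w: "w \<in> (\<lambda>w. cut (tadd k s (cut_left w)) (cut_color w) (tadd k (cut_right w) (tomega C k (trunc k e)))) ` els e"
    obtain i where "s = qtype lt c k (\<Union>j<i. A j)"
      using qtype_UN_lessThan(2)[where A=A, OF assms(1) Suc.prems(1) tk s] by blast
    with w show "w \<in> (\<Union>i. ?f i ` els e)" by blast
  qed
  finally show ?case by (simp only: els_eq_iff)
qed simp

end

declare qtype.simps(2) [simp del] trunc.simps(2) [simp del] tadd.simps(2) [simp del] tomega.simps(2) [simp del]

section \<open>The types of the colorings of an order\<close>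

definition qtypes :: "('a \<Rightarrow> 'a \<Rightarrow> bool) \<Rightarrow> nat \<Rightarrow> nat \<Rightarrow> 'a set \<Rightarrow> nat set" where
  "qtypes lt C k X = {qtype lt c k X | c. range c \<subseteq> els C}"

definition set_tadd :: "nat \<Rightarrow> nat set \<Rightarrow> nat set \<Rightarrow> nat set" where
  "set_tadd k A B = {tadd k s t | s t. s \<in> A \<and> t \<in> B}"

definition set_tomega :: "nat \<Rightarrow> nat \<Rightarrow> nat set \<Rightarrow> nat set" where
  "set_tomega C k P = {tadd k s (tomega C k e) | s e. s \<in> tsums k P \<and> e \<in> tsums k P}"

primrec point_type :: "nat \<Rightarrow> nat \<Rightarrow> nat" where
  "point_type 0 c = 0"
| "point_type (Suc k) c = set_encode {cut 0 c 0}"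

text \<open>
  The sets of order type \<open>\<omega>\<^sup>n\<close>, described by repeated \<open>\<omega>\<close>-sums, the form in which the types of their
  colorings are computed.
\<close>

primrec omega_block :: "('a \<Rightarrow> 'a \<Rightarrow> bool) \<Rightarrow> nat \<Rightarrow> 'a set \<Rightarrow> bool" where
  "omega_block lt 0 X \<longleftrightarrow> (\<exists>x. X = {x})"
| "omega_block lt (Suc n) X \<longleftrightarrow> (\<exists>A. (\<forall>i::nat. omega_block lt n (A i)) \<and>
     (\<forall>i j. i < j \<longrightarrow> before lt (A i) (A j)) \<and> X = (\<Union>i. A i))"

text \<open>
  The types of rank \<open>k\<close> of the colorings of \<open>\<omega>\<^sup>n\<close>, see \<open>qtypes_omega_block\<close>.
\<close>

primrec power_types :: "nat \<Rightarrow> nat \<Rightarrow> nat \<Rightarrow> nat set" where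
  "power_types C k 0 = point_type k ` els C"
| "power_types C k (Suc n) = set_tomega C k (power_types C k n)"

lemma fin_col: "range c \<subseteq> els C \<Longrightarrow> finite (range c)"
  by (rule finite_subset[OF _ finite_set_decode])

lemma qtypes_universe: "t \<in> qtypes lt C k X \<Longrightarrow> t \<in> els (universe C k)"
  unfolding qtypes_def by (auto intro!: qtype_universe)

lemma qtypes_I: "range c \<subseteq> els C \<Longrightarrow> qtype lt c k X \<in> qtypes lt C k X"
  unfolding qtypes_def by blast

lemma bounded_universe: "\<exists>b. \<forall>v\<in>els A. v < b"
  using finite_nat_set_iff_bounded[of "els A"] by simp

text \<open>
  Colorings of disjoint sets can be prescribed independently.
\<close>

lemma qtypes_merge:
  assumes C: "els C \<noteq> {}"
    and disj: "\<And>i j. i \<in> I \<Longrightarrow> j \<in> I \<Longrightarrow> i \<noteq> j \<Longrightarrow> X i \<inter> X j = {}"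
    and v: "\<And>i. i \<in> I \<Longrightarrow> v i \<in> qtypes lt C k (X i)"
  obtains c where "range c \<subseteq> els C" "\<And>i. i \<in> I \<Longrightarrow> qtype lt c k (X i) = v i"
proof -
  have "\<forall>i\<in>I. \<exists>c. range c \<subseteq> els C \<and> qtype lt c k (X i) = v i"
    using v unfolding qtypes_def by fastforce
  then obtain cc where cc: "\<And>i. i \<in> I \<Longrightarrow> range (cc i) \<subseteq> els C \<and> qtype lt (cc i) k (X i) = v i"
    by metis
  obtain c0 where c0: "c0 \<in> els C" using C by blast
  define c where "c x = (if \<exists>i\<in>I. x \<in> X i then cc (SOME i. i \<in> I \<and> x \<in> X i) x else c0)" for x
  have c: "c x = cc i x" if "i \<in> I" "x \<in> X i" for i x
  proof -
    have "(SOME i. i \<in> I \<and> x \<in> X i) = i"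
      by (rule some_equality) (use that disj in auto)
    then show ?thesis using that unfolding c_def by auto
  qed
  show thesis
  proof
    show "range c \<subseteq> els C"
    proof (intro image_subsetI)
      fix x
      show "c x \<in> els C"
      proof (cases "\<exists>i\<in>I. x \<in> X i")
        case True
        then obtain i where "i \<in> I" "x \<in> X i" by blast
        then show ?thesis using c cc[of i] by (simp add: image_subset_iff)
      qed (simp add: c_def c0)
    qed
    fix i assume i: "i \<in> I"
    then have "qtype lt c k (X i) = qtype lt (cc i) k (X i)" by (intro qtype_cong) (rule c)
    then show "qtype lt c k (X i) = v i" using cc i by simp
  qed
qed

lemma set_tadd_mono: "A \<subseteq> A' \<Longrightarrow> B \<subseteq> B' \<Longrightarrow> set_tadd k A B \<subseteq> set_tadd k A' B'"
  unfolding set_tadd_def by blast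

context strict_order
begin

lemma before_disj: "before lt A B \<Longrightarrow> A \<inter> B = {}"
  using irr by (auto simp: before_def)

lemma before_seq_disj:
  assumes "\<And>i j. i < j \<Longrightarrow> before lt (A i) (A j)" "i \<noteq> (j :: nat)"
  shows "A i \<inter> A j = {}"
  using before_disj[OF assms(1)[of i j]] before_disj[OF assms(1)[of j i]] assms(2)
  by (cases i j rule: linorder_cases) auto

lemma qtypes_Un:
  assumes C: "els C \<noteq> {}" and b: "before lt A B"
  shows "qtypes lt C k (A \<union> B) = set_tadd k (qtypes lt C k A) (qtypes lt C k B)"
proof (intro subset_antisym subsetI)
  fix t assume "t \<in> qtypes lt C k (A \<union> B)"
  then obtain c where c: "range c \<subseteq> els C" "t = qtype lt c k (A \<union> B)" unfolding qtypes_def by blast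
  then have "t = tadd k (qtype lt c k A) (qtype lt c k B)" using qtype_Un[OF fin_col b] by simp
  then show "t \<in> set_tadd k (qtypes lt C k A) (qtypes lt C k B)"
    using qtypes_I[OF c(1)] unfolding set_tadd_def by blast
next
  fix t assume "t \<in> set_tadd k (qtypes lt C k A) (qtypes lt C k B)"
  then obtain s u where t: "t = tadd k s u" and su: "s \<in> qtypes lt C k A" "u \<in> qtypes lt C k B"
    unfolding set_tadd_def by blast
  obtain c where c: "range c \<subseteq> els C"
    "\<And>i::bool. i \<in> UNIV \<Longrightarrow> qtype lt c k (if i then A else B) = (if i then s else u)"
    by (rule qtypes_merge[OF C, of "UNIV::bool set" "\<lambda>i. if i then A else B" "\<lambda>i. if i then s else u" lt k])
       (use su before_disj[OF b] in auto)
  from c(2)[of True] c(2)[of False] have "qtype lt c k (A \<union> B) = t"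
    using qtype_Un[OF fin_col[OF c(1)] b] t by simp
  then show "t \<in> qtypes lt C k (A \<union> B)" using qtypes_I[OF c(1)] by metis
qed

text \<open>
  For a given coloring, Ramsey's theorem yields cut points between which all blocks together have
  the same type \<open>e\<close>. Conversely, a finite sum \<open>e\<close> of types in \<open>P\<close> is realized on every run of
  consecutive blocks of a length that depends on \<open>e\<close> only, so that the whole sequence can be divided
  into one run for \<open>s\<close> and \<open>\<omega>\<close> runs for \<open>e\<close>.
\<close>

lemma qtypes_omega:
  assumes C: "els C \<noteq> {}" and b: "\<And>i j::nat. i < j \<Longrightarrow> before lt (A i) (A j)"
    and P: "\<And>i. qtypes lt C k (A i) = P"
  shows "qtypes lt C k (\<Union>i. A i) = set_tomega C k P"
proof -
  define U where "U m n = (\<Union>i\<in>{m..<n}. A i)" for m n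
  have bU: "before lt (U m n) (U m' n')" if "n \<le> m'" for m n m' n'
    unfolding before_def
  proof (intro ballI)
    fix x y assume "x \<in> U m n" "y \<in> U m' n'"
    then obtain i j where "x \<in> A i" "y \<in> A j" "i < n" "m' \<le> j" unfolding U_def by auto
    moreover from this that have "i < j" by linarith
    ultimately show "x \<sqsubset> y" using b unfolding before_def by blast
  qed
  have bA: "before lt (U m n) (A n)" for m n using bU[of n n m "Suc n"] unfolding U_def by simp
  have USuc: "U m (Suc n) = U m n \<union> A n" if "m \<le> n" for m n
    using that unfolding U_def by (auto simp: less_Suc_eq)
  have U1: "U m (Suc m) = A m" for m unfolding U_def by simp
  have U_Un: "U m n \<union> U n p = U m p" if "m \<le> n" "n \<le> p" for m n p
    using that unfolding U_def by (simp flip: UN_Un add: ivl_disj_un)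
  have split: "U 0 (h 0) \<union> (\<Union>i. U (h i) (h (Suc i))) = (\<Union>i. A i)" if h: "strict_mono h" for h
  proof (intro subset_antisym subsetI)
    fix x assume "x \<in> (\<Union>i. A i)"
    then obtain i where i: "x \<in> A i" by blast
    have "i < h (Suc i)" using strict_mono_imp_increasing[OF h, of "Suc i"] by linarith
    then have "x \<in> U 0 (h (Suc i))" using i unfolding U_def by auto
    moreover have "U 0 (h n) \<subseteq> U 0 (h 0) \<union> (\<Union>i. U (h i) (h (Suc i)))" for n
    proof (induction n)
      case (Suc n)
      have "U 0 (h (Suc n)) = U 0 (h n) \<union> U (h n) (h (Suc n))"
        using U_Un[of 0 "h n" "h (Suc n)"] h by (simp add: strict_mono_less_eq)
      then show ?case using Suc by blast
    qed simp
    ultimately show "x \<in> U 0 (h 0) \<union> (\<Union>i. U (h i) (h (Suc i)))" by blast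
  qed (auto simp: U_def)
  have bh: "before lt (U (h i) (h (Suc i))) (U (h j) (h (Suc j)))" if "strict_mono h" "i < j" for h i j
    by (rule bU) (use that in \<open>simp add: strict_mono_less_eq\<close>)
  have bh0: "before lt (U 0 (h 0)) (\<Union>i. U (h i) (h (Suc i)))" if "strict_mono h" for h
    using bU[of "h 0" "h i" 0 "h (Suc i)" for i] that
    unfolding before_def by (auto simp: strict_mono_less_eq)
  show ?thesis
  proof (intro subset_antisym subsetI)
    fix t assume "t \<in> qtypes lt C k (\<Union>i. A i)"
    then obtain c where c: "range c \<subseteq> els C" "t = qtype lt c k (\<Union>i. A i)" unfolding qtypes_def by blast
    note fc = fin_col[OF c(1)]
    have in_pl: "qtype lt c k (U m n) \<in> tsums k P" if "m < n" for m n
      using that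
    proof (induction n)
      case (Suc n)
      have A: "qtype lt c k (A n) \<in> P" using qtypes_I[OF c(1)] P by blast
      show ?case
      proof (cases "m = n")
        case True then show ?thesis using A U1 by (auto intro: tsums.base)
      next
        case False
        then have "m < n" using Suc.prems by simp
        then show ?thesis using Suc.IH A bA[of m n] by (auto simp: USuc qtype_Un[OF fc] intro!: tsums.step)
      qed
    qed simp
    obtain s where s: "\<And>v. v \<in> els (universe C k) \<Longrightarrow> v < s" using bounded_universe by blast
    \<comment> \<open>A pair \<open>i < j\<close> is colored by the type of the blocks from \<open>i\<close> up to,
      but excluding, \<open>j\<close>. The cut points avoid \<open>0\<close>, so that the piece before
      the first one is nonempty.\<close>
    define f where "f Y = qtype lt c k (U (Min Y) (Max Y))" for Y
    have "f Y < s" for Y unfolding f_def by (rule s, rule qtypes_universe, rule qtypes_I[OF c(1)])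
    then obtain Y e where Y: "Y \<subseteq> {1..}" "infinite Y" "\<forall>x\<in>Y. \<forall>y\<in>Y. x \<noteq> y \<longrightarrow> f {x, y} = e"
      using Ramsey2[of "{1::nat..}" f s] infinite_Ici[of "1::nat"] by auto
    define h where "h = enumerate Y"
    have h: "strict_mono h" unfolding h_def using strict_mono_enumerate[OF Y(2)] .
    have hY: "h i \<in> Y" for i unfolding h_def by (rule enumerate_in_set[OF Y(2)])
    have he: "qtype lt c k (U (h i) (h j)) = e" if "i < j" for i j
    proof -
      have "h i < h j" using h that by (simp add: strict_mono_less)
      then have "f {h i, h j} = qtype lt c k (U (h i) (h j))" unfolding f_def by simp
      moreover have "f {h i, h j} = e" using Y(3) hY \<open>h i < h j\<close> by (metis less_irrefl)
      ultimately show ?thesis by simp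
    qed
    have "qtype lt c k (\<Union>i. U (h i) (h (Suc i))) = tomega C k e"
      by (rule qtype_UN_omega[OF c(1)]) (use bh[OF h] he in auto)
    then have "t = tadd k (qtype lt c k (U 0 (h 0))) (tomega C k e)"
      unfolding c(2) split[OF h, symmetric] qtype_Un[OF fc bh0[OF h]] by simp
    moreover have "0 < h 0" using hY[of 0] Y(1) by auto
    then have "qtype lt c k (U 0 (h 0)) \<in> tsums k P" by (rule in_pl)
    moreover have "h 0 < h 1" using h by (simp add: strict_mono_less)
    then have "e \<in> tsums k P" using he[of 0 1] in_pl[of "h 0" "h 1"] by simp
    ultimately show "t \<in> set_tomega C k P" unfolding set_tomega_def by blast
  next
    fix t assume "t \<in> set_tomega C k P"
    then obtain s e where t: "t = tadd k s (tomega C k e)" and se: "s \<in> tsums k P" "e \<in> tsums k P"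
      unfolding set_tomega_def by blast
    have len: "\<exists>l\<ge>1. \<forall>m. x \<in> qtypes lt C k (U m (m + l))" if "x \<in> tsums k P" for x
      using that
    proof (induction rule: tsums.induct)
      case (base x)
      then have "\<forall>m. x \<in> qtypes lt C k (U m (m + 1))" using P U1 by simp
      then show ?case by blast
    next
      case (step s t)
      then obtain l where l: "l \<ge> 1" "\<And>m. s \<in> qtypes lt C k (U m (m + l))" by blast
      have "tadd k s t \<in> qtypes lt C k (U m (m + Suc l))" for m
        using l(2)[of m] P[of "m + l"] step.hyps(2) bA[of m "m + l"]
        by (auto simp: USuc qtypes_Un[OF C] set_tadd_def)
      then show ?case using l(1) by (meson le_Suc_eq)
    qed
    obtain l where l: "l \<ge> 1" "\<And>m. s \<in> qtypes lt C k (U m (m + l))" using len[OF se(1)] by blast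
    obtain p where p: "p \<ge> 1" "\<And>m. e \<in> qtypes lt C k (U m (m + p))" using len[OF se(2)] by blast
    define h where "h i = l + i * p" for i
    have h: "strict_mono h" unfolding h_def strict_mono_Suc_iff using p(1) by simp
    have hS: "h (Suc i) = h i + p" for i unfolding h_def by simp
    define X where "X i = (case i of 0 \<Rightarrow> U 0 (h 0) | Suc j \<Rightarrow> U (h j) (h (Suc j)))" for i
    have bX: "before lt (X i) (X j)" if "i < j" for i j
      using that h unfolding X_def by (auto split: nat.splits intro!: bU simp: strict_mono_less_eq)
    obtain c where c: "range c \<subseteq> els C" "\<And>i. i \<in> UNIV \<Longrightarrow> qtype lt c k (X i) = (if i = 0 then s else e)"
    proof (rule qtypes_merge[OF C, of UNIV X "\<lambda>i. if i = 0 then s else e" lt k])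
      show "(if i = 0 then s else e) \<in> qtypes lt C k (X i)" for i
      proof (cases i)
        case 0 then show ?thesis using l(2)[of 0] unfolding X_def by (simp add: h_def)
      next
        case (Suc j) then show ?thesis using p(2)[of "h j"] unfolding X_def by (simp add: hS)
      qed
      show "X i \<inter> X j = {}" if "i \<noteq> j" for i j by (rule before_seq_disj[OF bX that])
    qed blast
    have 0: "qtype lt c k (U 0 (h 0)) = s" using c(2)[of 0] unfolding X_def by simp
    have "qtype lt c k (U (h i) (h (Suc i))) = e" for i using c(2)[of "Suc i"] unfolding X_def by simp
    then have "qtype lt c k (\<Union>i. U (h i) (h (Suc i))) = tomega C k e"
      by (intro qtype_UN_omega[OF c(1)]) (use bh[OF h] in auto)
    then have "qtype lt c k (\<Union>i. A i) = t"
      unfolding split[OF h, symmetric] qtype_Un[OF fin_col[OF c(1)] bh0[OF h]] t 0 by simp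
    then show "t \<in> qtypes lt C k (\<Union>i. A i)" using qtypes_I[OF c(1)] by metis
  qed
qed

lemma qtype_singleton: "qtype lt c k {x} = point_type k (c x)"
proof (cases k)
  case (Suc m)
  have e: "{y \<in> {x}. y \<sqsubset> x} = {}" "{y \<in> {x}. x \<sqsubset> y} = {}" using irr by auto
  show ?thesis unfolding Suc by (simp only: qtype.simps e image_insert image_empty qtype_empty point_type.simps)
qed simp

lemma qtypes_singleton:
  "qtypes lt C k {x} = point_type k ` els C"
proof (intro subset_antisym subsetI)
  fix t assume "t \<in> point_type k ` els C"
  then obtain a where a: "a \<in> els C" "t = point_type k a" by blast
  then have "t = qtype lt (\<lambda>_. a) k {x}" by (simp add: qtype_singleton)
  then show "t \<in> qtypes lt C k {x}" using a(1) qtypes_I[of "\<lambda>_. a" C lt k "{x}"] by auto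
qed (auto simp: qtypes_def qtype_singleton)

lemma qtypes_omega_block:
  assumes C: "els C \<noteq> {}"
  shows "omega_block lt n X \<Longrightarrow> qtypes lt C k X = power_types C k n"
proof (induction n arbitrary: X)
  case 0 then show ?case by (auto simp: qtypes_singleton)
next
  case (Suc n)
  then obtain A where A: "\<And>i::nat. omega_block lt n (A i)" "\<And>i j. i < j \<Longrightarrow> before lt (A i) (A j)" "X = (\<Union>i. A i)"
    by auto
  then show ?case using qtypes_omega[OF C A(2), where k=k and P="power_types C k n"] Suc.IH[OF A(1)] by simp
qed

text \<open>
  The absorption law \<open>\<omega>\<^sup>m + \<omega>\<^sup>n = \<omega>\<^sup>n\<close> for \<open>m < n\<close>.
\<close>

lemma omega_block_split:
  "omega_block lt n X \<Longrightarrow> m < n \<Longrightarrow> \<exists>A B. X = A \<union> B \<and> before lt A B \<and> omega_block lt m A \<and> omega_block lt n B"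
proof (induction n arbitrary: X)
  case (Suc n)
  then obtain A where A: "\<And>i::nat. omega_block lt n (A i)" "\<And>i j. i < j \<Longrightarrow> before lt (A i) (A j)" "X = (\<Union>i. A i)"
    by auto
  show ?case
  proof (cases "m = n")
    case True
    have "X = A 0 \<union> (\<Union>i. A (Suc i))" unfolding A(3)
    proof (intro subset_antisym subsetI)
      fix x assume "x \<in> (\<Union>i. A i)"
      then obtain i where "x \<in> A i" by blast
      then show "x \<in> A 0 \<union> (\<Union>i. A (Suc i))" by (cases i) auto
    qed blast
    moreover have "before lt (A 0) (\<Union>i. A (Suc i))" using A(2) by (auto simp: before_def)
    moreover have "omega_block lt (Suc n) (\<Union>i. A (Suc i))"
      unfolding omega_block.simps by (rule exI[of _ "\<lambda>i. A (Suc i)"]) (simp add: A(1,2))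
    ultimately show ?thesis using A(1) True by blast
  next
    case False
    then obtain D E where DE: "A 0 = D \<union> E" "before lt D E" "omega_block lt m D" "omega_block lt n E"
      using Suc.IH[OF A(1)[of 0]] Suc.prems(2) by auto
    define A' where "A' i = (if i = 0 then E else A i)" for i
    have "omega_block lt (Suc n) (\<Union>i. A' i)"
    proof -
      have "before lt (A' i) (A' j)" if "i < j" for i j
        using A(2)[OF that] that DE(1) unfolding A'_def before_def by auto
      moreover have "omega_block lt n (A' i)" for i unfolding A'_def using A(1) DE(4) by simp
      ultimately show ?thesis unfolding omega_block.simps by (intro exI[of _ A']) simp
    qed
    moreover have "X = D \<union> (\<Union>i. A' i)"
    proof -
      have "(\<Union>i. B i) = B 0 \<union> (\<Union>i. B (Suc i))" for B :: "nat \<Rightarrow> 'a set"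
      proof (intro subset_antisym subsetI)
        fix x assume "x \<in> (\<Union>i. B i)"
        then obtain i where "x \<in> B i" by blast
        then show "x \<in> B 0 \<union> (\<Union>i. B (Suc i))" by (cases i) auto
      qed blast
      from this[of A] this[of A'] show ?thesis unfolding A(3) by (simp add: A'_def DE(1) Un_assoc)
    qed
    moreover have "before lt D (\<Union>i. A' i)"
    proof -
      have "d \<sqsubset> x" if "d \<in> D" "x \<in> A' i" for d x i
        using that DE(1,2) A(2)[of 0 i] unfolding A'_def before_def by (auto split: if_splits)
      then show ?thesis unfolding before_def by blast
    qed
    ultimately show ?thesis using DE(3) by blast
  qed
qed simp

lemma power_types_absorb: 
  assumes C: "els C \<noteq> {}" and X: "omega_block lt n X" and "m < n"
  shows "set_tadd k (power_types C k m) (power_types C k n) = power_types C k n"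
proof -
  obtain A B where AB: "X = A \<union> B" "before lt A B" "omega_block lt m A" "omega_block lt n B"
    using omega_block_split[OF X assms(3)] by blast
  have "qtypes lt C k X = set_tadd k (qtypes lt C k A) (qtypes lt C k B)" unfolding AB(1) by (rule qtypes_Un[OF C AB(2)])
  then show ?thesis using qtypes_omega_block[OF C] X AB(3,4) by simp
qed

text \<open>
  Divide \<open>\<omega>\<^sup>n\<^sup>+\<^sup>2\<close> into \<open>\<omega>\<close> pieces \<open>D\<^sub>i + E\<^sub>i\<close>, with \<open>D\<^sub>i\<close> of type \<open>\<omega>\<^sup>n\<close> and \<open>E\<^sub>i\<close> of type \<open>\<omega>\<^sup>n\<^sup>+\<^sup>1\<close>, and regroup
  it as \<open>D\<^sub>0 + (E\<^sub>0 + D\<^sub>1) + (E\<^sub>1 + D\<^sub>2) + \<dots>\<close>. If the set of types of \<open>\<omega>\<^sup>n\<^sup>+\<^sup>1 + \<omega>\<^sup>n\<close> is that of \<open>\<omega>\<^sup>n\<close>, then the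
  regrouped pieces cannot be told from copies of \<open>\<omega>\<^sup>n\<close>.
\<close>

lemma power_types_collapse:
  assumes C: "els C \<noteq> {}" and X: "omega_block lt (Suc (Suc n)) X"
    and cyc: "set_tadd k (power_types C k (Suc n)) (power_types C k n) = power_types C k n"
  shows "power_types C k (Suc (Suc n)) = power_types C k (Suc n)"
proof -
  obtain A where A: "\<And>i::nat. omega_block lt (Suc n) (A i)" "\<And>i j. i < j \<Longrightarrow> before lt (A i) (A j)" "X = (\<Union>i. A i)"
    using X by (auto simp del: omega_block.simps(1))
  have "\<exists>D E. A i = D \<union> E \<and> before lt D E \<and> omega_block lt n D \<and> omega_block lt (Suc n) E" for i
    using omega_block_split[OF A(1)[of i], of n] by simp
  then obtain D E where DE: "\<And>i. A i = D i \<union> E i" "\<And>i. before lt (D i) (E i)"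
    "\<And>i. omega_block lt n (D i)" "\<And>i. omega_block lt (Suc n) (E i)" by metis
  have bl: "a \<sqsubset> b" if "a \<in> A i" "b \<in> A j" "i < j" for a b i j
    using A(2)[OF that(3)] that by (auto simp: before_def)
  define F where "F i = E i \<union> D (Suc i)" for i
  have "qtypes lt C k (F i) = power_types C k n" for i
  proof -
    have "before lt (E i) (D (Suc i))" using bl[of _ i _ "Suc i"] DE(1) by (auto simp: before_def)
    then show ?thesis unfolding F_def
      using qtypes_Un[OF C] qtypes_omega_block[OF C DE(3)] qtypes_omega_block[OF C DE(4)] cyc by simp
  qed
  moreover have bF: "before lt (F i) (F j)" if "i < j" for i j
  proof -
    have "before lt (E i) (E j)" "before lt (E i) (D (Suc j))" "before lt (D (Suc i)) (D (Suc j))"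
      using bl[of _ i _ j] bl[of _ i _ "Suc j"] bl[of _ "Suc i" _ "Suc j"] that DE(1)
      by (auto simp: before_def)
    moreover have "before lt (D (Suc i)) (E j)"
    proof (cases "j = Suc i")
      case False then show ?thesis using bl[of _ "Suc i" _ j] that DE(1) by (auto simp: before_def)
    qed (use DE(2) in simp)
    ultimately show ?thesis unfolding F_def before_def by blast
  qed
  ultimately have 1: "qtypes lt C k (\<Union>i. F i) = power_types C k (Suc n)"
    using qtypes_omega[OF C bF] by simp
  have "X = D 0 \<union> (\<Union>i. F i)"
  proof (intro subset_antisym subsetI)
    fix x assume "x \<in> X"
    then obtain i where "x \<in> D i \<or> x \<in> E i" using A(3) DE(1) by blast
    then show "x \<in> D 0 \<union> (\<Union>i. F i)" unfolding F_def by (cases i) auto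
  qed (use A(3) DE(1) in \<open>auto simp: F_def\<close>)
  moreover have "before lt (D 0) (\<Union>i. F i)"
  proof -
    have "x \<sqsubset> y" if x: "x \<in> D 0" and y: "y \<in> F i" for x y i
    proof (cases "y \<in> E i")
      case True
      then show ?thesis using bl[of x 0 y i] DE(1) DE(2)[of 0] x unfolding before_def by (cases "i = 0") auto
    next
      case False
      then have "y \<in> D (Suc i)" using y unfolding F_def by blast
      then show ?thesis using bl[of x 0 y "Suc i"] DE(1) x by blast
    qed
    then show ?thesis unfolding before_def by blast
  qed
  ultimately have "qtypes lt C k X = set_tadd k (power_types C k n) (power_types C k (Suc n))"
    using qtypes_Un[OF C] qtypes_omega_block[OF C DE(3)] 1 by simp
  also have "\<dots> = power_types C k (Suc n)" using power_types_absorb[OF C DE(4)[of 0], of n] by simp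
  finally show ?thesis using qtypes_omega_block[OF C X] by simp
qed

end

section \<open>Laws of addition and omega-powers\<close>

interpretation rat_ord: strict_order "(<) :: rat \<Rightarrow> rat \<Rightarrow> bool"
  by standard auto

text \<open>
  A type that occurs inside every rational interval. Realizable types can be laid out one after
  the other in a single order, and every law of the algebra of types then follows by dividing the
  same order in two ways. The types of the colorings of \<open>\<omega>\<^sup>n\<close> are realizable because every rational
  interval contains a copy of \<open>\<omega>\<^sup>n\<close>.
\<close>

definition realizable :: "nat \<Rightarrow> nat \<Rightarrow> nat \<Rightarrow> bool" where
  "realizable C k t \<longleftrightarrow> (\<forall>a b::rat. a < b \<longrightarrow> (\<exists>X\<subseteq>{a<..<b}. t \<in> qtypes (<) C k X))"

lemma rat_intervals:
  assumes "a < (b::rat)"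
  obtains q :: "nat \<Rightarrow> rat" where "\<And>i. a \<le> q i" "\<And>i. q i < b" "\<And>i j. i < j \<Longrightarrow> q i < q j"
proof
  define q where "q i = b - (b - a) / (of_nat i + 1)" for i :: nat
  have pos: "0 < b - a" using assms by simp
  show "a \<le> q i" for i
  proof -
    have "(b - a) / (of_nat i + 1) \<le> (b - a) / 1"
      by (rule divide_left_mono) (use pos in auto)
    then show ?thesis unfolding q_def by simp
  qed
  show "q i < b" for i unfolding q_def using pos by (simp add: add_nonneg_pos)
  show "q i < q j" if "i < j" for i j
  proof -
    have "(b - a) / (of_nat j + 1) < (b - a) / (of_nat i + 1)"
      by (rule divide_strict_left_mono) (use pos that in \<open>auto simp: add_nonneg_pos\<close>)
    then show ?thesis unfolding q_def by simp
  qed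
qed

lemma rat_seq:
  assumes "a < (b::rat)" "\<And>i (a::rat) b. a < b \<Longrightarrow> \<exists>X\<subseteq>{a<..<b}. P i X"
  shows "\<exists>X. (\<forall>i::nat. X i \<subseteq> {a<..<b}) \<and> (\<forall>i j. i < j \<longrightarrow> before (<) (X i) (X j)) \<and> (\<forall>i. P i (X i))"
proof -
  obtain q where q: "\<And>i. a \<le> q i" "\<And>i. q i < b" "\<And>i j::nat. i < j \<Longrightarrow> q i < q j"
    using rat_intervals[OF assms(1)] by blast
  have "\<forall>i. \<exists>X\<subseteq>{q i<..<q (Suc i)}. P i X" using assms(2) q(3) by simp
  then obtain X where X: "\<And>i. X i \<subseteq> {q i<..<q (Suc i)}" "\<And>i. P i (X i)" by metis
  have "X i \<subseteq> {a<..<b}" for i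
  proof
    fix x assume "x \<in> X i"
    then have "q i < x" "x < q (Suc i)" using X(1)[of i] by auto
    then show "x \<in> {a<..<b}" using q(1)[of i] q(2)[of "Suc i"] by auto
  qed
  moreover have "before (<) (X i) (X j)" if "i < j" for i j
    unfolding before_def
  proof (intro ballI)
    fix x y assume "x \<in> X i" "y \<in> X j"
    then have "x < q (Suc i)" "q j < y" using X(1)[of i] X(1)[of j] by auto
    moreover have "q (Suc i) \<le> q j" using q(3)[of "Suc i" j] that by (cases "Suc i = j") auto
    ultimately show "x < y" by linarith
  qed
  ultimately show ?thesis using X(2) by (intro exI[of _ X]) simp
qed

lemma rat_omega_block: "a < b \<Longrightarrow> \<exists>X\<subseteq>{a<..<b::rat}. omega_block (<) n X"
proof (induction n arbitrary: a b)
  case 0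
  then obtain x where "a < x" "x < b" using dense by blast
  then have "{x} \<subseteq> {a<..<b}" "omega_block (<) 0 {x}" by auto
  then show ?case by blast
next
  case (Suc n)
  obtain X where X: "\<And>i::nat. X i \<subseteq> {a<..<b}" "\<And>i j. i < j \<Longrightarrow> before (<) (X i) (X j)" "\<And>i. omega_block (<) n (X i)"
    using rat_seq[where P="\<lambda>i X. omega_block (<) n X", OF Suc.prems Suc.IH] by auto
  then have "omega_block (<) (Suc n) (\<Union>i. X i)" unfolding omega_block.simps by (intro exI[of _ X]) simp
  then show ?case using X(1) by blast
qed

lemma qtypes_eqI: "range c \<subseteq> els C \<Longrightarrow> qtype lt c k X = t \<Longrightarrow> t \<in> qtypes lt C k X"
  unfolding qtypes_def by blast

lemma finite_range_repeats:
  fixes f :: "nat \<Rightarrow> 'b"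
  assumes "finite (range f)"
  obtains i j where "i < j" "f i = f j"
proof -
  have "\<not> inj f" using finite_imageD[OF assms] infinite_UNIV_nat by auto
  then obtain i j where ij: "f i = f j" "i \<noteq> j" unfolding inj_on_def by auto
  then show thesis using that[of i j] that[of j i] by (cases "i < j") auto
qed

lemma UN_nat_split: "(\<Union>i. B i) = B 0 \<union> (\<Union>i. B (Suc i))"
proof (intro subset_antisym subsetI)
  fix x assume "x \<in> (\<Union>i. B i)"
  then obtain i where "x \<in> B i" by blast
  then show "x \<in> B 0 \<union> (\<Union>i. B (Suc i))" by (cases i) auto
qed blast

lemma UN_nat_pairs: "(\<Union>i. B i) = (\<Union>i. B (2 * i) \<union> B (Suc (2 * i)))"
proof (intro subset_antisym subsetI)
  fix x assume "x \<in> (\<Union>i. B i)"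
  then obtain i where i: "x \<in> B i" by blast
  show "x \<in> (\<Union>i. B (2 * i) \<union> B (Suc (2 * i)))"
  proof (cases "even i")
    case True then show ?thesis using i by (auto elim!: evenE)
  next
    case False then show ?thesis using i by (auto elim!: oddE)
  qed
qed blast

context
  fixes C :: nat
  assumes C: "els C \<noteq> {}"
begin

lemma realizable_seq:
  assumes "\<And>i::nat. realizable C k (v i)" "a < (b::rat)"
  obtains c X where "range c \<subseteq> els C" "\<And>i. X i \<subseteq> {a<..<b}"
    "\<And>i j. i < j \<Longrightarrow> before (<) (X i) (X j)" "\<And>i. qtype (<) c k (X i) = v i"
proof -
  have ex: "\<exists>X\<subseteq>{a<..<b}. v i \<in> qtypes (<) C k X" if "a < b" for a b :: rat and i
    using assms(1)[of i] that unfolding realizable_def by blast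
  obtain X where X: "\<And>i::nat. X i \<subseteq> {a<..<b}" "\<And>i j. i < j \<Longrightarrow> before (<) (X i) (X j)"
     "\<And>i. v i \<in> qtypes (<) C k (X i)"
    using rat_seq[where P="\<lambda>i X. v i \<in> qtypes (<) C k X", OF assms(2) ex] by auto
  obtain c where "range c \<subseteq> els C" "\<And>i. i \<in> UNIV \<Longrightarrow> qtype (<) c k (X i) = v i"
  proof (rule qtypes_merge[OF C, of UNIV X v "(<)" k])
    show "X i \<inter> X j = {}" if "i \<noteq> j" for i j by (rule rat_ord.before_seq_disj[OF X(2) that])
  qed (use X(3) in auto)
  then show thesis by (intro that[of c X] X) auto
qed

lemma realizable_universe: "realizable C k t \<Longrightarrow> t \<in> els (universe C k)"
proof -
  assume "realizable C k t"
  then obtain X :: "rat set" where "t \<in> qtypes (<) C k X"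
    unfolding realizable_def using zero_less_one[where 'a=rat] by meson
  then show ?thesis by (rule qtypes_universe)
qed

lemma realizable_power_types: "t \<in> power_types C k n \<Longrightarrow> realizable C k t"
  unfolding realizable_def
proof (intro allI impI)
  fix a b :: rat assume t: "t \<in> power_types C k n" and "a < b"
  then obtain X where X: "X \<subseteq> {a<..<b}" "omega_block (<) n X" using rat_omega_block by blast
  from t have "t \<in> qtypes (<) C k X" unfolding rat_ord.qtypes_omega_block[OF C X(2)] .
  with X(1) show "\<exists>X\<subseteq>{a<..<b}. t \<in> qtypes (<) C k X" by blast
qed

lemma realizable_0: "realizable C k 0"
proof -
  obtain c0 where "c0 \<in> els C" using C by blast
  then have c0: "range (\<lambda>_::rat. c0) \<subseteq> els C" by auto
  have "qtype (<) (\<lambda>_. c0) k ({}::rat set) \<in> qtypes (<) C k ({}::rat set)" by (rule qtypes_I[OF c0])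
  then have "0 \<in> qtypes (<) C k ({}::rat set)" unfolding qtype_empty .
  then have "\<exists>X\<subseteq>{a<..<b}. 0 \<in> qtypes (<) C k X" for a b :: rat
    by (intro exI[of _ "{}"]) simp
  then show ?thesis unfolding realizable_def by simp
qed

lemma realizable_trunc:
  assumes "realizable C (Suc k) e"
  shows "realizable C k (trunc k e)"
  unfolding realizable_def
proof (intro allI impI)
  fix a b :: rat assume "a < b"
  then obtain X where X: "X \<subseteq> {a<..<b}" "e \<in> qtypes (<) C (Suc k) X" using assms unfolding realizable_def by blast
  then obtain c where c: "range c \<subseteq> els C" "e = qtype (<) c (Suc k) X" unfolding qtypes_def by blast
  have "finite (c ` X)" by (rule finite_subset[OF _ fin_col[OF c(1)]]) auto
  then have "trunc k e = qtype (<) c k X" unfolding c(2) by (rule trunc_qtype)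
  then show "\<exists>X\<subseteq>{a<..<b}. trunc k e \<in> qtypes (<) C k X" using X(1) qtypes_I[OF c(1)] by metis
qed

lemma realizable_list:
  assumes "\<And>i::nat. realizable C k (v i)"
  obtains c and X :: "nat \<Rightarrow> rat set" where "range c \<subseteq> els C"
    "\<And>i j. i < j \<Longrightarrow> before (<) (X i) (X j)" "\<And>i. qtype (<) c k (X i) = v i"
proof (rule realizable_seq[OF assms zero_less_one])
qed (rule that)

lemma tadd_assoc:
  assumes "realizable C k s" "realizable C k t" "realizable C k u"
  shows "tadd k (tadd k s t) u = tadd k s (tadd k t u)"
proof -
  have rzv: "realizable C k (if i = 0 then s else if i = 1 then t else u)" for i :: nat using assms by simp
  obtain c and X :: "nat \<Rightarrow> rat set" where X: "range c \<subseteq> els C"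
    "\<And>i j. i < j \<Longrightarrow> before (<) (X i) (X j)" "\<And>i. qtype (<) c k (X i) = (if i = 0 then s else if i = 1 then t else u)"
    by (rule realizable_list[OF rzv], rule that)
  note T = rat_ord.qtype_Un[OF fin_col[OF X(1)]]
  have b: "before (<) (X 0) (X 1)" "before (<) (X 0) (X 2)" "before (<) (X 1) (X 2)" by (auto intro!: X(2))
  have b': "before (<) (X 0 \<union> X 1) (X 2)" "before (<) (X 0) (X 1 \<union> X 2)"
    using b by (auto simp: before_def)
  have "qtype (<) c k ((X 0 \<union> X 1) \<union> X 2) = tadd k (tadd k s t) u"
    using T[OF b'(1)] T[OF b(1)] X(3) by simp
  moreover have "qtype (<) c k (X 0 \<union> (X 1 \<union> X 2)) = tadd k s (tadd k t u)"
    using T[OF b'(2)] T[OF b(3)] X(3) by simp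
  ultimately show ?thesis by (simp only: Un_assoc)
qed

lemma tadd_0:
  assumes "realizable C k t"
  shows "tadd k 0 t = t" "tadd k t 0 = t"
proof -
  obtain c and X :: "nat \<Rightarrow> rat set" where X: "range c \<subseteq> els C"
    "\<And>i j. i < j \<Longrightarrow> before (<) (X i) (X j)" "\<And>i. qtype (<) c k (X i) = t"
    by (rule realizable_list[where v="\<lambda>_. t", OF assms], rule that)
  have b: "before (<) {} (X 0)" "before (<) (X 0) {}" by (auto simp: before_def)
  from rat_ord.qtype_Un[OF fin_col[OF X(1)] b(1), of k] rat_ord.qtype_Un[OF fin_col[OF X(1)] b(2), of k]
  show "tadd k 0 t = t" "tadd k t 0 = t" using X(3)[of 0] by simp_all
qed

lemma tomega_unfold:
  assumes "realizable C k e"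
  shows "tadd k e (tomega C k e) = tomega C k e"
proof -
  obtain c and X :: "nat \<Rightarrow> rat set" where X: "range c \<subseteq> els C"
    "\<And>i j. i < j \<Longrightarrow> before (<) (X i) (X j)" "\<And>i. qtype (<) c k (X i) = e"
    by (rule realizable_list[where v="\<lambda>_. e", OF assms], rule that)
  have "qtype (<) c k (\<Union>i. X (Suc i)) = tomega C k e" "qtype (<) c k (\<Union>i. X i) = tomega C k e"
    by (rule rat_ord.qtype_UN_omega[OF X(1)]; simp add: X(2,3))+
  moreover have "before (<) (X 0) (\<Union>i. X (Suc i))"
    using X(2)[OF zero_less_Suc] unfolding before_def by blast
  ultimately show ?thesis
    using rat_ord.qtype_Un[OF fin_col[OF X(1)], of "X 0" "\<Union>i. X (Suc i)" k] X(3)[of 0] UN_nat_split[of X] by simp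
qed

text \<open>
  Both sides are the type of the alternating sum \<open>s + t + s + t + \<dots>\<close>.
\<close>

lemma tomega_rotate:
  assumes "realizable C k s" "realizable C k t"
  shows "tomega C k (tadd k s t) = tadd k s (tomega C k (tadd k t s))"
proof -
  have rzv: "realizable C k (if even i then s else t)" for i :: nat using assms by simp
  obtain c and X :: "nat \<Rightarrow> rat set" where X: "range c \<subseteq> els C"
    "\<And>i j. i < j \<Longrightarrow> before (<) (X i) (X j)" "\<And>i. qtype (<) c k (X i) = (if even i then s else t)"
    by (rule realizable_list[OF rzv], rule that)
  note T = rat_ord.qtype_Un[OF fin_col[OF X(1)]]
  have bb: "before (<) (X i \<union> X (Suc i)) (X j \<union> X (Suc j))" if "Suc i < j" for i j
  proof -
    have "before (<) (X i) (X j)" "before (<) (X (Suc i)) (X j)"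
      "before (<) (X i) (X (Suc j))" "before (<) (X (Suc i)) (X (Suc j))"
      using that by (auto intro!: X(2))
    then show ?thesis unfolding before_def by blast
  qed
  have t: "qtype (<) c k (X i \<union> X (Suc i)) = (if even i then tadd k s t else tadd k t s)" for i
    using T[OF X(2)[of i "Suc i"]] X(3) by simp
  have "qtype (<) c k (\<Union>i. X (2 * i) \<union> X (Suc (2 * i))) = tomega C k (tadd k s t)"
    by (rule rat_ord.qtype_UN_omega[OF X(1)]) (simp_all add: bb t)
  moreover have "qtype (<) c k (\<Union>i. X (Suc (2 * i)) \<union> X (Suc (Suc (2 * i)))) = tomega C k (tadd k t s)"
    by (rule rat_ord.qtype_UN_omega[OF X(1)]) (simp_all add: bb t)
  moreover have "before (<) (X 0) (\<Union>i. X (Suc (2 * i)) \<union> X (Suc (Suc (2 * i))))"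
    using X(2)[OF zero_less_Suc] unfolding before_def by blast
  moreover have "(\<Union>i. X (2 * i) \<union> X (Suc (2 * i))) = X 0 \<union> (\<Union>i. X (Suc (2 * i)) \<union> X (Suc (Suc (2 * i))))"
    using UN_nat_pairs[of X] UN_nat_split[of X] UN_nat_pairs[of "\<lambda>i. X (Suc i)"] by simp
  ultimately show ?thesis
    using T[of "X 0" "\<Union>i. X (Suc (2 * i)) \<union> X (Suc (Suc (2 * i)))"] X(3)[of 0] by simp
qed

lemma trunc_tomega:
  assumes "realizable C (Suc k) e"
  shows "trunc k (tomega C (Suc k) e) = tomega C k (trunc k e)"
proof -
  obtain c and X :: "nat \<Rightarrow> rat set" where X: "range c \<subseteq> els C"
    "\<And>i j. i < j \<Longrightarrow> before (<) (X i) (X j)" "\<And>i. qtype (<) c (Suc k) (X i) = e"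
    by (rule realizable_list[where v="\<lambda>_. e", OF assms], rule that)
  have fin: "finite (c ` Y)" for Y by (rule finite_subset[OF _ fin_col[OF X(1)]]) auto
  have "qtype (<) c k (X i) = trunc k e" for i using trunc_qtype[OF fin, of k "(<)" "X i"] X(3)[of i] by simp
  then have "qtype (<) c k (\<Union>i. X i) = tomega C k (trunc k e)"
    by (intro rat_ord.qtype_UN_omega[OF X(1,2)])
  moreover have "qtype (<) c (Suc k) (\<Union>i. X i) = tomega C (Suc k) e"
    by (rule rat_ord.qtype_UN_omega[OF X(1,2,3)])
  ultimately show ?thesis using trunc_qtype[OF fin, of k "(<)" "\<Union>i. X i"] by simp
qed

text \<open>
  By the pigeonhole principle \<open>S\<^sub>i = S\<^sub>j\<close> for some \<open>i < j\<close>. Unless \<open>j = i + 1\<close>, absorption gives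
  \<open>S\<^sub>i\<^sub>+\<^sub>1 + S\<^sub>i = S\<^sub>i\<^sub>+\<^sub>1 + S\<^sub>j = S\<^sub>j = S\<^sub>i\<close>, and the collapse applies.
\<close>

lemma power_types_stable: "\<exists>N. power_types C k (Suc N) = power_types C k N"
proof -
  have "power_types C k n \<in> Pow (els (universe C k))" for n using realizable_universe[OF realizable_power_types] by blast
  then have "range (power_types C k) \<subseteq> Pow (els (universe C k))" by (simp add: image_subset_iff)
  then have fr: "finite (range (power_types C k))" by (rule finite_subset) simp
  obtain i j where ij: "i < j" "power_types C k i = power_types C k j" by (rule finite_range_repeats[OF fr], rule that)
  show ?thesis
  proof (cases "j = Suc i")
    case False
    then have lt: "Suc i < j" using ij(1) by simp
    obtain X :: "rat set" where "omega_block (<) j X" using rat_omega_block[of 0 1 j] by auto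
    from rat_ord.power_types_absorb[OF C this lt, of k] have "set_tadd k (power_types C k (Suc i)) (power_types C k i) = power_types C k i"
      unfolding ij(2) .
    moreover obtain Y :: "rat set" where "omega_block (<) (Suc (Suc i)) Y" using rat_omega_block[of 0 1 "Suc (Suc i)"] by auto
    ultimately show ?thesis using rat_ord.power_types_collapse[OF C] by blast
  qed (use ij in metis)
qed

end

section \<open>Stable sets of types\<close>

text \<open>
  The properties of the limit \<open>E\<close> of the sets of types of the colorings of \<open>\<omega>\<^sup>n\<close> on which the treatment
  of infinite exponents rests.
\<close>

locale stable =
  fixes C k :: nat and E :: "nat set"
  assumes C: "els C \<noteq> {}" and rzE: "e \<in> E \<Longrightarrow> realizable C k e"
    and EE: "set_tadd k E E = E" and OmE: "set_tomega C k E = E"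
begin

abbreviation pls (infixl "\<oplus>" 65) where "s \<oplus> t \<equiv> tadd k s t"
abbreviation w where "w \<equiv> tomega C k"

text \<open>
  The types of the colorings of a sum of uncountable cofinality, see \<open>qtypes_uncountable_cofinality\<close>.
\<close>

definition U :: "nat set" where "U = {s \<oplus> g | s g. s \<in> E \<and> g \<in> E \<and> w g = g}"
text \<open>
  With the type \<open>0\<close> of the empty order as neutral element, divisors can be written with two factors
  without case distinctions.
\<close>

definition E0 :: "nat set" where "E0 = insert 0 E"

lemma E_add: "s \<in> E \<Longrightarrow> t \<in> E \<Longrightarrow> s \<oplus> t \<in> E"
  using EE unfolding set_tadd_def by blast

lemma tsums_E: "tsums k E = E"
proof (intro subset_antisym subsetI)
  fix x assume "x \<in> tsums k E"
  then show "x \<in> E" by induction (auto intro: E_add)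
qed (rule tsums.base)

lemma E_tomega_iff: "x \<in> E \<longleftrightarrow> (\<exists>s\<in>E. \<exists>e\<in>E. x = s \<oplus> w e)"
  using OmE unfolding set_tomega_def tsums_E by blast

lemma w_E: "e \<in> E \<Longrightarrow> w e \<in> E"
  using tomega_unfold[OF C rzE] E_tomega_iff by metis

lemma rzE0: "x \<in> E0 \<Longrightarrow> realizable C k x"
  unfolding E0_def using rzE realizable_0[OF C] by blast

lemma assoc: "a \<in> E0 \<Longrightarrow> b \<in> E0 \<Longrightarrow> c \<in> E0 \<Longrightarrow> (a \<oplus> b) \<oplus> c = a \<oplus> (b \<oplus> c)"
  by (rule tadd_assoc[OF C]; rule rzE0)

lemma E_E0: "x \<in> E \<Longrightarrow> x \<in> E0" and zero_E0: "0 \<in> E0" unfolding E0_def by auto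

lemma zero_add: "x \<in> E0 \<Longrightarrow> 0 \<oplus> x = x" "x \<in> E0 \<Longrightarrow> x \<oplus> 0 = x"
  using tadd_0[OF C rzE0] by auto

lemma E0_add: "a \<in> E0 \<Longrightarrow> b \<in> E0 \<Longrightarrow> a \<oplus> b \<in> E0"
  using zero_add E_add E_E0 unfolding E0_def by (metis insert_iff)

lemma E0_add_E: "a \<in> E0 \<Longrightarrow> b \<in> E \<Longrightarrow> a \<oplus> b \<in> E" "b \<in> E \<Longrightarrow> a \<in> E0 \<Longrightarrow> b \<oplus> a \<in> E"
  using zero_add[OF E_E0[of b]] E_add unfolding E0_def by (metis insert_iff)+

lemma finite_E0: "finite E0"
proof -
  have "E0 \<subseteq> els (universe C k)" using realizable_universe[OF C rzE0] by blast
  then show ?thesis by (rule finite_subset) simp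
qed

lemma U_sub_E: "U \<subseteq> E"
  unfolding U_def using E_add by blast

text \<open>
  Put \<open>y = e \<cdot> \<omega> + b\<close>. Since \<open>e + e \<cdot> \<omega> = e \<cdot> \<omega>\<close>, the assumption becomes \<open>e = a + e + y\<close>, hence
  \<open>e = a \<cdot> n + e + y \<cdot> n\<close> for all \<open>n\<close>. Two of the elements \<open>a \<cdot> i + e\<close> coincide, which gives \<open>e = e + y \<cdot> p\<close>
  for some \<open>p > 0\<close>, and \<open>e + y = y\<close> begins with \<open>e \<cdot> \<omega>\<close>.
\<close>

lemma loop_right:
  assumes e: "e \<in> E" and a: "a \<in> E0" and b: "b \<in> E0" and eq: "e = a \<oplus> w e \<oplus> b"
  shows "\<exists>z\<in>E0. e = w e \<oplus> z"
proof -
  define y where "y = w e \<oplus> b"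
  \<comment> \<open>\<open>R m\<close> adds \<open>m\<close> copies of \<open>y\<close> on the right, \<open>L
    m\<close> adds \<open>m\<close> copies of \<open>a\<close> on the left.\<close>
  define R where "R m x = ((\<lambda>x. x \<oplus> y) ^^ m) x" for m x
  define L where "L m x = ((\<lambda>x. a \<oplus> x) ^^ m) x" for m x
  have e0: "e \<in> E0" and we: "w e \<in> E0" using e w_E E_E0 by auto
  have y: "y \<in> E0" unfolding y_def by (rule E0_add[OF we b])
  have ey: "e \<oplus> y = y" unfolding y_def assoc[OF e0 we b, symmetric] tomega_unfold[OF C rzE[OF e]] ..
  have eq': "a \<oplus> e \<oplus> y = e"
    unfolding assoc[OF a e0 y] ey unfolding y_def using eq assoc[OF a we b] by simp
  have R0: "R m x \<in> E0" if "x \<in> E0" for m x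
    unfolding R_def by (induction m) (use that y in \<open>auto intro: E0_add\<close>)
  have L0: "L m x \<in> E0" if "x \<in> E0" for m x
    unfolding L_def by (induction m) (use that a in \<open>auto intro: E0_add\<close>)
  have RSuc: "R (Suc m) x = R m x \<oplus> y" "R (Suc m) x = R m (x \<oplus> y)" for m x
    using funpow_swap1[of "\<lambda>x. x \<oplus> y" m x] unfolding R_def by simp_all
  have LSuc: "L (Suc m) x = a \<oplus> L m x" "L (Suc m) x = L m (a \<oplus> x)" for m x
    using funpow_swap1[of "\<lambda>x. a \<oplus> x" m x] unfolding L_def by simp_all
  have R_left: "R m (u \<oplus> x) = u \<oplus> R m x" if "u \<in> E0" "x \<in> E0" for m u x
  proof (induction m)
    case (Suc m) then show ?case unfolding RSuc(1) using assoc[OF that(1) R0[OF that(2)] y] by simp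
  qed (simp add: R_def)
  have L_right: "L m (x \<oplus> y) = L m x \<oplus> y" if "x \<in> E0" for m x
  proof (induction m)
    case (Suc m) then show ?case unfolding LSuc(1) using assoc[OF a L0[OF that] y] by simp
  qed (simp add: L_def)
  have RL: "R m (L m e) = e" for m
  proof (induction m)
    case (Suc m)
    have "R (Suc m) (L (Suc m) e) = R m (L m (a \<oplus> e) \<oplus> y)" unfolding RSuc(2) LSuc(2) ..
    also have "\<dots> = R m (L m e)" using L_right[OF E0_add[OF a e0]] eq' by metis
    finally show ?case using Suc by simp
  qed (simp add: R_def L_def)
  have "range (\<lambda>m. L m e) \<subseteq> E0" by (simp add: image_subset_iff L0[OF e0])
  then have fr: "finite (range (\<lambda>m. L m e))" by (rule finite_subset[OF _ finite_E0])
  obtain i j where ij: "i < j" "L i e = L j e" by (rule finite_range_repeats[OF fr], rule that)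
  then obtain p where p: "j = i + Suc p" using less_imp_Suc_add by auto
  have "e = R j (L i e)" using RL[of j] ij(2) by simp
  also have "\<dots> = R (Suc p) (R i (L i e))" unfolding R_def p add.commute[of i] funpow_add by simp
  also have "\<dots> = R p (w e \<oplus> b)" unfolding RL RSuc(2) ey unfolding y_def ..
  also have "\<dots> = w e \<oplus> R p b" by (rule R_left[OF we b])
  finally show ?thesis using R0[OF b] by blast
qed

text \<open>
  Starting from \<open>x\<close>, write \<open>x\<^sub>i = s\<^sub>i + x\<^sub>i\<^sub>+\<^sub>1 \<cdot> \<omega>\<close> again and again. The sets of divisors in \<open>E\<close> decrease
  along this chain, so two consecutive ones agree. For the corresponding \<open>e = x\<^sub>i\<^sub>+\<^sub>1\<close> this means that
  \<open>e \<cdot> \<omega>\<close>, a divisor of \<open>x\<^sub>i\<close>, divides \<open>e\<close>. Hence \<open>e = e \<cdot> \<omega> + z\<close>, and \<open>g = z + e \<cdot> \<omega>\<close> satisfies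
  \<open>g \<cdot> \<omega> = g\<close> and \<open>e \<cdot> \<omega> + g = e \<cdot> \<omega>\<close>. Thus \<open>g\<close> can be inserted into \<open>x\<close>, even twice.
\<close>

lemma E_sub_U_E: "E \<subseteq> set_tadd k U E"
proof
  fix x assume x: "x \<in> E"
  define D where "D y = {z \<in> E. \<exists>a\<in>E0. \<exists>b\<in>E0. y = a \<oplus> z \<oplus> b}" for y
  obtain sd ed where dec: "\<And>x. x \<in> E \<Longrightarrow> sd x \<in> E \<and> ed x \<in> E \<and> x = sd x \<oplus> w (ed x)"
    using E_tomega_iff by metis
  define X where "X n = (ed ^^ n) x" for n
  have XE: "X n \<in> E" for n unfolding X_def by (induction n) (use x dec in auto)
  have XSuc: "X (Suc n) = ed (X n)" for n unfolding X_def by simp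
  have D_refl: "y \<in> D y" if "y \<in> E" for y
    unfolding D_def using that zero_E0 zero_add[OF E_E0[OF that]] by force
  have D_trans: "D z \<subseteq> D y" if z: "z \<in> D y" for z y
  proof
    fix v assume v: "v \<in> D z"
    from z obtain a b where ab: "z \<in> E" "a \<in> E0" "b \<in> E0" "y = a \<oplus> z \<oplus> b" unfolding D_def by blast
    from v obtain c d where cd: "v \<in> E" "c \<in> E0" "d \<in> E0" "z = c \<oplus> v \<oplus> d" unfolding D_def by blast
    have v0: "v \<in> E0" using cd(1) E_E0 by simp
    have "y = (a \<oplus> c) \<oplus> v \<oplus> (d \<oplus> b)"
      unfolding ab(4) cd(4)
      by (simp add: assoc E0_add ab cd v0)
    then show "v \<in> D y" unfolding D_def using cd(1) E0_add[OF ab(2) cd(2)] E0_add[OF cd(3) ab(3)] by blast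
  qed
  have wD: "w (X (Suc n)) \<in> D (X n)" for n
  proof -
    have "X n = sd (X n) \<oplus> w (X (Suc n))" "sd (X n) \<in> E" "w (X (Suc n)) \<in> E"
      using dec[OF XE[of n]] XSuc w_E by auto
    then have "X n = sd (X n) \<oplus> w (X (Suc n)) \<oplus> 0"
      using zero_add(2)[OF E_E0[OF XE[of n]]] by simp
    then show ?thesis unfolding D_def
      using \<open>sd (X n) \<in> E\<close> \<open>w (X (Suc n)) \<in> E\<close> E_E0 zero_E0 by blast
  qed
  have XD: "X (Suc n) \<in> D (w (X (Suc n)))" for n
  proof -
    have "w (X (Suc n)) = 0 \<oplus> X (Suc n) \<oplus> w (X (Suc n))"
      using zero_add(1)[OF E_E0[OF XE]] tomega_unfold[OF C rzE[OF XE]] by simp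
    then show ?thesis unfolding D_def using XE w_E[OF XE] E_E0 zero_E0 by blast
  qed
  have Dmono: "D (X (Suc n)) \<subseteq> D (X n)" for n using D_trans[OF XD] D_trans[OF wD] by blast
  have finD: "finite (D y)" for y
    by (rule finite_subset[OF _ finite_E0]) (auto simp: D_def E0_def)
  obtain i where i: "\<And>j. card (D (X i)) \<le> card (D (X j))"
    using ex_has_least_nat[of "\<lambda>_. True" 0 "\<lambda>i. card (D (X i))"] by blast
  have Deq: "D (X (Suc i)) = D (X i)"
    by (rule card_subset_eq[OF finD Dmono]) (use i[of "Suc i"] card_mono[OF finD Dmono[of i]] in simp)
  define e where "e = X (Suc i)"
  have eE: "e \<in> E" unfolding e_def by (rule XE)
  have "w e \<in> D e" using wD[of i] Deq unfolding e_def by simp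
  then obtain a b where ab: "a \<in> E0" "b \<in> E0" "e = a \<oplus> w e \<oplus> b" unfolding D_def by blast
  from loop_right[OF eE this] obtain z where z: "z \<in> E0" "e = w e \<oplus> z" by blast
  define g where "g = z \<oplus> w e"
  have weE: "w e \<in> E" by (rule w_E[OF eE])
  have g: "g \<in> E" unfolding g_def by (rule E0_add_E(1)[OF z(1) weE])
  have wg: "w g = g"
    unfolding g_def tomega_rotate[OF C rzE0[OF z(1)] rzE[OF weE]] z(2)[symmetric] ..
  have weg: "w e \<oplus> g = w e"
    using tomega_rotate[OF C rzE[OF weE] rzE0[OF z(1)]] wg unfolding z(2)[symmetric] g_def[symmetric] by simp
  have gg: "g \<oplus> g = g" using tomega_unfold[OF C rzE[OF g]] wg by simp
  have "X n \<in> D x" for n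
  proof -
    have "D (X n) \<subseteq> D (X 0)"
      by (induction n) (use Dmono in blast)+
    then show ?thesis using D_refl[OF XE[of n]] unfolding X_def by auto
  qed
  then obtain a' b' where x': "a' \<in> E0" "b' \<in> E0" "x = a' \<oplus> X i \<oplus> b'" unfolding D_def by blast
  define s where "s = sd (X i)"
  have s: "s \<in> E" "X i = s \<oplus> w e" using dec[OF XE[of i]] XSuc unfolding s_def e_def by auto
  have E0: "s \<in> E0" "w e \<in> E0" "g \<in> E0" using s(1) weE g E_E0 by auto
  have "x = (a' \<oplus> (s \<oplus> w e)) \<oplus> b'" using x'(3) s(2) by simp
  also have "\<dots> = (a' \<oplus> (s \<oplus> (w e \<oplus> (g \<oplus> g)))) \<oplus> b'" unfolding gg weg ..
  also have "\<dots> = ((a' \<oplus> (s \<oplus> w e)) \<oplus> g) \<oplus> (g \<oplus> b')"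
    by (simp add: assoc E0_add E0 x'(1,2))
  finally have "x = ((a' \<oplus> (s \<oplus> w e)) \<oplus> g) \<oplus> (g \<oplus> b')" .
  moreover have "(a' \<oplus> (s \<oplus> w e)) \<oplus> g \<in> U"
    unfolding U_def using E0_add_E(1)[OF x'(1) E_add[OF s(1) weE]] g wg by blast
  moreover have "g \<oplus> b' \<in> E" by (rule E0_add_E(2)[OF g x'(2)])
  ultimately show "x \<in> set_tadd k U E" unfolding set_tadd_def by blast
qed

lemma U_E: "set_tadd k U E = E"
  using E_sub_U_E set_tadd_mono[OF U_sub_E subset_refl, of k E] EE by blast

end

lemma stable_power_types:
  assumes C: "els C \<noteq> {}" and N: "power_types C k (Suc N) = power_types C k N"
  shows "stable C k (power_types C k N)"
proof
  obtain X :: "rat set" where "omega_block (<) (Suc N) X" using rat_omega_block[of 0 1 "Suc N"] by auto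
  from rat_ord.power_types_absorb[OF C this, of N k] show "set_tadd k (power_types C k N) (power_types C k N) = power_types C k N" using N by simp
  show "set_tomega C k (power_types C k N) = power_types C k N" using N by simp
qed (use C realizable_power_types[OF C] in auto)

section \<open>Sums of an absorbing type\<close>

lemma fin_im: "range c \<subseteq> els C \<Longrightarrow> finite (c ` X)"
  by (rule finite_subset[OF _ finite_set_decode[of C]]) auto

context strict_order
begin

lemma tadd_0_qtype:
  assumes "range c \<subseteq> els C"
  shows "tadd k 0 (qtype lt c k Y) = qtype lt c k Y"
  using qtype_Un[OF fin_col[OF assms], of "{}" Y k] by (simp add: before_def)

lemma omega_block_total: "omega_block lt n X \<Longrightarrow> x \<in> X \<Longrightarrow> y \<in> X \<Longrightarrow> x \<sqsubset> y \<or> x = y \<or> y \<sqsubset> x"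
proof (induction n arbitrary: X)
  case (Suc n)
  then obtain A where A: "\<And>i::nat. omega_block lt n (A i)" "\<And>i j. i < j \<Longrightarrow> before lt (A i) (A j)" "X = (\<Union>i. A i)"
    by auto
  obtain i j where ij: "x \<in> A i" "y \<in> A j" using Suc.prems(2,3) A(3) by blast
  show ?case
  proof (cases i j rule: linorder_cases)
    case equal then show ?thesis using Suc.IH[OF A(1)] ij by blast
  qed (use A(2)[of i j] A(2)[of j i] ij in \<open>auto simp: before_def\<close>)
qed auto

lemma tsums_singleton: "tadd k g g = g \<Longrightarrow> tsums k {g} = {g}"
proof (intro subset_antisym subsetI)
  fix x assume "tadd k g g = g" "x \<in> tsums k {g}"
  from this(2,1) show "x \<in> {g}" by induction auto
qed (auto intro: tsums.base)

text \<open>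
  Induction on the rank alone suffices, whatever the order type of \<open>J\<close>: by the induction hypothesis
  the blocks to the left and to the right of a point contribute the type \<open>g'\<close> of \<open>g\<close> at the lower
  rank, or nothing. The four resulting kinds of cuts are those of \<open>g + g\<close> and of \<open>g \<cdot> \<omega>\<close>, which
  both equal \<open>g\<close>.
\<close>

lemma qtype_absorb:
  assumes C: "els C \<noteq> {}" and c: "range c \<subseteq> els C"
    and tot: "\<And>i j. i \<in> I \<Longrightarrow> j \<in> I \<Longrightarrow> i \<sqsubset> j \<or> i = j \<or> j \<sqsubset> i"
    and wf: "\<And>J. J \<subseteq> I \<Longrightarrow> J \<noteq> {} \<Longrightarrow> \<exists>m\<in>J. \<forall>j\<in>J. \<not> j \<sqsubset> m"
    and ord: "\<And>i j. i \<in> I \<Longrightarrow> j \<in> I \<Longrightarrow> i \<sqsubset> j \<Longrightarrow> before lt (A i) (A j)"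
    and J: "J \<subseteq> I" "J \<noteq> {}" and g: "\<And>i. i \<in> I \<Longrightarrow> qtype lt c k (A i) = g"
    and real: "realizable C k g" and idem: "tomega C k g = g"
  shows "qtype lt c k (\<Union>i\<in>J. A i) = g"
  using J g real idem
proof (induction k arbitrary: J g)
  case 0 then show ?case by simp
next
  case (Suc k)
  define g' where "g' = trunc k g"
  note fc = fin_col[OF c]
  note T = qtype_Un[OF fc]
  have realizable': "realizable C k g'" unfolding g'_def by (rule realizable_trunc[OF C Suc.prems(4)])
  have tomega': "tomega C k g' = g'" unfolding g'_def using trunc_tomega[OF C Suc.prems(4)] Suc.prems(5) by simp
  have gg: "tadd (Suc k) g g = g" using tomega_unfold[OF C Suc.prems(4)] Suc.prems(5) by simp
  have gg': "tadd k g' g' = g'" using tomega_unfold[OF C realizable'] tomega' by simp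
  have A': "qtype lt c k (A i) = g'" if "i \<in> I" for i
    using trunc_qtype[OF fin_im[OF c], of k lt "A i"] Suc.prems(3)[OF that] unfolding g'_def by simp
  have IH: "qtype lt c k (\<Union>i\<in>J'. A i) = g'" if "J' \<subseteq> I" "J' \<noteq> {}" for J'
    by (rule Suc.IH[OF that A' realizable' tomega'])
  let ?loc = "\<lambda>i x. cut (qtype lt c k {y\<in>A i. y \<sqsubset> x}) (c x) (qtype lt c k {y\<in>A i. x \<sqsubset> y})"
  have elg: "els g = ?loc i ` A i" if "i \<in> I" for i
    using els_qtype_Suc[OF fin_im[OF c], of lt k "A i"] unfolding Suc.prems(3)[OF that] .
  have F1: "els g = (\<lambda>w. cut (cut_left w) (cut_color w) (tadd k (cut_right w) g')) ` els g \<union>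
      (\<lambda>w. cut (tadd k g' (cut_left w)) (cut_color w) (cut_right w)) ` els g"
  proof -
    have "els (tadd (Suc k) g g) = (\<lambda>w. cut (cut_left w) (cut_color w) (tadd k (cut_right w) g')) ` els g \<union>
      (\<lambda>w. cut (tadd k g' (cut_left w)) (cut_color w) (cut_right w)) ` els g"
      unfolding tadd.simps g'_def by (rule set_encode_inverse) simp
    then show ?thesis unfolding gg .
  qed
  have F2: "els g = (\<lambda>w. cut (tadd k 0 (cut_left w)) (cut_color w) (tadd k (cut_right w) g')) ` els g \<union>
      (\<lambda>w. cut (tadd k g' (cut_left w)) (cut_color w) (tadd k (cut_right w) g')) ` els g"
    using els_tomega[OF realizable_universe[OF C Suc.prems(4)]]
    unfolding Suc.prems(5) g'_def[symmetric] tomega' tsums_singleton[OF gg'] by simp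
  let ?U = "\<Union>i\<in>J. A i"
  let ?glob = "\<lambda>x. cut (qtype lt c k {y\<in>?U. y \<sqsubset> x}) (c x) (qtype lt c k {y\<in>?U. x \<sqsubset> y})"
  let ?lo = "\<lambda>i. {j\<in>J. j \<sqsubset> i}" and ?hi = "\<lambda>i. {j\<in>J. i \<sqsubset> j}"
  have JI: "i \<in> I" if "i \<in> J" for i using that Suc.prems(1) by blast
  have bef: "a \<sqsubset> b" "\<not> b \<sqsubset> a" if "a \<in> A i" "b \<in> A j" "i \<in> J" "j \<in> J" "i \<sqsubset> j" for a b i j
    using ord[OF JI JI that(5)] that asym unfolding before_def by blast+
  have left: "{y\<in>?U. y \<sqsubset> x} = (\<Union>j\<in>?lo i. A j) \<union> {y\<in>A i. y \<sqsubset> x}"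
    and right: "{y\<in>?U. x \<sqsubset> y} = {y\<in>A i. x \<sqsubset> y} \<union> (\<Union>j\<in>?hi i. A j)"
    if i: "i \<in> J" and x: "x \<in> A i" for i x
  proof -
    have "j \<sqsubset> i \<or> j = i" if "y \<in> A j" "j \<in> J" "y \<sqsubset> x" for y j
      using tot[OF JI[OF i] JI[OF that(2)]] bef(2)[OF x that(1) i that(2)] that(3) by blast
    moreover have "y \<sqsubset> x" if "y \<in> A j" "j \<in> J" "j \<sqsubset> i" for y j
      using bef(1)[OF that(1) x that(2) i that(3)] .
    ultimately show "{y\<in>?U. y \<sqsubset> x} = (\<Union>j\<in>?lo i. A j) \<union> {y\<in>A i. y \<sqsubset> x}"
      using i by blast
    have "i \<sqsubset> j \<or> j = i" if "y \<in> A j" "j \<in> J" "x \<sqsubset> y" for y j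
      using tot[OF JI[OF i] JI[OF that(2)]] bef(2)[OF that(1) x that(2) i] that(3) by blast
    moreover have "x \<sqsubset> y" if "y \<in> A j" "j \<in> J" "i \<sqsubset> j" for y j
      using bef(1)[OF x that(1) i that(2) that(3)] .
    ultimately show "{y\<in>?U. x \<sqsubset> y} = {y\<in>A i. x \<sqsubset> y} \<union> (\<Union>j\<in>?hi i. A j)"
      using i by blast
  qed
  have tl: "qtype lt c k {y\<in>?U. y \<sqsubset> x} = (if ?lo i = {} then cut_left (?loc i x) else tadd k g' (cut_left (?loc i x)))"
    if i: "i \<in> J" and x: "x \<in> A i" for i x
  proof (cases "?lo i = {}")
    case True show ?thesis unfolding left[OF that] unfolding True by simp
  next
    case False
    have "before lt (\<Union>j\<in>?lo i. A j) {y\<in>A i. y \<sqsubset> x}"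
      unfolding before_def using bef(1)[OF _ _ _ i] by blast
    from T[OF this, of k] show ?thesis unfolding left[OF that] using False IH[OF _ False] JI by auto
  qed
  have tr: "qtype lt c k {y\<in>?U. x \<sqsubset> y} = (if ?hi i = {} then cut_right (?loc i x) else tadd k (cut_right (?loc i x)) g')"
    if i: "i \<in> J" and x: "x \<in> A i" for i x
  proof (cases "?hi i = {}")
    case True show ?thesis unfolding right[OF that] unfolding True by simp
  next
    case False
    have "before lt {y\<in>A i. x \<sqsubset> y} (\<Union>j\<in>?hi i. A j)"
      unfolding before_def using bef(1)[OF _ _ i] by blast
    from T[OF this, of k] show ?thesis unfolding right[OF that] using False IH[OF _ False] JI by auto
  qed
  have glob: "?glob x = cut (if ?lo i = {} then cut_left (?loc i x) else tadd k g' (cut_left (?loc i x)))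
     (cut_color (?loc i x)) (if ?hi i = {} then cut_right (?loc i x) else tadd k (cut_right (?loc i x)) g')"
    if "i \<in> J" "x \<in> A i" for i x
    unfolding tl[OF that] tr[OF that] cut_simps ..
  have get: "v \<in> ?glob ` ?U" if i: "i \<in> J" and w: "w \<in> els g"
    and v: "v = cut (if ?lo i = {} then cut_left w else tadd k g' (cut_left w))
     (cut_color w) (if ?hi i = {} then cut_right w else tadd k (cut_right w) g')" for i w v
  proof -
    obtain x where x: "x \<in> A i" "w = ?loc i x" using w unfolding elg[OF JI[OF i]] by blast
    have "v = ?glob x" unfolding v x(2) by (rule glob[OF i x(1), symmetric])
    then show ?thesis using x(1) i by blast
  qed
  have "els (qtype lt c (Suc k) ?U) = els g"
    unfolding els_qtype_Suc[OF fin_im[OF c]]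
  proof (intro subset_antisym subsetI)
    fix v assume "v \<in> ?glob ` ?U"
    then obtain i x where i: "i \<in> J" "x \<in> A i" "v = ?glob x" by blast
    define w where "w = ?loc i x"
    have w: "w \<in> els g" unfolding w_def elg[OF JI[OF i(1)]] using i(2) by blast
    have v: "v = cut (if ?lo i = {} then cut_left w else tadd k g' (cut_left w))
       (cut_color w) (if ?hi i = {} then cut_right w else tadd k (cut_right w) g')"
      unfolding i(3) w_def by (rule glob[OF i(1,2)])
    consider "?lo i = {}" "?hi i = {}" | "?lo i = {}" "?hi i \<noteq> {}" | "?lo i \<noteq> {}" "?hi i = {}"
      | "?lo i \<noteq> {}" "?hi i \<noteq> {}" by argo
    then show "v \<in> els g"
    proof cases
      case 1 then show ?thesis using v w by simp
    next
      case 2 then show ?thesis using v w F1 by auto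
    next
      case 3 then show ?thesis using v w F1 by auto
    next
      case 4 then show ?thesis using v w F2 by auto
    qed
  next
    fix v assume v: "v \<in> els g"
    obtain i0 where i0: "i0 \<in> J" "\<And>j. j \<in> J \<Longrightarrow> \<not> j \<sqsubset> i0" using wf[OF Suc.prems(1,2)] by blast
    have lo0: "?lo i0 = {}" using i0(2) by blast
    have other: "i0 \<sqsubset> j" if "j \<in> J" "j \<noteq> i0" for j
      using tot[OF JI[OF i0(1)] JI[OF that(1)]] i0(2)[OF that(1)] that(2) by blast
    show "v \<in> ?glob ` ?U"
    proof (cases "\<exists>m\<in>J. ?hi m = {}")
      case True
      then obtain m where m: "m \<in> J" "?hi m = {}" by blast
      show ?thesis
      proof (cases "m = i0")
        case True
        show ?thesis by (rule get[OF i0(1) v]) (use lo0 m(2) True in simp)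
      next
        case False
        then have lt: "i0 \<sqsubset> m" using other m(1) by blast
        have hi0: "?hi i0 \<noteq> {}" and lom: "?lo m \<noteq> {}" using lt m(1) i0(1) by blast+
        from v F1 obtain w where w: "w \<in> els g"
          "v = cut (cut_left w) (cut_color w) (tadd k (cut_right w) g') \<or> v = cut (tadd k g' (cut_left w)) (cut_color w) (cut_right w)" by blast
        from w(2) show ?thesis
        proof
          assume v: "v = cut (cut_left w) (cut_color w) (tadd k (cut_right w) g')"
          show ?thesis by (rule get[OF i0(1) w(1)]) (simp only: v lo0 hi0 if_True if_False refl)
        next
          assume v: "v = cut (tadd k g' (cut_left w)) (cut_color w) (cut_right w)"
          show ?thesis by (rule get[OF m(1) w(1)]) (simp only: v lom m(2) if_True if_False refl)
        qed
      qed
    next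
      case False
      then have hi0: "?hi i0 \<noteq> {}" using i0(1) by blast
      then obtain i1 where i1: "i1 \<in> J" "i0 \<sqsubset> i1" by blast
      have lo1: "?lo i1 \<noteq> {}" and hi1: "?hi i1 \<noteq> {}" using i1 i0(1) False by blast+
      from v F2 obtain w where w: "w \<in> els g"
        "v = cut (tadd k 0 (cut_left w)) (cut_color w) (tadd k (cut_right w) g') \<or> v = cut (tadd k g' (cut_left w)) (cut_color w) (tadd k (cut_right w) g')"
        by blast
      have "tadd k 0 (cut_left w) = cut_left w"
      proof -
        obtain x where "w = ?loc i0 x" using w(1) unfolding elg[OF JI[OF i0(1)]] by blast
        then show ?thesis using tadd_0_qtype[OF c] by simp
      qed
      note w0 = w(2)[unfolded this]
      from w0 show ?thesis
      proof
        assume v: "v = cut (cut_left w) (cut_color w) (tadd k (cut_right w) g')"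
        show ?thesis by (rule get[OF i0(1) w(1)]) (simp only: v lo0 hi0 if_True if_False refl)
      next
        assume v: "v = cut (tadd k g' (cut_left w)) (cut_color w) (tadd k (cut_right w) g')"
        show ?thesis by (rule get[OF i1(1) w(1)]) (simp only: v lo1 hi1 if_True if_False refl)
      qed
    qed
  qed
  then show ?case by (simp only: els_eq_iff)
qed

end

section \<open>Colorings of uncountable cofinality\<close>

text \<open>
  A coloring \<open>c\<close> of \<open>X\<close> and an unbounded set \<open>D\<close> of cut points that contains the suprema of its increasing
  sequences. Such sequences are therefore never cofinal in \<open>X\<close>. The constant \<open>k\<close> is a rank; the
  conclusions are about rank \<open>k + 1\<close>.
\<close>

locale cofinal_set = strict_order +
  fixes X D :: "'a set" and C k :: nat and c :: "'a \<Rightarrow> nat"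
  assumes total: "x \<in> X \<Longrightarrow> y \<in> X \<Longrightarrow> x \<sqsubset> y \<or> x = y \<or> y \<sqsubset> x"
    and DX: "D \<subseteq> X" and Dne: "D \<noteq> {}" and cof: "x \<in> X \<Longrightarrow> \<exists>d\<in>D. x \<sqsubset> d"
    and sup: "(\<And>n. f n \<in> D) \<Longrightarrow> (\<And>n. f n \<sqsubset> f (Suc n)) \<Longrightarrow>
       \<exists>d\<in>D. (\<forall>n. f n \<sqsubset> d) \<and> (\<forall>y\<in>X. y \<sqsubset> d \<longrightarrow> (\<exists>n. y \<sqsubset> f n))"
    and c: "range c \<subseteq> els C"
begin

definition tail_from where "tail_from x = {y\<in>X. \<not> y \<sqsubset> x}"
definition between where "between x z = {y\<in>X. \<not> y \<sqsubset> x \<and> y \<sqsubset> z}"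
definition above where "above x = {y\<in>X. x \<sqsubset> y}"

text \<open>
  What is seen from \<open>i\<close> at a point above \<open>i\<close> is already seen at a point between \<open>i\<close> and \<open>j\<close>.
\<close>

definition witnessed where
  "witnessed i j \<longleftrightarrow> (\<forall>y\<in>tail_from i. \<exists>y'\<in>between i j. c y' = c y \<and>
     qtype lt c k (between i y') = qtype lt c k (between i y) \<and> qtype lt c k (above y') = qtype lt c k (above y))"

definition upclosed where "upclosed Z \<longleftrightarrow> Z \<subseteq> X \<and> (\<forall>z\<in>Z. above z \<subseteq> Z)"

text \<open>
  Up to rank \<open>k + 1\<close>, the part of \<open>X\<close> below \<open>d\<close> behaves like an elementary substructure: final segments of \<open>X\<close>
  that start below \<open>d\<close> may be truncated at \<open>d\<close> without change of type.
\<close>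

definition good where
  "good d \<longleftrightarrow> (\<forall>Z. upclosed Z \<and> (\<exists>x\<in>X. x \<sqsubset> d \<and> above x \<subseteq> Z) \<longrightarrow>
     qtype lt c (Suc k) {z\<in>Z. z \<sqsubset> d} = qtype lt c (Suc k) Z)"

lemma upclosed_above: "upclosed (above x)" unfolding upclosed_def above_def using tr by blast
lemma upclosed_tail_from: "upclosed (tail_from x)" unfolding upclosed_def above_def tail_from_def using tr by blast
lemma le: "x \<in> X \<Longrightarrow> y \<in> X \<Longrightarrow> \<not> y \<sqsubset> x \<Longrightarrow> x = y \<or> x \<sqsubset> y" using total by blast

lemma bound:
  assumes "finite F" "F \<subseteq> X"
  shows "\<exists>j\<in>D. \<forall>x\<in>F. x \<sqsubset> j"
  using assms
proof (induction rule: finite_induct)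
  case empty then show ?case using Dne by blast
next
  case (insert x F)
  then obtain j where j: "j \<in> D" "\<forall>x\<in>F. x \<sqsubset> j" by blast
  obtain i where i: "i \<in> D" "x \<sqsubset> i" using cof insert.prems by blast
  show ?case
  proof (cases "i \<sqsubset> j")
    case True then show ?thesis using j i tr by blast
  next
    case False
    then have "j = i \<or> j \<sqsubset> i" using total i j DX by blast
    then show ?thesis using i j tr by blast
  qed
qed

text \<open>
  There are finitely many triples to be witnessed, so their witnesses are bounded.
\<close>

lemma witnessed_ex:
  assumes "i \<in> D"
  shows "\<exists>j\<in>D. i \<sqsubset> j \<and> witnessed i j"
proof -
  define \<tau> where "\<tau> y = cut (qtype lt c k (between i y)) (c y) (qtype lt c k (above y))" for y
  have "finite (\<tau> ` tail_from i)"
  proof (rule finite_subset)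
    show "\<tau> ` tail_from i \<subseteq> {w. cut_left w \<in> els (universe C k) \<and> cut_color w \<in> els C \<and> cut_right w \<in> els (universe C k)}"
      unfolding \<tau>_def using qtype_universe[of c _ C lt k] c by (auto simp: image_subset_iff)
  qed (rule finite_triples)
  then obtain F where F: "F \<subseteq> tail_from i" "finite F" "\<tau> ` tail_from i = \<tau> ` F"
    using finite_subset_image[of "\<tau> ` tail_from i" \<tau> "tail_from i"] by blast
  have "insert i F \<subseteq> X" using assms DX F(1) unfolding tail_from_def by blast
  then obtain j where j: "j \<in> D" "\<forall>x\<in>insert i F. x \<sqsubset> j" using bound[of "insert i F"] F(2) by blast
  have "witnessed i j" unfolding witnessed_def
  proof
    fix y assume "y \<in> tail_from i"
    then obtain y' where y': "y' \<in> F" "\<tau> y = \<tau> y'" using F(3) by blast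
    then have "y' \<in> between i j" using F(1) j(2) unfolding between_def tail_from_def by blast
    then show "\<exists>y'\<in>between i j. c y' = c y \<and>
     qtype lt c k (between i y') = qtype lt c k (between i y) \<and> qtype lt c k (above y') = qtype lt c k (above y)"
      using y'(2) unfolding \<tau>_def cut_inject by metis
  qed
  then show ?thesis using j by blast
qed

text \<open>
  The argument of Tarski and Vaught, by induction on the rank. A point \<open>y\<close> of \<open>Z\<close> at or above \<open>d\<close> is
  replaced by the witness \<open>y'\<close> between \<open>f n\<close> and \<open>f (n + 1)\<close>; the part of \<open>Z\<close> below \<open>f n\<close> is not affected by
  this, so the left parts of both points have the same type.
\<close>

lemma good_limit:
  assumes f: "\<And>n. f n \<in> D" "\<And>n. f n \<sqsubset> f (Suc n)" "\<And>n. witnessed (f n) (f (Suc n))"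
    and d: "\<And>n. f n \<sqsubset> d" "\<And>y. y \<in> X \<Longrightarrow> y \<sqsubset> d \<Longrightarrow> \<exists>n. y \<sqsubset> f n"
  shows "good d"
proof -
  have fX: "f n \<in> X" for n using f(1) DX by blast
  have tail_from_above: "tail_from (f n) \<subseteq> above x" if "x \<sqsubset> f n" for x n
    unfolding tail_from_def above_def using le[OF fX] that tr by blast
  have main: "qtype lt c r {z\<in>Z. z \<sqsubset> d} = qtype lt c r Z"
    if "r \<le> Suc k" "upclosed Z" "tail_from (f n) \<subseteq> Z" for r Z n
    using that
  proof (induction r arbitrary: Z n)
    case (Suc r)
    let ?\<tau> = "\<lambda>y. cut (qtype lt c r {z\<in>Z. z \<sqsubset> y}) (c y) (qtype lt c r (above y))"
    have gtZ: "{z\<in>Z. y \<sqsubset> z} = above y" if "y \<in> Z" for y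
      using that Suc.prems(2) unfolding upclosed_def above_def by blast
    have r: "r \<le> k" "r \<le> Suc k" using Suc.prems(1) by auto
    have 1: "els (qtype lt c (Suc r) Z) = ?\<tau> ` Z"
      unfolding els_qtype_Suc[OF fin_im[OF c]] by (rule image_cong[OF refl]) (simp only: gtZ)
    have 2: "els (qtype lt c (Suc r) {z\<in>Z. z \<sqsubset> d}) = ?\<tau> ` {z\<in>Z. z \<sqsubset> d}"
      unfolding els_qtype_Suc[OF fin_im[OF c]]
    proof (rule image_cong[OF refl])
      fix y assume "y \<in> {z\<in>Z. z \<sqsubset> d}"
      then have y: "y \<in> Z" "y \<sqsubset> d" by auto
      have yX: "y \<in> X" using y(1) Suc.prems(2) unfolding upclosed_def by blast
      have l: "{z \<in> {z\<in>Z. z \<sqsubset> d}. z \<sqsubset> y} = {z\<in>Z. z \<sqsubset> y}" using y(2) tr by blast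
      have rr: "{z \<in> {z\<in>Z. z \<sqsubset> d}. y \<sqsubset> z} = {z\<in>above y. z \<sqsubset> d}" using gtZ[OF y(1)] by blast
      obtain m where m: "y \<sqsubset> f m" using d(2)[OF yX y(2)] by blast
      have "qtype lt c r {z\<in>above y. z \<sqsubset> d} = qtype lt c r (above y)"
        by (rule Suc.IH[OF r(2) upclosed_above tail_from_above[OF m]])
      then show "cut (qtype lt c r {z \<in> {z\<in>Z. z \<sqsubset> d}. z \<sqsubset> y}) (c y) (qtype lt c r {z \<in> {z\<in>Z. z \<sqsubset> d}. y \<sqsubset> z}) = ?\<tau> y"
        unfolding l rr by simp
    qed
    have "?\<tau> ` Z \<subseteq> ?\<tau> ` {z\<in>Z. z \<sqsubset> d}"
    proof
      fix v assume "v \<in> ?\<tau> ` Z"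
      then obtain y where y: "y \<in> Z" "v = ?\<tau> y" by blast
      have yX: "y \<in> X" using y(1) Suc.prems(2) unfolding upclosed_def by blast
      show "v \<in> ?\<tau> ` {z\<in>Z. z \<sqsubset> d}"
      proof (cases "y \<sqsubset> d")
        case False
        then have ytl: "y \<in> tail_from (f n)" unfolding tail_from_def using yX d(1)[of n] tr by blast
        then obtain y' where y': "y' \<in> between (f n) (f (Suc n))" "c y' = c y"
          "qtype lt c k (between (f n) y') = qtype lt c k (between (f n) y)" "qtype lt c k (above y') = qtype lt c k (above y)"
          using f(3)[of n] unfolding witnessed_def by blast
        have y'tail_from: "y' \<in> tail_from (f n)" using y'(1) unfolding between_def tail_from_def by blast
        have y'd: "y' \<sqsubset> d" using y'(1) d(1)[of "Suc n"] tr unfolding between_def by blast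
        have split: "qtype lt c r {z\<in>Z. z \<sqsubset> u} = tadd r (qtype lt c r {z\<in>Z. z \<sqsubset> f n}) (qtype lt c r (between (f n) u))"
          if "u \<in> tail_from (f n)" for u
        proof -
          have u: "u \<in> X" "\<not> u \<sqsubset> f n" using that unfolding tail_from_def by auto
          have "{z\<in>Z. z \<sqsubset> u} = {z\<in>Z. z \<sqsubset> f n} \<union> between (f n) u"
          proof -
            have "z \<sqsubset> u" if "z \<sqsubset> f n" for z using le[OF fX u] that tr by blast
            moreover have "between (f n) u \<subseteq> Z" using Suc.prems(3) unfolding between_def tail_from_def by blast
            ultimately show ?thesis using Suc.prems(2) unfolding between_def upclosed_def by blast
          qed
          moreover have "before lt {z\<in>Z. z \<sqsubset> f n} (between (f n) u)"
            unfolding before_def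
          proof (intro ballI)
            fix a b assume "a \<in> {z\<in>Z. z \<sqsubset> f n}" "b \<in> between (f n) u"
            then have "a \<sqsubset> f n" "b \<in> X" "\<not> b \<sqsubset> f n" unfolding between_def by auto
            then show "a \<sqsubset> b" using le[OF fX, of b n] tr by blast
          qed
          ultimately show ?thesis using qtype_Un[OF fin_col[OF c]] by simp
        qed
        have "qtype lt c r (between (f n) y') = qtype lt c r (between (f n) y)" "qtype lt c r (above y') = qtype lt c r (above y)"
          by (rule qtype_eq_mono[OF fin_im[OF c] fin_im[OF c] _ r(1)], rule y')+
        then have "?\<tau> y = ?\<tau> y'" unfolding split[OF ytl] split[OF y'tail_from] y'(2) by simp
        moreover have "y' \<in> {z\<in>Z. z \<sqsubset> d}" using y'd y'tail_from Suc.prems(3) by blast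
        ultimately show ?thesis using y(2) by blast
      qed (use y in blast)
    qed
    then have "?\<tau> ` Z = ?\<tau> ` {z\<in>Z. z \<sqsubset> d}" by blast
    then show ?case using 1 2 by (simp only: els_eq_iff[symmetric])
  qed simp
  show ?thesis unfolding good_def
  proof (intro allI impI)
    fix Z assume Z: "upclosed Z \<and> (\<exists>x\<in>X. x \<sqsubset> d \<and> above x \<subseteq> Z)"
    then obtain x where x: "x \<in> X" "x \<sqsubset> d" "above x \<subseteq> Z" by blast
    obtain n where "x \<sqsubset> f n" using d(2)[OF x(1,2)] by blast
    then have "tail_from (f n) \<subseteq> Z" using tail_from_above x(3) by blast
    then show "qtype lt c (Suc k) {z\<in>Z. z \<sqsubset> d} = qtype lt c (Suc k) Z"
      using main[of "Suc k" Z n] Z by blast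
  qed
qed

lemma good_ex:
  assumes "i \<in> D"
  shows "\<exists>d\<in>D. i \<sqsubset> d \<and> good d"
proof -
  obtain s where s: "\<And>i. i \<in> D \<Longrightarrow> s i \<in> D \<and> i \<sqsubset> s i \<and> witnessed i (s i)" using witnessed_ex by metis
  define f where "f n = (s ^^ n) i" for n
  have fD: "f n \<in> D" for n unfolding f_def by (induction n) (use assms s in auto)
  have f: "f n \<sqsubset> f (Suc n)" "witnessed (f n) (f (Suc n))" for n using s[OF fD[of n]] unfolding f_def by auto
  obtain d where d: "d \<in> D" "\<forall>n. f n \<sqsubset> d" "\<forall>y\<in>X. y \<sqsubset> d \<longrightarrow> (\<exists>n. y \<sqsubset> f n)"
    using sup[of f, OF fD f(1)] by blast
  have "good d" by (rule good_limit[of f]) (use fD f d in auto)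
  moreover have "i \<sqsubset> d" using d(2) unfolding f_def by (metis funpow_0)
  ultimately show ?thesis using d(1) by blast
qed

lemma good_tail_from:
  assumes "i \<in> D" "i \<sqsubset> d" "good d"
  shows "qtype lt c (Suc k) (between i d) = qtype lt c (Suc k) (tail_from i)"
proof -
  have "{z\<in>tail_from i. z \<sqsubset> d} = between i d" unfolding tail_from_def between_def by blast
  moreover have "above i \<subseteq> tail_from i" unfolding above_def tail_from_def using asym by blast
  then have "\<exists>x\<in>X. x \<sqsubset> d \<and> above x \<subseteq> tail_from i" using assms(1,2) DX by blast
  ultimately show ?thesis using assms(3)[unfolded good_def, rule_format, of "tail_from i"] upclosed_tail_from[of i] by simp
qed

text \<open>
  A type of rank \<open>k + 1\<close> determines which triples of rank \<open>k\<close> occur, hence good points witness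
  everything below them. Sequences of good points therefore satisfy the hypothesis of \<open>good_limit\<close>.
\<close>

lemma witnessed_good:
  assumes i: "i \<in> D" "i \<sqsubset> d" and g: "good d"
  shows "witnessed i d"
  unfolding witnessed_def
proof
  fix y assume y: "y \<in> tail_from i"
  have gtl: "{z\<in>tail_from i. y \<sqsubset> z} = above y" if "y \<in> tail_from i" for y
    using that upclosed_tail_from[of i] unfolding upclosed_def above_def tail_from_def by blast
  have ivl: "{z\<in>tail_from i. z \<sqsubset> y} = between i y" for y unfolding tail_from_def between_def by blast
  have "cut (qtype lt c k {z\<in>tail_from i. z \<sqsubset> y}) (c y) (qtype lt c k {z\<in>tail_from i. y \<sqsubset> z}) \<in> els (qtype lt c (Suc k) (tail_from i))"
    unfolding els_qtype_Suc[OF fin_im[OF c]] using y by blast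
  then have "cut (qtype lt c k (between i y)) (c y) (qtype lt c k (above y)) \<in> els (qtype lt c (Suc k) (between i d))"
    unfolding good_tail_from[OF assms] ivl gtl[OF y] .
  then obtain y' where y': "y' \<in> between i d" "qtype lt c k (between i y) = qtype lt c k {z\<in>between i d. z \<sqsubset> y'}" "c y = c y'"
     "qtype lt c k (above y) = qtype lt c k {z\<in>between i d. y' \<sqsubset> z}"
    unfolding els_qtype_Suc[OF fin_im[OF c]] by auto
  have y'X: "y' \<in> X" "y' \<sqsubset> d" "y' \<in> tail_from i" using y'(1) unfolding between_def tail_from_def by auto
  have "{z\<in>between i d. z \<sqsubset> y'} = between i y'" using y'X tr unfolding between_def by blast
  moreover have "{z\<in>between i d. y' \<sqsubset> z} = {z\<in>above y'. z \<sqsubset> d}"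
    using gtl[OF y'X(3)] unfolding between_def tail_from_def by blast
  moreover have "qtype lt c (Suc k) {z\<in>above y'. z \<sqsubset> d} = qtype lt c (Suc k) (above y')"
    using g[unfolded good_def, rule_format, of "above y'"] upclosed_above y'X by blast
  then have "qtype lt c k {z\<in>above y'. z \<sqsubset> d} = qtype lt c k (above y')"
    by (rule qtype_eq_mono[OF fin_im[OF c] fin_im[OF c]]) simp
  ultimately show "\<exists>y'\<in>between i d. c y' = c y \<and>
     qtype lt c k (between i y') = qtype lt c k (between i y) \<and> qtype lt c k (above y') = qtype lt c k (above y)"
    using y' by auto
qed

text \<open>
  For some \<open>e\<close>, the good points whose tail has type \<open>e\<close> are unbounded. Take an increasing sequence of
  them, with supremum \<open>\<delta>\<close>. The piece between consecutive members has type \<open>e\<close>, since truncation at a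
  good point does not change the type of a tail; so the part from the first member
  up to \<open>\<delta>\<close> has type \<open>e \<cdot> \<omega>\<close>. It also has type \<open>e\<close>, because \<open>\<delta>\<close> is good again.
\<close>

lemma idempotent_tail:
  assumes "i \<in> D"
  shows "\<exists>d\<in>D. \<exists>d'\<in>D. i \<sqsubset> d \<and> d \<sqsubset> d' \<and>
    qtype lt c (Suc k) (between d d') = qtype lt c (Suc k) (tail_from d) \<and>
    tomega C (Suc k) (qtype lt c (Suc k) (tail_from d)) = qtype lt c (Suc k) (tail_from d)"
proof -
  let ?t = "\<lambda>d. qtype lt c (Suc k) (tail_from d)"
  have t: "?t d \<in> els (universe C (Suc k))" for d by (rule qtype_universe) (use c in auto)
  have "\<exists>e. \<forall>b\<in>D. \<exists>d\<in>D. b \<sqsubset> d \<and> good d \<and> ?t d = e"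
  proof (rule ccontr)
    assume "\<nexists>e. \<forall>b\<in>D. \<exists>d\<in>D. b \<sqsubset> d \<and> good d \<and> ?t d = e"
    then have "\<forall>e. \<exists>b\<in>D. \<forall>d\<in>D. b \<sqsubset> d \<and> good d \<longrightarrow> ?t d \<noteq> e" by blast
    then obtain b where b: "\<And>e. b e \<in> D" "\<And>e d. d \<in> D \<Longrightarrow> b e \<sqsubset> d \<Longrightarrow> good d \<Longrightarrow> ?t d \<noteq> e" by metis
    obtain j where j: "j \<in> D" "\<forall>x\<in>b ` els (universe C (Suc k)). x \<sqsubset> j"
      using bound[of "b ` els (universe C (Suc k))"] b(1) DX by (auto simp: image_subset_iff)
    obtain d where d: "d \<in> D" "j \<sqsubset> d" "good d" using good_ex[OF j(1)] by blast
    have "b (?t d) \<sqsubset> d" using j(2) t[of d] d(2) tr by blast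
    then show False using b(2)[OF d(1) _ d(3)] by blast
  qed
  then obtain e s where s: "\<And>b. b \<in> D \<Longrightarrow> s b \<in> D \<and> b \<sqsubset> s b \<and> good (s b) \<and> ?t (s b) = e" by metis
  define f where "f n = (s ^^ Suc n) i" for n
  have fs: "f n \<in> D \<and> good (f n) \<and> ?t (f n) = e" for n
    unfolding f_def by (induction n) (use assms s in auto)
  have f: "f n \<sqsubset> f (Suc n)" for n using s[of "f n"] fs unfolding f_def by simp
  have fD: "f n \<in> D" for n using fs by blast
  obtain d where d: "d \<in> D" "\<forall>n. f n \<sqsubset> d" "\<forall>y\<in>X. y \<sqsubset> d \<longrightarrow> (\<exists>n. y \<sqsubset> f n)"
    using sup[of f, OF fD f] by blast
  have w: "witnessed (f n) (f (Suc n))" for n by (rule witnessed_good) (use fs f in auto)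
  have g: "good d" by (rule good_limit[of f]) (use fD f w d in auto)
  have piece: "qtype lt c (Suc k) (between (f n) (f (Suc n))) = e" for n
    using good_tail_from[OF fD f, of n] fs by simp
  have mono: "f m \<sqsubset> f n" if "m < n" for m n
    using that by (induction n) (use f tr less_Suc_eq in \<open>blast+\<close>)
  have le': "\<not> f n \<sqsubset> f m" if "m \<le> n" for m n
    using mono[of m n] that asym irr by (cases "m = n") auto
  have "(\<Union>n. between (f n) (f (Suc n))) = between (f 0) d"
  proof (intro subset_antisym subsetI)
    fix y assume "y \<in> (\<Union>n. between (f n) (f (Suc n)))"
    then obtain n where n: "y \<in> X" "\<not> y \<sqsubset> f n" "y \<sqsubset> f (Suc n)" unfolding between_def by blast
    have "\<not> y \<sqsubset> f 0" using n(2) mono[of 0 n] tr by (cases "n = 0") auto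
    moreover have "y \<sqsubset> d" using n(3) d(2) tr by blast
    ultimately show "y \<in> between (f 0) d" unfolding between_def using n(1) by blast
  next
    fix y assume "y \<in> between (f 0) d"
    then have y: "y \<in> X" "\<not> y \<sqsubset> f 0" "y \<sqsubset> d" unfolding between_def by auto
    then have ex: "\<exists>n. y \<sqsubset> f n" using d(3) by blast
    define m where "m = (LEAST n. y \<sqsubset> f n)"
    have m: "y \<sqsubset> f m" unfolding m_def using ex by (rule LeastI_ex)
    then obtain m' where m': "m = Suc m'" using y(2) by (cases m) auto
    then have "\<not> y \<sqsubset> f m'" using not_less_Least[of m' "\<lambda>n. y \<sqsubset> f n"] unfolding m_def by simp
    then show "y \<in> (\<Union>n. between (f n) (f (Suc n)))" using m y(1) unfolding m' between_def by blast
  qed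
  moreover have "qtype lt c (Suc k) (\<Union>n. between (f n) (f (Suc n))) = tomega C (Suc k) e"
  proof (rule qtype_UN_omega[OF c _ piece])
    fix m n :: nat assume "m < n"
    show "before lt (between (f m) (f (Suc m))) (between (f n) (f (Suc n)))"
      unfolding before_def
    proof (intro ballI)
      fix a b assume "a \<in> between (f m) (f (Suc m))" "b \<in> between (f n) (f (Suc n))"
      then have ab: "a \<sqsubset> f (Suc m)" "b \<in> X" "\<not> b \<sqsubset> f n" unfolding between_def by auto
      have "a \<sqsubset> f n" using ab(1) mono[of "Suc m" n] \<open>m < n\<close> tr by (cases "Suc m = n") auto
      then show "a \<sqsubset> b" using le[of "f n" b] ab fD[of n] DX tr by blast
    qed
  qed
  moreover have "qtype lt c (Suc k) (between (f 0) d) = e"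
    using good_tail_from[OF fD[of 0] _ g] d(2) fs[of 0] by simp
  ultimately have "tomega C (Suc k) e = e" by simp
  moreover have "i \<sqsubset> f 0" using s[OF assms] unfolding f_def by simp
  ultimately show ?thesis using fD[of 0] fD[of 1] f[of 0] piece[of 0] fs[of 0] by (metis One_nat_def)
qed

end

section \<open>Well-ordered sums of blocks\<close>

text \<open>
  Each block is indexed by its least element, so that blocks and points live in one order.
\<close>

locale blocks = strict_order +
  fixes I :: "'a set" and A :: "'a \<Rightarrow> 'a set" and N :: nat
  assumes blk: "i \<in> I \<Longrightarrow> omega_block lt N (A i)"
    and mem: "i \<in> I \<Longrightarrow> i \<in> A i"
    and least: "i \<in> I \<Longrightarrow> x \<in> A i \<Longrightarrow> x = i \<or> i \<sqsubset> x"
    and ord: "i \<in> I \<Longrightarrow> j \<in> I \<Longrightarrow> i \<sqsubset> j \<Longrightarrow> before lt (A i) (A j)"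
    and tot: "i \<in> I \<Longrightarrow> j \<in> I \<Longrightarrow> i \<sqsubset> j \<or> i = j \<or> j \<sqsubset> i"
    and wf: "J \<subseteq> I \<Longrightarrow> J \<noteq> {} \<Longrightarrow> \<exists>m\<in>J. \<forall>j\<in>J. \<not> j \<sqsubset> m"
begin

definition union_of where "union_of J = (\<Union>i\<in>J. A i)"
definition seg where "seg J i j = {l\<in>J. \<not> l \<sqsubset> i \<and> l \<sqsubset> j}"

lemma bef: "i \<in> I \<Longrightarrow> j \<in> I \<Longrightarrow> i \<sqsubset> j \<Longrightarrow> a \<in> A i \<Longrightarrow> b \<in> A j \<Longrightarrow> a \<sqsubset> b"
  using ord unfolding before_def by blast

lemma lt_iff:
  assumes "i \<in> I" "j \<in> I" "x \<in> A i"
  shows "x \<sqsubset> j \<longleftrightarrow> i \<sqsubset> j"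
proof
  assume "x \<sqsubset> j"
  then show "i \<sqsubset> j" using least[OF assms(1,3)] tr by blast
qed (rule bef[OF assms(1,2) _ assms(3) mem[OF assms(2)]])

lemma union_of_total:
  assumes "J \<subseteq> I" "x \<in> union_of J" "y \<in> union_of J"
  shows "x \<sqsubset> y \<or> x = y \<or> y \<sqsubset> x"
proof -
  obtain i j where ij: "i \<in> I" "j \<in> I" "x \<in> A i" "y \<in> A j" using assms unfolding union_of_def by blast
  show ?thesis
  proof (cases "i = j")
    case True then show ?thesis using omega_block_total[OF blk[OF ij(1)]] ij by blast
  next
    case False then show ?thesis using tot[OF ij(1,2)] bef ij by blast
  qed
qed

lemma union_of_seg: "J \<subseteq> I \<Longrightarrow> i \<in> I \<Longrightarrow> j \<in> I \<Longrightarrow> union_of (seg J i j) = {y\<in>union_of J. \<not> y \<sqsubset> i \<and> y \<sqsubset> j}"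
  unfolding union_of_def seg_def using lt_iff by blast

lemma before_union_of:
  assumes "J \<subseteq> I" "K \<subseteq> I" "\<And>i j. i \<in> J \<Longrightarrow> j \<in> K \<Longrightarrow> i \<sqsubset> j"
  shows "before lt (union_of J) (union_of K)"
  unfolding before_def union_of_def using bef assms by blast

context
  fixes C k :: nat
  assumes st: "stable C k (power_types C k N)"
begin

interpretation st: stable C k "power_types C k N" by (rule st)

abbreviation (input) E where "E \<equiv> power_types C k N"
abbreviation (input) U where "U \<equiv> st.U"

lemma qtypes_A: "i \<in> I \<Longrightarrow> qtypes lt C k (A i) = E"
  by (rule qtypes_omega_block[OF st.C blk])

text \<open>
  The induction hypothesis for proper initial segments, stated for all intervals because
  the pieces of a decomposition are intervals.
\<close>

definition segs_ok where
  "segs_ok J \<longleftrightarrow> (\<forall>i\<in>J. \<forall>j\<in>J. i \<sqsubset> j \<longrightarrow> qtypes lt C k (union_of (seg J i j)) \<in> {E, U})"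

text \<open>
  A last block turns \<open>U\<close> into \<open>E\<close>, by \<open>U + E = E\<close>.
\<close>

lemma qtypes_max:
  assumes J: "J \<subseteq> I" and ok: "segs_ok J" and m: "m \<in> J" "\<And>j. j \<in> J \<Longrightarrow> \<not> m \<sqsubset> j"
  shows "qtypes lt C k (union_of J) = E"
proof (cases "J = {m}")
  case True
  then show ?thesis using qtypes_A m(1) J by (simp add: union_of_def)
next
  case False
  have JI: "j \<in> I" if "j \<in> J" for j using that J by blast
  obtain i0 where i0: "i0 \<in> J" "\<And>j. j \<in> J \<Longrightarrow> \<not> j \<sqsubset> i0" using wf[OF J] m(1) by blast
  have lt: "j \<sqsubset> m" if "j \<in> J" "j \<noteq> m" for j using tot[OF JI JI] that m by blast
  have im: "i0 \<sqsubset> m"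
  proof (rule ccontr)
    assume n: "\<not> i0 \<sqsubset> m"
    then have "i0 = m" using lt i0(1) by blast
    then have "j = m" if "j \<in> J" for j using that lt i0(2) by blast
    then show False using False m(1) by blast
  qed
  have J2: "J = seg J i0 m \<union> {m}"
    unfolding seg_def using i0(2) lt m(1) by blast
  have "union_of J = union_of (seg J i0 m) \<union> A m" by (subst J2) (auto simp: union_of_def)
  moreover have "before lt (union_of (seg J i0 m)) (A m)"
    unfolding before_def
  proof (intro ballI)
    fix x y assume "x \<in> union_of (seg J i0 m)" "y \<in> A m"
    then obtain i where "i \<in> J" "i \<sqsubset> m" "x \<in> A i" unfolding union_of_def seg_def by blast
    then show "x \<sqsubset> y" using bef[OF JI JI[OF m(1)] _ _ \<open>y \<in> A m\<close>] by blast
  qed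
  moreover have "set_tadd k P E = E" if "P \<in> {E, U}" for P using that st.EE st.U_E by auto
  moreover have "qtypes lt C k (union_of (seg J i0 m)) \<in> {E, U}"
    using ok im i0(1) m(1) unfolding segs_ok_def by blast
  ultimately show ?thesis using qtypes_Un[OF st.C] qtypes_A[OF JI[OF m(1)]] by simp
qed

lemma seg_seg:
  assumes "J \<subseteq> I" "a \<in> J" "b \<in> J" "i \<in> seg J a b" "j \<in> seg J a b"
  shows "seg (seg J a b) i j = seg J i j"
proof -
  have "l \<in> seg J a b" if "l \<in> J" "\<not> l \<sqsubset> i" "l \<sqsubset> j" for l
  proof -
    have "i \<in> J" "\<not> i \<sqsubset> a" "j \<sqsubset> b" using assms(4,5) unfolding seg_def by auto
    then have "\<not> l \<sqsubset> a" using that tot[of l i] assms(1) tr by blast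
    then show ?thesis using that \<open>j \<sqsubset> b\<close> tr unfolding seg_def by blast
  qed
  then show ?thesis unfolding seg_def by blast
qed

lemma segs_ok_seg:
  assumes "J \<subseteq> I" "a \<in> J" "b \<in> J" "segs_ok J"
  shows "segs_ok (seg J a b)"
  unfolding segs_ok_def
proof (intro ballI impI)
  fix i j assume ij: "i \<in> seg J a b" "j \<in> seg J a b" "i \<sqsubset> j"
  then have "i \<in> J" "j \<in> J" unfolding seg_def by auto
  then show "qtypes lt C k (union_of (seg (seg J a b) i j)) \<in> {E, U}"
    unfolding seg_seg[OF assms(1-3) ij(1,2)] using assms(4) ij(3) unfolding segs_ok_def by blast
qed

text \<open>
  The sum is cut at successors, so that every piece has a last block and contributes \<open>E\<close>
  regardless of the cofinalities that occur inside it.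
\<close>

lemma qtypes_countable_cofinality:
  fixes f :: "nat \<Rightarrow> 'a"
  assumes J: "J \<subseteq> I" "J \<noteq> {}" and ok: "segs_ok J" and nomax: "\<And>i. i \<in> J \<Longrightarrow> \<exists>j\<in>J. i \<sqsubset> j"
    and f: "\<And>n. f n \<in> J" "\<And>j. j \<in> J \<Longrightarrow> \<exists>n. j \<sqsubset> f n"
  shows "qtypes lt C k (union_of J) = E"
proof -
  have JI: "j \<in> I" if "j \<in> J" for j using that J(1) by blast
  obtain i0 where i0: "i0 \<in> J" "\<And>j. j \<in> J \<Longrightarrow> \<not> j \<sqsubset> i0" using wf[OF J] by blast
  have "\<exists>m. m \<in> J \<and> i \<sqsubset> m \<and> (\<forall>j\<in>J. i \<sqsubset> j \<longrightarrow> \<not> j \<sqsubset> m)" if "i \<in> J" for i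
    using wf[of "{j\<in>J. i \<sqsubset> j}"] J(1) nomax[OF that] by blast
  then obtain s where s: "\<And>i. i \<in> J \<Longrightarrow> s i \<in> J \<and> i \<sqsubset> s i \<and> (\<forall>j\<in>J. i \<sqsubset> j \<longrightarrow> \<not> j \<sqsubset> s i)"
    by metis
  \<comment> \<open>The cut point after \<open>g n\<close> is the successor of the larger of \<open>g n\<close> and
    \<open>f n\<close>; so the cut points overtake \<open>f\<close> and are cofinal.\<close>
  define mx where "mx a b = (if a \<sqsubset> b then b else a)" for a b
  define g where "g = rec_nat i0 (\<lambda>n a. s (mx a (f n)))"
  have g0: "g 0 = i0" and gS: "g (Suc n) = s (mx (g n) (f n))" for n unfolding g_def by simp_all
  have gJ: "g n \<in> J" for n
  proof (induction n)
    case (Suc n)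
    then have "mx (g n) (f n) \<in> J" unfolding mx_def using f(1) by simp
    then show ?case unfolding gS using s by blast
  qed (simp add: g0 i0)
  have mxJ: "mx (g n) (f n) \<in> J" for n unfolding mx_def using f(1) gJ by simp
  note s' = s[OF mxJ, folded gS]
  have g_lt: "g n \<sqsubset> g (Suc n)" and f_lt: "f n \<sqsubset> g (Suc n)" for n
  proof -
    have "mx (g n) (f n) \<sqsubset> g (Suc n)" using s' by blast
    moreover have "f n = g n \<or> f n \<sqsubset> g n \<or> g n \<sqsubset> f n" using tot[OF JI JI] f(1) gJ by blast
    ultimately show "g n \<sqsubset> g (Suc n)" "f n \<sqsubset> g (Suc n)"
      unfolding mx_def using tr[of "g n" "f n" "g (Suc n)"] tr[of "f n" "g n" "g (Suc n)"]
      by (auto split: if_splits)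
  qed
  have mono: "g m \<sqsubset> g n" if "m < n" for m n
    using that
  proof (induction n)
    case (Suc n) then show ?case using g_lt[of n] tr[of "g m" "g n"] by (cases "m = n") auto
  qed simp
  let ?P = "\<lambda>n. seg J (g n) (g (Suc n))"
  have "qtypes lt C k (union_of (?P n)) = E" for n
  proof (rule qtypes_max)
    show "?P n \<subseteq> I" unfolding seg_def using J(1) by blast
    show "segs_ok (?P n)" by (rule segs_ok_seg[OF J(1) gJ gJ ok])
    have "\<not> mx (g n) (f n) \<sqsubset> g n" unfolding mx_def using irr asym by auto
    then show "mx (g n) (f n) \<in> ?P n" unfolding seg_def using mxJ s'[of n] by blast
    fix j assume "j \<in> ?P n"
    then have "j \<in> J" "j \<sqsubset> g (Suc n)" unfolding seg_def by auto
    then show "\<not> mx (g n) (f n) \<sqsubset> j" using s'[of n] by blast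
  qed
  moreover have "before lt (union_of (?P m)) (union_of (?P n))" if "m < n" for m n
  proof (rule before_union_of)
    show "?P m \<subseteq> I" "?P n \<subseteq> I" unfolding seg_def using J(1) by blast+
    fix i j assume "i \<in> ?P m" "j \<in> ?P n"
    then have ij: "i \<sqsubset> g (Suc m)" "j \<in> J" "\<not> j \<sqsubset> g n" unfolding seg_def by auto
    have "i \<sqsubset> g n" using mono[of "Suc m" n] that ij(1) tr by (cases "Suc m = n") auto
    then show "i \<sqsubset> j" using tot[OF JI[OF gJ[of n]] JI[OF ij(2)]] ij(3) tr by blast
  qed
  ultimately have "qtypes lt C k (\<Union>n. union_of (?P n)) = set_tomega C k E" by (intro qtypes_omega[OF st.C])
  moreover have "(\<Union>n. union_of (?P n)) = union_of J"
  proof -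
    have "\<exists>n. j \<in> ?P n" if j: "j \<in> J" for j
    proof -
      obtain n where "j \<sqsubset> f n" using f(2)[OF j] by blast
      then have ex: "\<exists>n. j \<sqsubset> g n" using f_lt[of n] tr by blast
      define m where "m = (LEAST n. j \<sqsubset> g n)"
      have m: "j \<sqsubset> g m" unfolding m_def using ex by (rule LeastI_ex)
      then obtain m' where m': "m = Suc m'" using i0(2)[OF j] g0 by (cases m) auto
      then have "\<not> j \<sqsubset> g m'" using not_less_Least[of m' "\<lambda>n. j \<sqsubset> g n"] unfolding m_def by simp
      then show ?thesis using m j unfolding m' seg_def by blast
    qed
    then show ?thesis unfolding union_of_def seg_def by blast
  qed
  ultimately show ?thesis using st.OmE by simp
qed

lemma qtypes_uncountable_cofinality:
  assumes J: "J \<subseteq> I" "J \<noteq> {}" and ok: "segs_ok J" and nomax: "\<And>i. i \<in> J \<Longrightarrow> \<exists>j\<in>J. i \<sqsubset> j"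
    and unc: "\<And>f :: nat \<Rightarrow> 'a. (\<And>n. f n \<in> J) \<Longrightarrow> \<exists>j\<in>J. \<forall>n. \<not> j \<sqsubset> f n"
    and k: "k > 0"
  shows "qtypes lt C k (union_of J) = U"
proof -
  have JI: "j \<in> I" if "j \<in> J" for j using that J(1) by blast
  obtain i0 where i0: "i0 \<in> J" "\<And>j. j \<in> J \<Longrightarrow> \<not> j \<sqsubset> i0" using wf[OF J] by blast
  obtain k' where k': "k = Suc k'" using k by (cases k) auto
  have segE: "qtypes lt C k (union_of (seg J i j)) \<subseteq> E" if "i \<in> J" "j \<in> J" "i \<sqsubset> j" for i j
    using ok that st.U_sub_E unfolding segs_ok_def by blast
  show ?thesis
  proof (intro subset_antisym subsetI)
    fix t assume "t \<in> qtypes lt C k (union_of J)"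
    then obtain c where c: "range c \<subseteq> els C" "t = qtype lt c k (union_of J)" unfolding qtypes_def by blast
    interpret cs: cofinal_set lt "union_of J" J C k' c
    proof
      show "J \<subseteq> union_of J" unfolding union_of_def using mem JI by blast
      show "\<exists>d\<in>J. x \<sqsubset> d" if x: "x \<in> union_of J" for x
      proof -
        obtain i where i: "i \<in> J" "x \<in> A i" using x unfolding union_of_def by blast
        obtain j where j: "j \<in> J" "i \<sqsubset> j" using nomax[OF i(1)] by blast
        then show ?thesis using lt_iff[OF JI[OF i(1)] JI[OF j(1)] i(2)] by blast
      qed
      fix f :: "nat \<Rightarrow> 'a" assume f: "\<And>n. f n \<in> J" "\<And>n. f n \<sqsubset> f (Suc n)"
      let ?B = "{j\<in>J. \<forall>n. f n \<sqsubset> j}"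
      obtain b where b: "b \<in> J" "\<forall>n. \<not> b \<sqsubset> f n" using unc[of f, OF f(1)] by blast
      have "f n \<sqsubset> b" for n
        using f(2)[of n] b tot[OF JI[OF b(1)] JI[OF f(1)[of "Suc n"]]] tr by blast
      then have "?B \<noteq> {}" using b(1) by blast
      then obtain d where d: "d \<in> ?B" "\<forall>j\<in>?B. \<not> j \<sqsubset> d" using wf[of ?B] J(1) by blast
      have "\<exists>n. y \<sqsubset> f n" if y: "y \<in> union_of J" "y \<sqsubset> d" for y
      proof -
        obtain i where i: "i \<in> J" "y \<in> A i" using y unfolding union_of_def by blast
        have "i \<sqsubset> d" using lt_iff[OF JI[OF i(1)] JI i(2)] d(1) y(2) by blast
        then obtain n where "\<not> f n \<sqsubset> i" using d(2) i(1) by blast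
        then have "i \<sqsubset> f (Suc n)" using tot[OF JI[OF i(1)] JI[OF f(1)[of n]]] f(2)[of n] tr by blast
        then show ?thesis using lt_iff[OF JI[OF i(1)] JI[OF f(1)] i(2)] by blast
      qed
      then show "\<exists>d\<in>J. (\<forall>n. f n \<sqsubset> d) \<and> (\<forall>y\<in>union_of J. y \<sqsubset> d \<longrightarrow> (\<exists>n. y \<sqsubset> f n))"
        using d(1) by blast
    next
      show "x \<sqsubset> y \<or> x = y \<or> y \<sqsubset> x" if "x \<in> union_of J" "y \<in> union_of J" for x y
        by (rule union_of_total[OF J(1) that])
    qed (rule J(2), rule c(1))
    obtain d d' where d: "d \<in> J" "d' \<in> J" "i0 \<sqsubset> d" "d \<sqsubset> d'"
      "qtype lt c k (cs.between d d') = qtype lt c k (cs.tail_from d)"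
      "tomega C k (qtype lt c k (cs.tail_from d)) = qtype lt c k (cs.tail_from d)"
      using cs.idempotent_tail[OF i0(1)] unfolding k' by blast
    let ?e = "qtype lt c k (cs.tail_from d)"
    have between: "cs.between i j = union_of (seg J i j)" if "i \<in> J" "j \<in> J" for i j
      unfolding cs.between_def by (rule union_of_seg[OF J(1) JI[OF that(1)] JI[OF that(2)], symmetric])
    have "?e \<in> E" using segE[OF d(1,2,4)] qtypes_I[OF c(1), of lt k "union_of (seg J d d')"] d(5) between[OF d(1,2)] by auto
    moreover have "qtype lt c k (union_of (seg J i0 d)) \<in> E"
      using segE[OF i0(1) d(1,3)] qtypes_I[OF c(1)] by blast
    moreover have "t = tadd k (qtype lt c k (union_of (seg J i0 d))) ?e"
    proof -
      have no: "\<not> y \<sqsubset> i0" if "y \<in> union_of J" for y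
        using that lt_iff[OF JI JI[OF i0(1)]] i0(2) unfolding union_of_def by blast
      have eq: "union_of J = cs.between i0 d \<union> cs.tail_from d" unfolding cs.between_def cs.tail_from_def using no by blast
      have b: "before lt (cs.between i0 d) (cs.tail_from d)" unfolding before_def
      proof (intro ballI)
        fix a b assume "a \<in> cs.between i0 d" "b \<in> cs.tail_from d"
        then have "a \<sqsubset> d" "b \<in> union_of J" "\<not> b \<sqsubset> d" unfolding cs.between_def cs.tail_from_def by auto
        then show "a \<sqsubset> b" using cs.le[of d b] cs.DX d(1) tr by blast
      qed
      show ?thesis unfolding c(2) between[OF i0(1) d(1), symmetric]
        by (rule trans[OF arg_cong[OF eq, of "qtype lt c k"] qtype_Un[OF fin_col[OF c(1)] b]])
    qed
    ultimately show "t \<in> U" unfolding st.U_def using d(6) by blast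
  next
    fix t assume "t \<in> U"
    then obtain s g where t: "t = tadd k s g" "s \<in> E" "g \<in> E" "tomega C k g = g" unfolding st.U_def by blast
    obtain c where c: "range c \<subseteq> els C"
      "\<And>i. i \<in> I \<Longrightarrow> qtype lt c k (A i) = (if i = i0 then s else g)"
    proof (rule qtypes_merge[OF st.C, of I A "\<lambda>i. if i = i0 then s else g" lt k])
      show "A i \<inter> A j = {}" if "i \<in> I" "j \<in> I" "i \<noteq> j" for i j
        using before_disj[OF ord[OF that(1,2)]] before_disj[OF ord[OF that(2,1)]] tot[OF that(1,2)] that(3)
        by blast
      show "(if i = i0 then s else g) \<in> qtypes lt C k (A i)" if "i \<in> I" for i
        using t(2,3) qtypes_A[OF that] by simp
    qed blast
    let ?K = "J - {i0}"
    have lt: "i0 \<sqsubset> j" if "j \<in> ?K" for j using that i0 tot[OF JI[OF i0(1)] JI] by blast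
    have ne: "?K \<noteq> {}" using nomax[OF i0(1)] irr by blast
    have "qtype lt c k (\<Union>i\<in>?K. A i) = g"
    proof (rule qtype_absorb[OF st.C c(1), of ?K])
      show "\<exists>m\<in>L. \<forall>j\<in>L. \<not> j \<sqsubset> m" if "L \<subseteq> ?K" "L \<noteq> {}" for L
        using wf[of L] that J(1) by blast
      show "i \<sqsubset> j \<or> i = j \<or> j \<sqsubset> i" if "i \<in> ?K" "j \<in> ?K" for i j using tot[OF JI JI] that by blast
      show "before lt (A i) (A j)" if "i \<in> ?K" "j \<in> ?K" "i \<sqsubset> j" for i j using ord[OF JI JI] that by blast
      show "qtype lt c k (A i) = g" if "i \<in> ?K" for i using c(2)[OF JI] that by auto
      show "realizable C k g" by (rule st.rzE[OF t(3)])
    qed (use ne t(4) in auto)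
    moreover have "union_of J = A i0 \<union> (\<Union>i\<in>?K. A i)" unfolding union_of_def using i0(1) by blast
    moreover have "before lt (A i0) (\<Union>i\<in>?K. A i)"
      unfolding before_def using bef[OF JI[OF i0(1)] JI] lt by blast
    ultimately have "qtype lt c k (union_of J) = t"
      using qtype_Un[OF fin_col[OF c(1)]] c(2)[OF JI[OF i0(1)]] t(1) by simp
    then show "t \<in> qtypes lt C k (union_of J)" by (rule qtypes_eqI[OF c(1)])
  qed
qed

lemma qtypes_cases:
  assumes J: "J \<subseteq> I" "J \<noteq> {}" and ok: "segs_ok J" and k: "k > 0"
  shows "qtypes lt C k (union_of J) \<in> {E, U}"
proof (cases "\<exists>m\<in>J. \<forall>j\<in>J. \<not> m \<sqsubset> j")
  case True
  then obtain m where "m \<in> J" "\<forall>j\<in>J. \<not> m \<sqsubset> j" by blast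
  then show ?thesis using qtypes_max[OF J(1) ok, of m] by blast
next
  case False
  then have nomax: "\<exists>j\<in>J. i \<sqsubset> j" if "i \<in> J" for i using that by blast
  show ?thesis
  proof (cases "\<exists>f::nat \<Rightarrow> 'a. (\<forall>n. f n \<in> J) \<and> (\<forall>j\<in>J. \<exists>n. j \<sqsubset> f n)")
    case True
    then obtain f :: "nat \<Rightarrow> 'a" where f: "\<forall>n. f n \<in> J" "\<forall>j\<in>J. \<exists>n. j \<sqsubset> f n" by blast
    have "qtypes lt C k (union_of J) = E"
      by (rule qtypes_countable_cofinality[OF J ok nomax, of f]; use f in blast)
    then show ?thesis by blast
  next
    case False
    then have unc: "\<exists>j\<in>J. \<forall>n. \<not> j \<sqsubset> f n" if "\<And>n. f n \<in> J" for f :: "nat \<Rightarrow> 'a"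
      using that by blast
    have "qtypes lt C k (union_of J) = U"
      by (rule qtypes_uncountable_cofinality[OF J ok nomax unc k])
    then show ?thesis by blast
  qed
qed

lemma segs_ok_I:
  assumes k: "k > 0"
  shows "segs_ok I"
proof (rule ccontr)
  assume "\<not> segs_ok I"
  define bad where "bad = {j\<in>I. \<exists>i\<in>I. i \<sqsubset> j \<and> qtypes lt C k (union_of (seg I i j)) \<notin> {E, U}}"
  have "bad \<noteq> {}" using \<open>\<not> segs_ok I\<close> unfolding bad_def segs_ok_def by blast
  moreover have "bad \<subseteq> I" unfolding bad_def by blast
  ultimately obtain j where j: "j \<in> bad" "\<forall>l\<in>bad. \<not> l \<sqsubset> j" using wf by blast
  then obtain i where i: "i \<in> I" "i \<sqsubset> j" "qtypes lt C k (union_of (seg I i j)) \<notin> {E, U}" and jI: "j \<in> I"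
    unfolding bad_def by blast
  let ?J = "seg I i j"
  have "i \<in> ?J" unfolding seg_def using i irr by blast
  moreover have "?J \<subseteq> I" unfolding seg_def by blast
  moreover have "segs_ok ?J" unfolding segs_ok_def
  proof (intro ballI impI)
    fix a b assume ab: "a \<in> ?J" "b \<in> ?J" "a \<sqsubset> b"
    then have "a \<in> I" "b \<in> I" "b \<sqsubset> j" unfolding seg_def by auto
    then show "qtypes lt C k (union_of (seg ?J a b)) \<in> {E, U}"
      unfolding seg_seg[OF subset_refl i(1) jI ab(1,2)] using j(2) ab(3) unfolding bad_def by blast
  qed
  ultimately show False using qtypes_cases[of ?J] k i(3) by blast
qed

theorem qtypes_blocks:
  assumes "I \<noteq> {}" "k > 0" and nomax: "\<And>i. i \<in> I \<Longrightarrow> \<exists>j\<in>I. i \<sqsubset> j"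
  shows "(\<exists>f::nat \<Rightarrow> 'a. (\<forall>n. f n \<in> I) \<and> (\<forall>j\<in>I. \<exists>n. j \<sqsubset> f n)) \<Longrightarrow> qtypes lt C k (union_of I) = E"
    and "(\<And>f::nat \<Rightarrow> 'a. (\<And>n. f n \<in> I) \<Longrightarrow> \<exists>j\<in>I. \<forall>n. \<not> j \<sqsubset> f n) \<Longrightarrow> qtypes lt C k (union_of I) = U"
proof -
  note ok = segs_ok_I[OF assms(2)]
  assume "\<exists>f::nat \<Rightarrow> 'a. (\<forall>n. f n \<in> I) \<and> (\<forall>j\<in>I. \<exists>n. j \<sqsubset> f n)"
  then obtain f :: "nat \<Rightarrow> 'a" where f: "\<forall>n. f n \<in> I" "\<forall>j\<in>I. \<exists>n. j \<sqsubset> f n" by blast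
  show "qtypes lt C k (union_of I) = E"
    by (rule qtypes_countable_cofinality[OF subset_refl assms(1) ok nomax, of f]; use f in blast)
next
  note ok = segs_ok_I[OF assms(2)]
  assume "\<And>f::nat \<Rightarrow> 'a. (\<And>n. f n \<in> I) \<Longrightarrow> \<exists>j\<in>I. \<forall>n. \<not> j \<sqsubset> f n"
  from qtypes_uncountable_cofinality[OF subset_refl assms(1) ok nomax this assms(2)]
  show "qtypes lt C k (union_of I) = U" .
qed

end

end


section \<open>Powers of omega as blocks\<close>

definition slt :: "'a rel \<Rightarrow> 'a \<Rightarrow> 'a \<Rightarrow> bool" where
  "slt r x y \<longleftrightarrow> (x, y) \<in> r \<and> x \<noteq> y"

lemma Well_order_props:
  assumes "Well_order r"
  shows "trans r" "antisym r" "x \<in> Field r \<Longrightarrow> (x, x) \<in> r"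
    "x \<in> Field r \<Longrightarrow> y \<in> Field r \<Longrightarrow> x \<noteq> y \<Longrightarrow> (x, y) \<in> r \<or> (y, x) \<in> r" "wf (r - Id)"
  using assms unfolding well_order_on_def linear_order_on_def partial_order_on_def preorder_on_def
    total_on_def refl_on_def by blast+

lemma strict_order_slt:
  assumes "Well_order r"
  shows "strict_order (slt r)"
proof
  show "\<not> slt r x x" for x unfolding slt_def by simp
  show "slt r x z" if "slt r x y" "slt r y z" for x y z
    using that Well_order_props(1,2)[OF assms] unfolding slt_def by (metis antisymD transD)
qed

lemma slt_total:
  assumes "Well_order r" "x \<in> Field r" "y \<in> Field r"
  shows "slt r x y \<or> x = y \<or> slt r y x"
  using Well_order_props(4)[OF assms] unfolding slt_def by blast

lemma slt_wf:
  assumes "Well_order r" "J \<noteq> {}"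
  shows "\<exists>m\<in>J. \<forall>j\<in>J. \<not> slt r j m"
proof -
  obtain x where "x \<in> J" using assms(2) by blast
  obtain m where "m \<in> J" "\<And>y. (y, m) \<in> r - Id \<Longrightarrow> y \<notin> J"
    using Well_order_props(5)[OF assms(1)] \<open>x \<in> J\<close> unfolding wf_eq_minimal by metis
  then show ?thesis unfolding slt_def by blast
qed

text \<open>
  The first elements of the well-order \<open>\<beta>\<close>, in increasing order.
\<close>

fun low :: "'b rel \<Rightarrow> nat \<Rightarrow> 'b" where
  "low \<beta> n = (SOME m. m \<in> Field \<beta> - low \<beta> ` {..<n} \<and>
     (\<forall>y\<in>Field \<beta> - low \<beta> ` {..<n}. \<not> slt \<beta> y m))"

declare low.simps [simp del]

lemma low:
  assumes "Well_order \<beta>" "infinite (Field \<beta>) \<or> n < card (Field \<beta>)"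
  shows "low \<beta> n \<in> Field \<beta>" "low \<beta> n \<notin> low \<beta> ` {..<n}"
    "y \<in> Field \<beta> \<Longrightarrow> slt \<beta> y (low \<beta> n) \<Longrightarrow> y \<in> low \<beta> ` {..<n}"
proof -
  let ?R = "Field \<beta> - low \<beta> ` {..<n}"
  have "?R \<noteq> {}"
  proof
    assume "?R = {}"
    then have "Field \<beta> \<subseteq> low \<beta> ` {..<n}" by blast
    then have "finite (Field \<beta>)" "card (Field \<beta>) \<le> card (low \<beta> ` {..<n})"
      by (auto intro: finite_subset card_mono)
    moreover have "card (low \<beta> ` {..<n}) \<le> n" using card_image_le[of "{..<n}" "low \<beta>"] by simp
    ultimately show False using assms(2) by simp
  qed
  then obtain m where m: "m \<in> ?R" "\<forall>y\<in>?R. \<not> slt \<beta> y m" using slt_wf[OF assms(1), of ?R] by auto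
  then have "\<exists>m. m \<in> ?R \<and> (\<forall>y\<in>?R. \<not> slt \<beta> y m)" by (intro exI[of _ m] conjI)
  then have "low \<beta> n \<in> ?R \<and> (\<forall>y\<in>?R. \<not> slt \<beta> y (low \<beta> n))"
    unfolding low.simps[of \<beta> n] by (rule someI_ex)
  then show "low \<beta> n \<in> Field \<beta>" "low \<beta> n \<notin> low \<beta> ` {..<n}"
    "y \<in> Field \<beta> \<Longrightarrow> slt \<beta> y (low \<beta> n) \<Longrightarrow> y \<in> low \<beta> ` {..<n}" by blast+
qed

lemma low_down:
  assumes "Well_order \<beta>" "infinite (Field \<beta>) \<or> N \<le> card (Field \<beta>)"
    and "x \<in> low \<beta> ` {..<N}" "y \<in> Field \<beta>" "slt \<beta> y x"
  shows "y \<in> low \<beta> ` {..<N}"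
proof -
  obtain m where m: "m < N" "x = low \<beta> m" using assms(3) by blast
  have "y \<in> low \<beta> ` {..<m}" by (rule low(3)[OF assms(1)]) (use m assms in auto)
  then show ?thesis using m(1) by auto
qed

lemma low_all:
  assumes "Well_order \<beta>" "finite (Field \<beta>)"
  shows "low \<beta> ` {..<card (Field \<beta>)} = Field \<beta>"
proof (rule card_subset_eq[OF assms(2)])
  let ?n = "card (Field \<beta>)"
  show "low \<beta> ` {..<?n} \<subseteq> Field \<beta>" using low(1)[OF assms(1)] by auto
  have ne: "low \<beta> i \<noteq> low \<beta> j" if "i < j" "j < ?n" for i j
  proof -
    have "low \<beta> i \<in> low \<beta> ` {..<j}" using that(1) by blast
    then show ?thesis using low(2)[OF assms(1), of j] that(2) by metis
  qed
  have "inj_on (low \<beta>) {..<?n}"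
  proof (rule inj_onI)
    fix i j assume "i \<in> {..<?n}" "j \<in> {..<?n}" "low \<beta> i = low \<beta> j"
    then show "i = j" using ne[of i j] ne[of j i] by (cases i j rule: linorder_cases) auto
  qed
  then show "card (low \<beta> ` {..<?n}) = ?n" by (simp add: card_image)
qed

text \<open>
  The functions that differ from \<open>g\<close> at most at the first \<open>N\<close> arguments. In the lexicographic order,
  where large arguments come first, they form an interval of type \<open>\<omega>\<^sup>N\<close> inside \<open>\<omega>\<^sup>\<beta>\<close>.
\<close>

definition low_block :: "'b rel \<Rightarrow> nat \<Rightarrow> ('b \<Rightarrow> nat) \<Rightarrow> ('b \<Rightarrow> nat) set" where
  "low_block \<beta> N g = {f \<in> fin_supp \<beta>. \<forall>x. x \<notin> low \<beta> ` {..<N} \<longrightarrow> f x = g x}"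

lemma omega_power_I:
  "f \<in> fin_supp \<beta> \<Longrightarrow> g \<in> fin_supp \<beta> \<Longrightarrow> x \<in> Field \<beta> \<Longrightarrow> f x < g x \<Longrightarrow>
     (\<And>y. (x, y) \<in> \<beta> \<Longrightarrow> y \<noteq> x \<Longrightarrow> f y = g y) \<Longrightarrow> slt (omega_power \<beta>) f g"
  unfolding slt_def omega_power_def by auto

lemma omega_power_E:
  assumes "slt (omega_power \<beta>) f g"
  shows "\<exists>x\<in>Field \<beta>. f x < g x \<and> (\<forall>y. (x, y) \<in> \<beta> \<and> y \<noteq> x \<longrightarrow> f y = g y)"
  using assms unfolding slt_def omega_power_def by auto

lemma fin_suppI:
  assumes "finite A" "A \<subseteq> Field \<beta>" "\<And>x. x \<notin> A \<Longrightarrow> f x = 0"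
  shows "f \<in> fin_supp \<beta>"
proof -
  have "{x. f x \<noteq> 0} \<subseteq> A"
  proof
    fix x assume "x \<in> {x. f x \<noteq> 0}"
    then show "x \<in> A" using assms(3)[of x] by auto
  qed
  then have "finite {x. f x \<noteq> 0}" "{x. f x \<noteq> 0} \<subseteq> Field \<beta>"
    by (rule finite_subset[OF _ assms(1)], rule subset_trans[OF _ assms(2)])
  then show ?thesis unfolding fin_supp_def by (intro CollectI conjI)
qed

lemma fin_suppD: "f \<in> fin_supp \<beta> \<Longrightarrow> finite {x. f x \<noteq> 0}" "f \<in> fin_supp \<beta> \<Longrightarrow> {x. f x \<noteq> 0} \<subseteq> Field \<beta>"
  unfolding fin_supp_def by simp_all

lemma fin_supp_upd:
  assumes "g \<in> fin_supp \<beta>" "b \<in> Field \<beta>"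
  shows "g(b := v) \<in> fin_supp \<beta>"
  by (rule fin_suppI[of "insert b {x. g x \<noteq> 0}"]) (use fin_suppD[OF assms(1)] assms(2) in simp_all)

lemma fin_supp_less:
  assumes "g \<in> fin_supp \<beta>" "\<And>x. f x \<noteq> 0 \<Longrightarrow> g x \<noteq> 0"
  shows "f \<in> fin_supp \<beta>"
proof (rule fin_suppI)
  show "f x = 0" if "x \<notin> {x. g x \<noteq> 0}" for x using assms(2)[of x] that by auto
qed (rule fin_suppD[OF assms(1)])+

text \<open>
  The value at the argument \<open>low \<beta> N\<close>, the most significant of the free ones, selects one of \<open>\<omega>\<close> copies
  of the block for \<open>N\<close>.
\<close>

lemma omega_block_low_block:
  assumes "Well_order \<beta>"
  shows "infinite (Field \<beta>) \<or> N \<le> card (Field \<beta>) \<Longrightarrow> g \<in> fin_supp \<beta> \<Longrightarrow>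
    omega_block (slt (omega_power \<beta>)) N (low_block \<beta> N g)"
proof (induction N arbitrary: g)
  case 0
  then have "low_block \<beta> 0 g = {g}" unfolding low_block_def by auto
  then show ?case by simp
next
  case (Suc N)
  let ?b = "low \<beta> N"
  have N: "infinite (Field \<beta>) \<or> N < card (Field \<beta>)" using Suc.prems(1) by auto
  note b = low(1,2)[OF assms N]
  have g: "g(?b := k) \<in> fin_supp \<beta>" for k by (rule fin_supp_upd[OF Suc.prems(2) b(1)])
  have "omega_block (slt (omega_power \<beta>)) N (low_block \<beta> N (g(?b := k)))" for k
    by (rule Suc.IH[OF _ g]) (use N in auto)
  moreover have "before (slt (omega_power \<beta>)) (low_block \<beta> N (g(?b := k))) (low_block \<beta> N (g(?b := l)))"
    if "k < l" for k l
    unfolding before_def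
  proof (intro ballI)
    fix f f' assume f: "f \<in> low_block \<beta> N (g(?b := k))" "f' \<in> low_block \<beta> N (g(?b := l))"
    show "slt (omega_power \<beta>) f f'"
    proof (rule omega_power_I[OF _ _ b(1)])
      show "f ?b < f' ?b" using f b(2) that unfolding low_block_def by simp
      fix y assume y: "(?b, y) \<in> \<beta>" "y \<noteq> ?b"
      have "y \<notin> low \<beta> ` {..<N}"
      proof
        assume yl: "y \<in> low \<beta> ` {..<N}"
        have "?b \<in> low \<beta> ` {..<N}"
          by (rule low_down[OF assms _ yl b(1)]) (use N y in \<open>auto simp: slt_def\<close>)
        then show False using b(2) by blast
      qed
      then show "f y = f' y" using f y(2) unfolding low_block_def by simp
    qed (use f in \<open>auto simp: low_block_def\<close>)
  qed
  moreover have "low_block \<beta> (Suc N) g = (\<Union>k. low_block \<beta> N (g(?b := k)))"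
  proof (intro subset_antisym subsetI)
    fix f assume f: "f \<in> low_block \<beta> (Suc N) g"
    then have "f \<in> low_block \<beta> N (g(?b := f ?b))"
      unfolding low_block_def by (auto simp: lessThan_Suc)
    then show "f \<in> (\<Union>k. low_block \<beta> N (g(?b := k)))" by blast
  next
    fix f assume "f \<in> (\<Union>k. low_block \<beta> N (g(?b := k)))"
    then show "f \<in> low_block \<beta> (Suc N) g" unfolding low_block_def by (auto simp: lessThan_Suc)
  qed
  ultimately show ?case unfolding omega_block.simps
    by (intro exI[of _ "\<lambda>k. low_block \<beta> N (g(?b := k))"]) simp
qed

lemma omega_block_image:
  "omega_block lt n X \<Longrightarrow> (\<And>x y. x \<in> X \<Longrightarrow> y \<in> X \<Longrightarrow> lt x y \<Longrightarrow> lt' (h x) (h y)) \<Longrightarrow> omega_block lt' n (h ` X)"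
proof (induction n arbitrary: X)
  case 0 then show ?case by auto
next
  case (Suc n)
  then obtain A where A: "\<And>i::nat. omega_block lt n (A i)" "\<And>i j. i < j \<Longrightarrow> before lt (A i) (A j)" "X = (\<Union>i. A i)"
    by auto
  have "omega_block lt' n (h ` A i)" for i
    by (rule Suc.IH[OF A(1)]) (use Suc.prems(2) A(3) in blast)
  moreover have "before lt' (h ` A i) (h ` A j)" if "i < j" for i j
    using A(2)[OF that] Suc.prems(2) A(3) unfolding before_def by blast
  ultimately show ?case unfolding omega_block.simps
    by (intro exI[of _ "\<lambda>i. h ` A i"]) (simp add: A(3) image_UN)
qed

section \<open>Infinite exponents and cofinality\<close>

lemma infinite_exponent:
  assumes "natLeq \<le>o \<beta>" shows "infinite (Field \<beta>)"
proof -
  have "|UNIV::nat set| \<le>o |Field \<beta>|" using card_of_mono2[OF assms] unfolding Field_natLeq .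
  then show ?thesis by (rule card_of_ordLeq_infinite) simp
qed

lemma finite_exponent:
  assumes "\<beta> <o natLeq" shows "finite (Field \<beta>)"
proof (rule ccontr)
  assume "infinite (Field \<beta>)"
  then have "natLeq \<le>o |Field \<beta>|" using infinite_iff_natLeq_ordLeq[of "Field \<beta>"] by simp
  moreover have "Well_order \<beta>" using assms unfolding ordLess_def by blast
  then have "|Field \<beta>| \<le>o \<beta>" by (rule card_of_least)
  ultimately have "natLeq \<le>o \<beta>" by (rule ordLeq_transitive)
  then show False using not_ordLess_ordLeq[OF assms] by simp
qed

text \<open>
  A minimal cofinal set is infinite because there is no last element. So the two values
  distinguished by a presentation exhaust all possibilities.
\<close>

lemma cofinality_cases:
  fixes r :: "'b rel"
  assumes wo: "Well_order r" and ne: "Field r \<noteq> {}" and nomax: "\<forall>x\<in>Field r. \<exists>y\<in>Field r. slt r x y"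
  shows "cofinality r =o natLeq \<or> natLeq <o cofinality r"
    and "cofinality r =o natLeq \<Longrightarrow> \<exists>f::nat \<Rightarrow> 'b. range f \<subseteq> Field r \<and> (\<forall>x\<in>Field r. \<exists>n. slt r x (f n))"
    and "natLeq <o cofinality r \<Longrightarrow> range (f::nat \<Rightarrow> 'b) \<subseteq> Field r \<Longrightarrow> \<exists>x\<in>Field r. \<forall>n. \<not> slt r x (f n)"
proof -
  define good where "good A \<longleftrightarrow> A \<subseteq> Field r \<and> cofinal A r" for A
  have "good (Field r)" unfolding good_def cofinal_def using nomax unfolding slt_def by blast
  then have "card_of ` Collect good \<noteq> {}" by blast
  then obtain A where A: "good A" "\<And>B. good B \<Longrightarrow> |A| \<le>o |B|"
  proof -
    have "\<forall>r\<in>card_of ` Collect good. Well_order r"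
    proof
      fix r assume "r \<in> card_of ` Collect good"
      then obtain B where "r = |B|" by blast
      then show "Well_order r" by (simp only: card_of_Well_order)
    qed
    from exists_minim_Well_order[OF \<open>card_of ` Collect good \<noteq> {}\<close> this]
    obtain r where r: "r \<in> card_of ` Collect good" "\<forall>r'\<in>card_of ` Collect good. r \<le>o r'" ..
    from r(1) obtain A where A: "r = |A|" "good A" by blast
    show thesis by (rule that[OF A(2)]) (use r(2) A(1) in simp)
  qed
  define A0 where "A0 = (SOME A. A \<subseteq> Field r \<and> cofinal A r \<and>
     (\<forall>B. B \<subseteq> Field r \<and> cofinal B r \<longrightarrow> |A| \<le>o |B| ))"
  have A0: "good A0 \<and> (\<forall>B. good B \<longrightarrow> |A0| \<le>o |B| )"
  proof -
    have "A \<subseteq> Field r \<and> cofinal A r \<and> (\<forall>B. B \<subseteq> Field r \<and> cofinal B r \<longrightarrow> |A| \<le>o |B| )"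
      using A unfolding good_def by blast
    then have "A0 \<subseteq> Field r \<and> cofinal A0 r \<and> (\<forall>B. B \<subseteq> Field r \<and> cofinal B r \<longrightarrow> |A0| \<le>o |B| )"
      unfolding A0_def by (rule someI)
    then show ?thesis unfolding good_def by blast
  qed
  have cf: "cofinality r = |A0|" unfolding cofinality_def A0_def ..
  interpret strict_order "slt r" by (rule strict_order_slt[OF wo])
  have cofE: "\<exists>b\<in>B. slt r x b" if "good B" "x \<in> Field r" for B x
    using that unfolding good_def cofinal_def slt_def by blast
  have inf: "infinite B" if "good B" for B
  proof
    assume "finite B"
    obtain x where "x \<in> Field r" using ne by blast
    have bd: "\<exists>y\<in>Field r. \<forall>b\<in>F. \<not> slt r y b" if "finite F" "F \<subseteq> Field r" for F
      using that
    proof (induction rule: finite_induct)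
      case empty then show ?case using ne by blast
    next
      case (insert b F)
      then obtain y where y: "y \<in> Field r" "\<forall>b\<in>F. \<not> slt r y b" by blast
      show ?case
      proof (cases "slt r y b")
        case True
        then have "\<not> slt r b a" if "a \<in> insert b F" for a using that y(2) tr irr by blast
        moreover have "b \<in> Field r" using insert.prems by simp
        ultimately show ?thesis by blast
      qed (use y in blast)
    qed
    have "B \<subseteq> Field r" using that unfolding good_def by simp
    then obtain y where y: "y \<in> Field r" "\<forall>b\<in>B. \<not> slt r y b" using bd[OF \<open>finite B\<close>] by auto
    then show False using cofE[OF that y(1)] by auto
  qed
  have "natLeq \<le>o |A0|" using inf[of A0] A0 infinite_iff_natLeq_ordLeq[of A0] by simp
  then show "cofinality r =o natLeq \<or> natLeq <o cofinality r"
    unfolding cf ordLeq_iff_ordLess_or_ordIso by (auto intro: ordIso_symmetric)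
  show "\<exists>f::nat \<Rightarrow> 'b. range f \<subseteq> Field r \<and> (\<forall>x\<in>Field r. \<exists>n. slt r x (f n))" if "cofinality r =o natLeq"
  proof -
    have "|A0| =o |UNIV::nat set|"
      by (rule ordIso_transitive[OF that[unfolded cf] ordIso_symmetric[OF card_of_nat]])
    then have "|UNIV::nat set| =o |A0|" by (rule ordIso_symmetric)
    then obtain f :: "nat \<Rightarrow> 'b" where "bij_betw f UNIV A0"
      unfolding card_of_ordIso[symmetric] ..
    then have f: "range f = A0" by (rule bij_betw_imp_surj_on)
    show ?thesis
    proof (intro exI[of _ f] conjI ballI)
      show "range f \<subseteq> Field r" using f A0 unfolding good_def by simp
      fix x assume "x \<in> Field r"
      then obtain b where "b \<in> A0" "slt r x b" using cofE A0 by blast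
      then show "\<exists>n. slt r x (f n)" unfolding f[symmetric] by blast
    qed
  qed
  show "\<exists>x\<in>Field r. \<forall>n. \<not> slt r x (f n)" if "natLeq <o cofinality r" "range f \<subseteq> Field r" for f :: "nat \<Rightarrow> 'b"
  proof (rule ccontr)
    assume "\<not> (\<exists>x\<in>Field r. \<forall>n. \<not> slt r x (f n))"
    then have "good (range f)" using that(2) unfolding good_def cofinal_def slt_def by blast
    then have "|A0| \<le>o |range f|" using A0 by blast
    also have "|range f| \<le>o |UNIV::nat set|" by (rule card_of_image)
    finally have "|A0| \<le>o natLeq" by (rule ordLeq_ordIso_trans[OF _ card_of_nat])
    then show False using not_ordLess_ordLeq[OF that(1)] unfolding cf by simp
  qed
qed

lemma Field_cnf_ord: "Field (cnf_ord cs) = cnf_points cs"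
proof (intro subset_antisym subsetI)
  fix x assume x: "x \<in> cnf_points cs"
  obtain i j f where xe: "x = (i, j, f)" by (cases x)
  have "(f, f) \<in> omega_power (fst (cs ! i))" using x unfolding xe cnf_points_def omega_power_def by auto
  then have "(x, x) \<in> cnf_ord cs" using x unfolding xe cnf_ord_def by auto
  then show "x \<in> Field (cnf_ord cs)" by (rule FieldI1)
qed (auto simp: Field_def cnf_ord_def)

lemma slt_cnf: "slt (cnf_ord cs) (i, j, f) (i', j', f') \<longleftrightarrow>
   (i, j, f) \<in> cnf_points cs \<and> (i', j', f') \<in> cnf_points cs \<and>
   (i < i' \<or> i = i' \<and> (j < j' \<or> j = j' \<and> slt (omega_power (fst (cs ! i))) f f'))"
  unfolding slt_def cnf_ord_def by auto

lemma cnf_split: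
  assumes "is_cnf cs"
  shows "cs = infinite_terms cs @ finite_terms cs"
  using assms
proof (induction cs)
  case (Cons a cs)
  obtain \<beta> c where a: "a = (\<beta>, c)" by (cases a)
  have cs: "is_cnf cs" using Cons.prems unfolding is_cnf_def by simp
  have W: "Well_order \<beta>" using Cons.prems unfolding is_cnf_def a by simp
  show ?case
  proof (cases "natLeq \<le>o \<beta>")
    case True
    then have "\<not> \<beta> <o natLeq" using not_ordLess_ordLeq[of \<beta> natLeq] by auto
    then show ?thesis using Cons.IH[OF cs] True unfolding infinite_terms_def finite_terms_def a by simp
  next
    case False
    then have fin: "\<beta> <o natLeq" using not_ordLeq_iff_ordLess[OF W natLeq_Well_order] by simp
    have tl: "\<gamma> <o natLeq" if "(\<gamma>, d) \<in> set cs" for \<gamma> d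
    proof -
      have "\<gamma> <o \<beta>" using Cons.prems that unfolding is_cnf_def a by fastforce
      then show ?thesis by (rule ordLess_transitive[OF _ fin])
    qed
    have "\<not> natLeq \<le>o \<gamma>" if "(\<gamma>, d) \<in> set cs" for \<gamma> d
      by (rule not_ordLess_ordLeq[OF tl[OF that]])
    then have "infinite_terms cs = []" unfolding infinite_terms_def by (auto simp: filter_empty_conv)
    moreover have "finite_terms cs = cs" unfolding finite_terms_def using tl by (auto simp: filter_id_conv)
    ultimately show ?thesis using fin False unfolding infinite_terms_def finite_terms_def a by simp
  qed
qed (simp add: infinite_terms_def finite_terms_def)

section \<open>The types of a Cantor normal form\<close>

definition repeat_tadd :: "nat \<Rightarrow> nat set \<Rightarrow> nat \<Rightarrow> nat set \<Rightarrow> nat set" where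
  "repeat_tadd k B n A = ((\<lambda>A. set_tadd k A B) ^^ n) A"

text \<open>
  The types of the colorings of \<open>\<alpha>\<^sub>0\<close>, see \<open>qtypes_us\<close>.
\<close>

definition base_types :: "nat \<Rightarrow> nat \<Rightarrow> nat \<Rightarrow> 'a cnf \<Rightarrow> nat set" where
  "base_types C k N cs = (if Field (cnf_ord (infinite_terms cs)) = {} then {0}
     else if cofinality (cnf_ord (infinite_terms cs)) =o natLeq then power_types C k N
     else stable.U C k (power_types C k N))"

context
  fixes cs :: "'a cnf" and us vs :: "'a cnf"
  assumes cnf: "is_cnf cs" and wo: "Well_order (cnf_ord cs)"
    and us: "us = infinite_terms cs" and vs: "vs = finite_terms cs"
begin

lemma cs_eq: "cs = us @ vs"
  using cnf_split[OF cnf] us vs by simp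

abbreviation (input) plt where "plt \<equiv> slt (cnf_ord cs)"

interpretation strict_order plt by (rule strict_order_slt[OF wo])

lemma points_us: "cnf_points us = {x \<in> cnf_points cs. fst x < length us}"
  unfolding cnf_points_def cs_eq by (auto simp: nth_append)

lemma slt_us: "slt (cnf_ord us) x y \<longleftrightarrow> x \<in> cnf_points us \<and> y \<in> cnf_points us \<and> plt x y"
proof -
  obtain i j f i' j' f' where xy: "x = (i, j, f)" "y = (i', j', f')" by (cases x, cases y)
  have "cs ! i = us ! i" if "i < length us" using that by (simp add: cs_eq nth_append)
  then show ?thesis unfolding xy slt_cnf points_us by auto
qed

lemma exponent_us: "i < length us \<Longrightarrow> Well_order (fst (cs ! i)) \<and> infinite (Field (fst (cs ! i)))"
proof -
  assume i: "i < length us"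
  then have "cs ! i = us ! i" by (simp add: cs_eq nth_append)
  moreover have "us ! i \<in> set us" using i by simp
  then have "natLeq \<le>o fst (us ! i)" "us ! i \<in> set cs" unfolding us infinite_terms_def by auto
  ultimately show ?thesis using cnf infinite_exponent unfolding is_cnf_def by fastforce
qed

lemma exponent_vs:
  assumes "i < length vs"
  shows "Well_order (fst (vs ! i))" "finite (Field (fst (vs ! i)))"
proof -
  have "vs ! i \<in> set vs" using assms by simp
  then have "fst (vs ! i) <o natLeq" "vs ! i \<in> set cs" unfolding vs finite_terms_def by auto
  then show "Well_order (fst (vs ! i))" "finite (Field (fst (vs ! i)))"
    using finite_exponent unfolding ordLess_def by blast+
qed

text \<open>
  The least elements of the blocks of type \<open>\<omega>\<^sup>N\<close> into which \<open>\<alpha>\<^sub>0\<close> decomposes: the lowest \<open>N\<close> values of the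
  third component vanish.
\<close>

definition reps :: "nat \<Rightarrow> (nat \<times> nat \<times> ('a \<Rightarrow> nat)) set" where
  "reps N = {(i, j, g). (i, j, g) \<in> cnf_points us \<and> (\<forall>x\<in>low (fst (cs ! i)) ` {..<N}. g x = 0)}"

definition blockof :: "nat \<Rightarrow> nat \<times> nat \<times> ('a \<Rightarrow> nat) \<Rightarrow> (nat \<times> nat \<times> ('a \<Rightarrow> nat)) set" where
  "blockof N p = (\<lambda>f. (fst p, fst (snd p), f)) ` low_block (fst (cs ! fst p)) N (snd (snd p))"

lemma pointsI: "(i, j, g) \<in> cnf_points cs \<Longrightarrow> f \<in> fin_supp (fst (cs ! i)) \<Longrightarrow> (i, j, f) \<in> cnf_points cs"
  unfolding cnf_points_def by auto

lemma pointsD: "(i, j, g) \<in> cnf_points cs \<Longrightarrow> g \<in> fin_supp (fst (cs ! i))"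
  unfolding cnf_points_def by auto

lemma plt_same: "(i, j, f) \<in> cnf_points cs \<Longrightarrow> (i, j, g) \<in> cnf_points cs \<Longrightarrow>
   plt (i, j, f) (i, j, g) \<longleftrightarrow> slt (omega_power (fst (cs ! i))) f g"
  unfolding slt_cnf by auto

lemma reps_points: "p \<in> reps N \<Longrightarrow> p \<in> cnf_points us" "p \<in> reps N \<Longrightarrow> p \<in> cnf_points cs"
  unfolding reps_def points_us by auto

lemma blockof_points: "p \<in> cnf_points us \<Longrightarrow> blockof N p \<subseteq> cnf_points us"
  unfolding blockof_def points_us by (cases p) (auto simp: low_block_def cnf_points_def)

lemma blocks_reps: "blocks plt (reps N) (blockof N) N"
proof
  fix p assume p: "p \<in> reps N"
  obtain i j g where pe: "p = (i, j, g)" by (cases p)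
  let ?\<beta> = "fst (cs ! i)"
  have i: "i < length us" using reps_points(1)[OF p] unfolding pe cnf_points_def by simp
  have W: "Well_order ?\<beta>" and inf: "infinite (Field ?\<beta>)" using exponent_us[OF i] by auto
  have pc: "(i, j, g) \<in> cnf_points cs" using reps_points(2)[OF p] unfolding pe .
  note g = pointsD[OF pc]
  have g0: "g x = 0" if "x \<in> low ?\<beta> ` {..<N}" for x using p that unfolding pe reps_def by auto
  show "omega_block plt N (blockof N p)" unfolding blockof_def
  proof (rule omega_block_image)
    show "omega_block (slt (omega_power (fst (cs ! fst p)))) N (low_block (fst (cs ! fst p)) N (snd (snd p)))"
      unfolding pe fst_conv snd_conv by (rule omega_block_low_block[OF W _ g]) (use inf in simp)
    fix f f' assume "f \<in> low_block (fst (cs ! fst p)) N (snd (snd p))" "f' \<in> low_block (fst (cs ! fst p)) N (snd (snd p))"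
      and l: "slt (omega_power (fst (cs ! fst p))) f f'"
    then have "(i, j, f) \<in> cnf_points cs" "(i, j, f') \<in> cnf_points cs"
      by (auto intro!: pointsI[OF pc] simp: pe low_block_def)
    then show "plt (fst p, fst (snd p), f) (fst p, fst (snd p), f')"
      using l plt_same unfolding pe by simp
  qed
  show mem: "p \<in> blockof N p" unfolding blockof_def pe using g by (auto simp: low_block_def)
  show "x = p \<or> plt p x" if x: "x \<in> blockof N p" for x
  proof -
    obtain f where f: "x = (i, j, f)" "f \<in> low_block ?\<beta> N g" using x unfolding blockof_def pe by auto
    have xp: "(i, j, f) \<in> cnf_points cs" using pointsI[OF pc] f(2) unfolding low_block_def by auto
    have "\<not> plt x p"
    proof
      assume "plt x p"
      then have "slt (omega_power ?\<beta>) f g" using plt_same[OF xp pc] unfolding f(1) pe by simp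
      then obtain y where y: "f y < g y" using omega_power_E by blast
      then have "y \<in> low ?\<beta> ` {..<N}" using f(2) unfolding low_block_def by force
      then show False using g0 y by simp
    qed
    then show ?thesis using slt_total[OF wo, of x p] xp pc unfolding Field_cnf_ord f(1) pe by auto
  qed
  fix q assume q: "q \<in> reps N"
  show "plt p q \<or> p = q \<or> plt q p"
    using slt_total[OF wo, of p q] reps_points(2)[OF p] reps_points(2)[OF q] unfolding Field_cnf_ord by simp
  obtain i' j' g' where qe: "q = (i', j', g')" by (cases q)
  have qc: "(i', j', g') \<in> cnf_points cs" using reps_points(2)[OF q] unfolding qe .
  show "before plt (blockof N p) (blockof N q)" if l: "plt p q"
    unfolding before_def
  proof (intro ballI)
    fix x y assume "x \<in> blockof N p" "y \<in> blockof N q"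
    then obtain f f' where f: "x = (i, j, f)" "f \<in> low_block ?\<beta> N g"
      and f': "y = (i', j', f')" "f' \<in> low_block (fst (cs ! i')) N g'" unfolding blockof_def pe qe by auto
    have xp: "(i, j, f) \<in> cnf_points cs" using pointsI[OF pc] f(2) unfolding low_block_def by auto
    have yp: "(i', j', f') \<in> cnf_points cs" using pointsI[OF qc] f'(2) unfolding low_block_def by auto
    show "plt x y"
    proof (cases "i = i' \<and> j = j'")
      case False
      then show ?thesis using l xp yp unfolding pe qe f(1) f'(1) slt_cnf by auto
    next
      case True
      have g0': "g' x = 0" if "x \<in> low ?\<beta> ` {..<N}" for x
        using q that True unfolding qe reps_def by auto
      have "slt (omega_power ?\<beta>) g g'" using l pc qc True plt_same unfolding pe qe by auto
      then obtain z where z: "z \<in> Field ?\<beta>" "g z < g' z" "\<And>y. (z, y) \<in> ?\<beta> \<Longrightarrow> y \<noteq> z \<Longrightarrow> g y = g' y"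
        using omega_power_E by blast
      have zl: "z \<notin> low ?\<beta> ` {..<N}" using z(2) g0' by fastforce
      have "slt (omega_power ?\<beta>) f f'"
      proof (rule omega_power_I[OF _ _ z(1)])
        show "f z < f' z" using f(2) f'(2) zl z(2) True unfolding low_block_def by simp
        fix y assume y: "(z, y) \<in> ?\<beta>" "y \<noteq> z"
        have "y \<notin> low ?\<beta> ` {..<N}"
        proof
          assume yl: "y \<in> low ?\<beta> ` {..<N}"
          have "z \<in> low ?\<beta> ` {..<N}"
            by (rule low_down[OF W _ yl z(1)]) (use inf y in \<open>auto simp: slt_def\<close>)
          then show False using zl by simp
        qed
        then show "f y = f' y" using f(2) f'(2) z(3)[OF y] True unfolding low_block_def by simp
      qed (use f(2) f'(2) True in \<open>auto simp: low_block_def\<close>)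
      then show ?thesis using plt_same[OF xp] yp True unfolding f(1) f'(1) by simp
    qed
  qed
next
  fix J :: "(nat \<times> nat \<times> ('a \<Rightarrow> nat)) set" assume "J \<noteq> {}"
  then show "\<exists>m\<in>J. \<forall>j\<in>J. \<not> plt j m" by (rule slt_wf[OF wo])
qed

lemma union_of_reps: "blocks.union_of (blockof N) (reps N) = cnf_points us"
proof -
  interpret b: blocks plt "reps N" "blockof N" N by (rule blocks_reps)
  show ?thesis unfolding b.union_of_def
  proof (intro subset_antisym UN_least subsetI)
    show "x \<in> cnf_points us" if "p \<in> reps N" "x \<in> blockof N p" for p x
      using blockof_points[OF reps_points(1)[OF that(1)]] that(2) by blast
    fix x assume x: "x \<in> cnf_points us"
    obtain i j f where xe: "x = (i, j, f)" by (cases x)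
    define g where "g y = (if y \<in> low (fst (cs ! i)) ` {..<N} then 0 else f y)" for y
    have xc: "(i, j, f) \<in> cnf_points cs" using x unfolding xe points_us by simp
    have f: "f \<in> fin_supp (fst (cs ! i))" by (rule pointsD[OF xc])
    have "g \<in> fin_supp (fst (cs ! i))" by (rule fin_supp_less[OF f]) (simp add: g_def split: if_splits)
    then have "(i, j, g) \<in> cnf_points us" using pointsI[OF xc] x unfolding xe points_us by simp
    then have "(i, j, g) \<in> reps N" unfolding reps_def g_def by auto
    moreover have "x \<in> blockof N (i, j, g)" unfolding blockof_def xe using f by (auto simp: low_block_def g_def)
    ultimately show "x \<in> (\<Union>p\<in>reps N. blockof N p)" by blast
  qed
qed

text \<open>
  The exponent is infinite, so there is an argument beyond the first \<open>N\<close> at which \<open>g\<close> can be increased.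
\<close>

lemma reps_nomax:
  assumes "p \<in> reps N" shows "\<exists>q\<in>reps N. plt p q"
proof -
  obtain i j g where pe: "p = (i, j, g)" by (cases p)
  let ?\<beta> = "fst (cs ! i)"
  have i: "i < length us" using reps_points(1)[OF assms] unfolding pe cnf_points_def by simp
  have W: "Well_order ?\<beta>" and inf: "infinite (Field ?\<beta>)" using exponent_us[OF i] by auto
  have pc: "(i, j, g) \<in> cnf_points cs" using reps_points(2)[OF assms] unfolding pe .
  note b = low(1,2)[OF W, of N]
  let ?b = "low ?\<beta> N"
  let ?h = "g(?b := Suc (g ?b))"
  have h: "?h \<in> fin_supp ?\<beta>" by (rule fin_supp_upd[OF pointsD[OF pc]]) (use b inf in simp)
  have hc: "(i, j, ?h) \<in> cnf_points cs" by (rule pointsI[OF pc h])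
  have "?h x = 0" if x: "x \<in> low ?\<beta> ` {..<N}" for x
  proof -
    have "x \<noteq> ?b" using x b(2) inf by blast
    moreover have "g x = 0" using assms x unfolding pe reps_def by auto
    ultimately show ?thesis by simp
  qed
  then have "(i, j, ?h) \<in> reps N"
    using hc i unfolding reps_def points_us by auto
  moreover have "slt (omega_power ?\<beta>) g ?h"
    by (rule omega_power_I[OF pointsD[OF pc] h]) (use b inf in auto)
  then have "plt p (i, j, ?h)" unfolding pe using plt_same[OF pc hc] by simp
  ultimately show ?thesis by blast
qed

lemma wo_us: "Well_order (cnf_ord us)"
proof -
  have sub: "cnf_ord us = {(x, y) \<in> cnf_ord cs. x \<in> cnf_points us \<and> y \<in> cnf_points us}"
  proof -
    have "(x, y) \<in> cnf_ord us \<longleftrightarrow> (x, y) \<in> cnf_ord cs \<and> x \<in> cnf_points us \<and> y \<in> cnf_points us" for x y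
    proof (cases "x = y")
      case True
      have "(x, x) \<in> cnf_ord us \<longleftrightarrow> x \<in> cnf_points us" "x \<in> cnf_points us \<Longrightarrow> (x, x) \<in> cnf_ord cs"
        unfolding points_us by (auto simp: cnf_ord_def cnf_points_def omega_power_def cs_eq nth_append)
      then show ?thesis using True by blast
    next
      case False then show ?thesis using slt_us[of x y] unfolding slt_def by blast
    qed
    then show ?thesis by auto
  qed
  have "cnf_ord us = Restr (cnf_ord cs) (cnf_points us)" unfolding sub by auto
  then show ?thesis using Well_order_Restr[OF wo] by simp
qed

context
  fixes C k N :: nat
  assumes st: "stable C k (power_types C k N)" and k: "k > 0"
begin

lemma Cne: "els C \<noteq> {}"
  using st by (rule stable.C)

lemma us_cofinality:
  assumes "Field (cnf_ord us) \<noteq> {}"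
  shows "cofinality (cnf_ord us) =o natLeq \<or> natLeq <o cofinality (cnf_ord us)"
    and "qtypes plt C k (cnf_points us) =
      (if cofinality (cnf_ord us) =o natLeq then power_types C k N else stable.U C k (power_types C k N))"
proof -
  interpret b: blocks plt "reps N" "blockof N" N by (rule blocks_reps)
  note eq = union_of_reps[of N, unfolded b.union_of_def]
  have ne: "reps N \<noteq> {}" using assms eq unfolding Field_cnf_ord by auto
  have inX: "\<exists>p\<in>reps N. x \<in> blockof N p" if "x \<in> cnf_points us" for x using that eq by blast
  have nomax: "\<forall>x\<in>Field (cnf_ord us). \<exists>y\<in>Field (cnf_ord us). slt (cnf_ord us) x y"
  proof
    fix x assume x: "x \<in> Field (cnf_ord us)"
    obtain p where p: "p \<in> reps N" "x \<in> blockof N p" using inX x unfolding Field_cnf_ord by blast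
    obtain q where q: "q \<in> reps N" "plt p q" using reps_nomax[OF p(1)] by blast
    have "plt x q" using b.lt_iff[OF p(1) q(1) p(2)] q(2) by simp
    then show "\<exists>y\<in>Field (cnf_ord us). slt (cnf_ord us) x y"
      using x reps_points(1)[OF q(1)] unfolding Field_cnf_ord slt_us by blast
  qed
  note cof = cofinality_cases[OF wo_us assms nomax]
  show 1: "cofinality (cnf_ord us) =o natLeq \<or> natLeq <o cofinality (cnf_ord us)" by (rule cof(1))
  note main = b.qtypes_blocks[OF st ne k, unfolded union_of_reps]
  show "qtypes plt C k (cnf_points us) =
      (if cofinality (cnf_ord us) =o natLeq then power_types C k N else stable.U C k (power_types C k N))"
  proof (cases "cofinality (cnf_ord us) =o natLeq")
    case True
    obtain f :: "nat \<Rightarrow> nat \<times> nat \<times> ('a \<Rightarrow> nat)" where f: "range f \<subseteq> Field (cnf_ord us)"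
       "\<forall>x\<in>Field (cnf_ord us). \<exists>n. slt (cnf_ord us) x (f n)" using cof(2)[OF True] by blast
    have "\<exists>q\<in>reps N. \<exists>p\<in>reps N. f n \<in> blockof N p \<and> plt p q" for n
    proof -
      obtain p where p: "p \<in> reps N" "f n \<in> blockof N p" using inX f(1) unfolding Field_cnf_ord by blast
      then show ?thesis using reps_nomax[OF p(1)] by blast
    qed
    then obtain q p where qp: "\<And>n. q n \<in> reps N \<and> p n \<in> reps N \<and> f n \<in> blockof N (p n) \<and> plt (p n) (q n)"
      by metis
    have "\<exists>n. plt j (q n)" if j: "j \<in> reps N" for j
    proof -
      obtain n where "slt (cnf_ord us) j (f n)" using f(2) reps_points(1)[OF j] unfolding Field_cnf_ord by blast
      then have "plt j (f n)" unfolding slt_us by blast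
      moreover have "plt (f n) (q n)" using b.lt_iff[of "p n" "q n" "f n"] qp by blast
      ultimately show ?thesis using tr by blast
    qed
    then have "\<exists>f::nat \<Rightarrow> _. (\<forall>n. f n \<in> reps N) \<and> (\<forall>j\<in>reps N. \<exists>n. plt j (f n))"
      using qp by blast
    from main(1)[OF reps_nomax this] show ?thesis using True by simp
  next
    case False
    then have unc: "natLeq <o cofinality (cnf_ord us)" using 1 by blast
    have no: "\<exists>j\<in>reps N. \<forall>n. \<not> plt j (f n)" if f: "\<And>n. f n \<in> reps N" for f :: "nat \<Rightarrow> _"
    proof -
      have "range f \<subseteq> Field (cnf_ord us)" using reps_points(1)[OF f] unfolding Field_cnf_ord by blast
      from cof(3)[OF unc this] obtain x where x: "x \<in> cnf_points us" "\<forall>n. \<not> slt (cnf_ord us) x (f n)"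
        unfolding Field_cnf_ord by blast
      obtain p where p: "p \<in> reps N" "x \<in> blockof N p" using inX[OF x(1)] by blast
      have "\<not> plt p (f n)" for n
        using x b.lt_iff[OF p(1) f p(2), of n] reps_points(1)[OF f, of n] unfolding slt_us by blast
      then show ?thesis using p(1) by blast
    qed
    have "qtypes plt C k (cnf_points us) = stable.U C k (power_types C k N)"
      by (rule main(2)[OF reps_nomax no])
    then show ?thesis using False by simp
  qed
qed

lemma qtypes_us: "qtypes plt C k (cnf_points us) = base_types C k N cs"
proof (cases "Field (cnf_ord us) = {}")
  case True
  obtain a where a: "a \<in> els C" using Cne by blast
  have "0 \<in> qtypes plt C k {}"
    by (rule qtypes_eqI[of "\<lambda>_. a"]) (use a in auto)
  then have "qtypes plt C k {} = {0}" unfolding qtypes_def by auto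
  then show ?thesis using True unfolding base_types_def us[symmetric] Field_cnf_ord by simp
next
  case False
  then show ?thesis using us_cofinality(2) unfolding base_types_def us[symmetric] by simp
qed

text \<open>
  The terms of \<open>\<theta>\<close> are added one after the other, and the copies within a term likewise.
\<close>

lemma qtypes_prefix:
  assumes "m \<le> length vs"
  shows "qtypes plt C k {x \<in> cnf_points cs. fst x < length us + m} =
    foldl (\<lambda>A (n, c). repeat_tadd k (power_types C k n) c A) (base_types C k N cs) (take m (theta_cnf cs))"
  using assms
proof (induction m)
  case 0 show ?case using qtypes_us unfolding points_us by simp
next
  case (Suc m)
  let ?i = "length us + m"
  have m: "m < length vs" using Suc.prems by simp
  have csi: "cs ! ?i = vs ! m" using m by (simp add: cs_eq nth_append)
  obtain \<beta> c where \<beta>c: "vs ! m = (\<beta>, c)" by (cases "vs ! m")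
  have W: "Well_order \<beta>" and fin: "finite (Field \<beta>)" using exponent_vs[OF m] \<beta>c by auto
  let ?n = "card (Field \<beta>)"
  let ?P = "\<lambda>c'. {x \<in> cnf_points cs. fst x < ?i \<or> fst x = ?i \<and> fst (snd x) < c'}"
  have ilen: "?i < length cs" using m by (simp add: cs_eq)
  have copy: "qtypes plt C k ((\<lambda>f. (?i, j, f)) ` fin_supp \<beta>) = power_types C k ?n" if "j < c" for j
  proof (rule qtypes_omega_block[OF Cne])
    have point: "(?i, j, f) \<in> cnf_points cs" if "f \<in> fin_supp \<beta>" for f
      using that \<open>j < c\<close> ilen csi \<beta>c unfolding cnf_points_def by simp
    show "omega_block plt ?n ((\<lambda>f. (?i, j, f)) ` fin_supp \<beta>)"
    proof (rule omega_block_image)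
      have z: "(\<lambda>_. 0) \<in> fin_supp \<beta>" by (rule fin_suppI[of "{}"]) auto
      have "low_block \<beta> ?n (\<lambda>_. 0) = fin_supp \<beta>"
        unfolding low_block_def low_all[OF W fin] using fin_suppD(2) by fastforce
      then show "omega_block (slt (omega_power \<beta>)) ?n (fin_supp \<beta>)"
        using omega_block_low_block[OF W _ z, of ?n] by simp
      fix f g assume "f \<in> fin_supp \<beta>" "g \<in> fin_supp \<beta>" "slt (omega_power \<beta>) f g"
      then show "plt (?i, j, f) (?i, j, g)" using plt_same[OF point point] csi \<beta>c by simp
    qed
  qed
  have inner: "qtypes plt C k (?P c') = repeat_tadd k (power_types C k ?n) c' (qtypes plt C k (?P 0))" if "c' \<le> c" for c'
    using that
  proof (induction c')
    case 0 show ?case unfolding repeat_tadd_def by simp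
  next
    case (Suc c')
    have eq: "?P (Suc c') = ?P c' \<union> (\<lambda>f. (?i, c', f)) ` fin_supp \<beta>"
    proof -
      have "x \<in> (\<lambda>f. (?i, c', f)) ` fin_supp \<beta> \<longleftrightarrow> x \<in> cnf_points cs \<and> fst x = ?i \<and> fst (snd x) = c'" for x
        using Suc.prems ilen csi \<beta>c unfolding cnf_points_def by (cases x) auto
      then show ?thesis by (auto simp: less_Suc_eq)
    qed
    have b: "before plt (?P c') ((\<lambda>f. (?i, c', f)) ` fin_supp \<beta>)"
      unfolding before_def
    proof (intro ballI)
      fix x y assume x: "x \<in> ?P c'" and y: "y \<in> (\<lambda>f. (?i, c', f)) ` fin_supp \<beta>"
      then obtain f where f: "y = (?i, c', f)" "f \<in> fin_supp \<beta>" by blast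
      have "y \<in> cnf_points cs" using f Suc.prems ilen csi \<beta>c unfolding cnf_points_def by simp
      then show "plt x y" using x unfolding f(1) by (cases x) (auto simp: slt_cnf)
    qed
    have "qtypes plt C k (?P (Suc c')) = set_tadd k (qtypes plt C k (?P c')) (power_types C k ?n)"
      unfolding eq qtypes_Un[OF Cne b] using copy Suc.prems by simp
    then show ?case using Suc by (simp add: repeat_tadd_def)
  qed
  have "{x \<in> cnf_points cs. fst x < length us + Suc m} = ?P c"
    unfolding cnf_points_def using csi \<beta>c by (auto simp: less_Suc_eq)
  moreover have "?P 0 = {x \<in> cnf_points cs. fst x < length us + m}" by auto
  moreover have th: "m < length (theta_cnf cs)" "theta_cnf cs ! m = (?n, c)"
    using m \<beta>c unfolding theta_cnf_def vs by simp_all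
  ultimately show ?case
    using inner[of c] Suc.IH m by (simp add: take_Suc_conv_app_nth[OF th(1)] th(2))
qed

theorem qtypes_cnf:
  "qtypes plt C k (cnf_points cs) =
    foldl (\<lambda>A (n, c). repeat_tadd k (power_types C k n) c A) (base_types C k N cs) (theta_cnf cs)"
proof -
  have "{x \<in> cnf_points cs. fst x < length us + length vs} = cnf_points cs"
    unfolding cnf_points_def cs_eq by auto
  moreover have "take (length vs) (theta_cnf cs) = theta_cnf cs" unfolding theta_cnf_def vs by simp
  ultimately show ?thesis using qtypes_prefix[of "length vs"] by simp
qed

end

end

section \<open>Recursive functions\<close>

text \<open>
  Functions of one argument; several arguments are packed by \<open>prod_encode\<close>. In the closure rules below,
  the additional argument of a function under a binder is the first component of a pair
  and the parameters are the second component.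
\<close>

definition computable :: "(nat \<Rightarrow> nat) \<Rightarrow> bool" where "computable f \<longleftrightarrow> recursive 1 (\<lambda>xs. f (xs ! 0))"
definition decidable :: "(nat \<Rightarrow> bool) \<Rightarrow> bool" where "decidable P \<longleftrightarrow> computable (\<lambda>x. if P x then 1 else 0)"

lemma recursive_cong: "recursive n f \<Longrightarrow> (\<And>xs. length xs = n \<Longrightarrow> f xs = g xs) \<Longrightarrow> recursive n g"
  by (rule recursive.ext) auto

lemma recursive_comp1: "recursive 1 g \<Longrightarrow> recursive n h \<Longrightarrow> recursive n (\<lambda>xs. g [h xs])"
  using recursive.comp[of "[h]" g n] by simp

lemma recursive_comp2:
  "recursive 2 g \<Longrightarrow> recursive n h1 \<Longrightarrow> recursive n h2 \<Longrightarrow> recursive n (\<lambda>xs. g [h1 xs, h2 xs])"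
  using recursive.comp[of "[h1, h2]" g n] by (simp add: numeral_2_eq_2)

lemma recursive_comp3:
  "recursive 3 g \<Longrightarrow> recursive n h1 \<Longrightarrow> recursive n h2 \<Longrightarrow> recursive n h3 \<Longrightarrow>
     recursive n (\<lambda>xs. g [h1 xs, h2 xs, h3 xs])"
  using recursive.comp[of "[h1, h2, h3]" g n] by (simp add: numeral_3_eq_3)

lemma recursive_computable: "computable g \<Longrightarrow> recursive n h \<Longrightarrow> recursive n (\<lambda>xs. g (h xs))"
  unfolding computable_def using recursive_comp1[of "\<lambda>xs. g (xs ! 0)" n h] by simp

lemma recursive_Suc: "recursive n h \<Longrightarrow> recursive n (\<lambda>xs. Suc (h xs))"
  using recursive_comp1[OF recursive.succ, of n h] by simp

lemma recursive_const: "recursive n (\<lambda>xs. c)"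
proof (induction c)
  case 0 show ?case by (rule recursive.zero)
qed (rule recursive_Suc)

lemma recursive2: "recursive 2 (\<lambda>xs. xs ! 0)" "recursive 2 (\<lambda>xs. xs ! 1)"
  by (rule recursive.proj; simp)+

lemma recursive3: "recursive 3 (\<lambda>xs. xs ! 0)" "recursive 3 (\<lambda>xs. xs ! 1)" "recursive 3 (\<lambda>xs. xs ! 2)"
  by (rule recursive.proj; simp)+

lemma recursive_rec2:
  assumes "recursive 1 g" "recursive 3 h"
    and f0: "\<And>y. f 0 y = g [y]" and fS: "\<And>x y. f (Suc x) y = h [x, f x y, y]"
    and ab: "recursive n a" "recursive n b"
  shows "recursive n (\<lambda>xs. f (a xs) (b xs))"
proof -
  let ?F = "\<lambda>xs. rec_nat (g (tl xs)) (\<lambda>y r. h (y # r # tl xs)) (hd xs)"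
  have "recursive 2 ?F"
    using recursive.prim_rec[of 1 g h] assms(1,2) by (simp add: numeral_2_eq_2 numeral_3_eq_3)
  from recursive_comp2[OF this ab] have "recursive n (\<lambda>xs. ?F [a xs, b xs])" .
  moreover have "rec_nat (g [y]) (\<lambda>x r. h [x, r, y]) x = f x y" for x y
    by (induction x) (simp_all add: f0 fS)
  ultimately show ?thesis by simp
qed

subsection \<open>Arithmetic\<close>

lemma recursive_plus:
  assumes "recursive n a" "recursive n b" shows "recursive n (\<lambda>xs. a xs + b xs)"
proof (rule recursive_rec2[where f="(+)" and g="\<lambda>xs. xs ! 0" and h="\<lambda>xs. Suc (xs ! 1)", OF _ _ _ _ assms])
  show "recursive 1 (\<lambda>xs. xs ! 0)" by (rule recursive.proj) simp
  show "recursive 3 (\<lambda>xs. Suc (xs ! 1))" by (rule recursive_Suc[OF recursive3(2)])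
qed simp_all

lemma recursive_times:
  assumes "recursive n a" "recursive n b" shows "recursive n (\<lambda>xs. a xs * b xs)"
proof (rule recursive_rec2[where f="(*)" and g="\<lambda>xs. 0" and h="\<lambda>xs. xs ! 1 + xs ! 2", OF _ _ _ _ assms])
  show "recursive 1 (\<lambda>xs. 0)" by (rule recursive_const)
  show "recursive 3 (\<lambda>xs. xs ! 1 + xs ! 2)" by (rule recursive_plus[OF recursive3(2,3)])
qed simp_all

lemma recursive_pred:
  assumes "recursive n a" shows "recursive n (\<lambda>xs. a xs - 1)"
proof (rule recursive_rec2[where f="\<lambda>x y. x - 1" and g="\<lambda>xs. 0" and h="\<lambda>xs. xs ! 0", OF _ _ _ _ assms assms])
  show "recursive 1 (\<lambda>xs. 0)" by (rule recursive_const)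
  show "recursive 3 (\<lambda>xs. xs ! 0)" by (rule recursive3(1))
qed simp_all

lemma recursive_minus:
  assumes "recursive n a" "recursive n b" shows "recursive n (\<lambda>xs. a xs - b xs)"
proof (rule recursive_rec2[where f="\<lambda>x y. y - x" and g="\<lambda>xs. xs ! 0" and h="\<lambda>xs. xs ! 1 - 1", OF _ _ _ _ assms(2,1)])
  show "recursive 1 (\<lambda>xs. xs ! 0)" by (rule recursive.proj) simp
  show "recursive 3 (\<lambda>xs. xs ! 1 - 1)" by (rule recursive_pred[OF recursive3(2)])
qed simp_all

lemma recursive_triangle:
  assumes "recursive n a" shows "recursive n (\<lambda>xs. triangle (a xs))"
proof (rule recursive_rec2[where f="\<lambda>x y. triangle x" and g="\<lambda>xs. 0" and h="\<lambda>xs. xs ! 1 + Suc (xs ! 0)", OF _ _ _ _ assms assms])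
  show "recursive 1 (\<lambda>xs. 0)" by (rule recursive_const)
  show "recursive 3 (\<lambda>xs. xs ! 1 + Suc (xs ! 0))"
    by (rule recursive_plus[OF recursive3(2) recursive_Suc[OF recursive3(1)]])
qed simp_all

lemma recursive_pair:
  assumes "recursive n a" "recursive n b" shows "recursive n (\<lambda>xs. prod_encode (a xs, b xs))"
  using recursive_plus[OF recursive_triangle[OF recursive_plus[OF assms]] assms(1)]
  by (simp add: prod_encode_def)

lemma recursive_if:
  assumes "recursive n p" "recursive n a" "recursive n b"
  shows "recursive n (\<lambda>xs. if p xs \<noteq> 0 then a xs else b xs)"
proof -
  have "recursive n (\<lambda>xs. (1 - (1 - p xs)) * a xs + (1 - p xs) * b xs)"
    by (intro recursive_plus recursive_times recursive_minus recursive_const assms)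
  then show ?thesis by (rule recursive_cong) auto
qed

lemma recursive_eq:
  assumes "recursive n a" "recursive n b"
  shows "recursive n (\<lambda>xs. if a xs = b xs then 1 else 0)"
proof -
  have "recursive n (\<lambda>xs. 1 - ((a xs - b xs) + (b xs - a xs)))"
    by (intro recursive_plus recursive_minus recursive_const assms)
  then show ?thesis by (rule recursive_cong) auto
qed

lemma computable_Suc: "computable f \<Longrightarrow> computable (\<lambda>x. Suc (f x))"
  unfolding computable_def by (rule recursive_Suc)

lemma computable_id: "computable (\<lambda>x. x)"
  unfolding computable_def by (rule recursive.proj) simp

lemma computable_const: "computable (\<lambda>x. c)"
  unfolding computable_def by (rule recursive_const)

lemma computable_comp: "computable f \<Longrightarrow> computable g \<Longrightarrow> computable (\<lambda>x. f (g x))"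
  unfolding computable_def[of g] computable_def[of "\<lambda>x. f (g x)"] by (rule recursive_computable)

lemma computable_plus: "computable a \<Longrightarrow> computable b \<Longrightarrow> computable (\<lambda>x. a x + b x)"
  unfolding computable_def by (rule recursive_plus)

lemma computable_times: "computable a \<Longrightarrow> computable b \<Longrightarrow> computable (\<lambda>x. a x * b x)"
  unfolding computable_def by (rule recursive_times)

lemma computable_minus: "computable a \<Longrightarrow> computable b \<Longrightarrow> computable (\<lambda>x. a x - b x)"
  unfolding computable_def by (rule recursive_minus)

lemma computable_pair: "computable a \<Longrightarrow> computable b \<Longrightarrow> computable (\<lambda>x. prod_encode (a x, b x))"
  unfolding computable_def by (rule recursive_pair)

lemma computable_if:
  assumes "decidable P" "computable a" "computable b"
  shows "computable (\<lambda>x. if P x then a x else b x)"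
proof -
  have "recursive 1 (\<lambda>xs. if (if P (xs ! 0) then 1 else 0) \<noteq> (0::nat) then a (xs ! 0) else b (xs ! 0))"
    by (rule recursive_if) (rule assms[unfolded decidable_def computable_def])+
  then show ?thesis unfolding computable_def by (rule recursive_cong) simp
qed

lemma decidable_cong: "decidable P \<Longrightarrow> (\<And>x. P x \<longleftrightarrow> Q x) \<Longrightarrow> decidable Q"
  unfolding decidable_def by simp

lemma decidable_comp: "decidable P \<Longrightarrow> computable f \<Longrightarrow> decidable (\<lambda>x. P (f x))"
  unfolding decidable_def by (rule computable_comp)

lemma decidable_eq: "computable a \<Longrightarrow> computable b \<Longrightarrow> decidable (\<lambda>x. a x = b x)"
  unfolding computable_def decidable_def by (rule recursive_eq)

lemma decidable_const: "decidable (\<lambda>x. b)"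
  unfolding decidable_def by (rule computable_const)

lemma decidable_if: "decidable P \<Longrightarrow> decidable Q \<Longrightarrow> decidable R \<Longrightarrow> decidable (\<lambda>x. if P x then Q x else R x)"
proof -
  assume "decidable P" "decidable Q" "decidable R"
  then have "computable (\<lambda>x. if P x then (if Q x then 1 else 0) else (if R x then 1 else 0))"
    unfolding decidable_def[of Q] decidable_def[of R] by (rule computable_if)
  moreover have "(\<lambda>x. if P x then (if Q x then 1 else 0) else (if R x then 1 else 0)) =
      (\<lambda>x. if (if P x then Q x else R x) then 1 else (0::nat))" by auto
  ultimately show ?thesis unfolding decidable_def by simp
qed

lemma decidable_not:
  assumes "decidable P" shows "decidable (\<lambda>x. \<not> P x)"
  by (rule decidable_cong[OF decidable_if[OF assms decidable_const[of False] decidable_const[of True]]]) simp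

lemma decidable_conj:
  assumes "decidable P" "decidable Q" shows "decidable (\<lambda>x. P x \<and> Q x)"
  by (rule decidable_cong[OF decidable_if[OF assms decidable_const[of False]]]) simp

lemma decidable_disj:
  assumes "decidable P" "decidable Q" shows "decidable (\<lambda>x. P x \<or> Q x)"
  by (rule decidable_cong[OF decidable_if[OF assms(1) decidable_const[of True] assms(2)]]) simp

lemma decidable_imp:
  assumes "decidable P" "decidable Q" shows "decidable (\<lambda>x. P x \<longrightarrow> Q x)"
  by (rule decidable_cong[OF decidable_if[OF assms decidable_const[of True]]]) simp

lemma decidable_le: "computable a \<Longrightarrow> computable b \<Longrightarrow> decidable (\<lambda>x. a x \<le> b x)"
  using decidable_eq[OF computable_minus computable_const, of a b 0] by simp

lemma decidable_less: "computable a \<Longrightarrow> computable b \<Longrightarrow> decidable (\<lambda>x. a x < b x)"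
  using decidable_not[OF decidable_le, of b a] by (simp add: not_le)

subsection \<open>Pairing\<close>

lemma computable_mu_raw:
  assumes "recursive 2 (\<lambda>xs. if P (xs ! 0) (xs ! 1) then 1 else 0)" "\<And>x. \<exists>y. P y x"
  shows "computable (\<lambda>x. LEAST y. P y x)"
proof -
  let ?g = "\<lambda>xs. 1 - (if P (xs ! 0) (xs ! 1) then 1 else (0::nat))"
  have n: "recursive (Suc 1) ?g"
    using recursive_minus[OF recursive_const[of 2 1] assms(1)] by (simp only: numeral_2_eq_2 One_nat_def)
  have e: "?g (y # xs) = 0 \<longleftrightarrow> P y (xs ! 0)" for y xs by simp
  have "recursive 1 (\<lambda>xs. LEAST y. ?g (y # xs) = 0)"
    by (rule recursive.mu[OF n]) (use assms(2) in \<open>simp only: e, blast\<close>)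
  then show ?thesis unfolding computable_def e .
qed

text \<open>
  The first component is found by minimization with a bounded search for the second one. Bounded
  search is done by hand here, since the general rule \<open>decidable_bex_less\<close> already presupposes the
  projections.
\<close>

lemma computable_pfst: "computable a \<Longrightarrow> computable (\<lambda>x. pfst (a x))"
proof -
  assume a: "computable a"
  define R where "R b m z = (if \<exists>n<b. prod_encode (m, n) = z then 1 else (0::nat))" for b m z
  let ?h = "\<lambda>xs::nat list. if (if prod_encode (xs ! 2, xs ! 0) = xs ! 3 then 1 else 0) \<noteq> (0::nat) then 1 else xs ! 1"
  have p: "recursive 4 (\<lambda>xs. xs ! i)" if "i < 4" for i by (rule recursive.proj[OF that])
  have h: "recursive 4 ?h"
    by (rule recursive_if[OF recursive_eq[OF recursive_pair[OF p p] p] recursive_const p]) simp_all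
  have "recursive 3 (\<lambda>xs. rec_nat ((\<lambda>_. 0) (tl xs)) (\<lambda>y r. ?h (y # r # tl xs)) (hd xs))"
    using recursive.prim_rec[OF recursive.zero[of 2], of ?h] h by (simp add: eval_nat_numeral)
  then have r: "recursive 3 (\<lambda>xs. R (xs ! 0) (xs ! 1) (xs ! 2))"
  proof (rule recursive_cong)
    fix xs :: "nat list" assume "length xs = 3"
    then obtain b m z where xs: "xs = [b, m, z]"
      by (auto simp: numeral_3_eq_3 length_Suc_conv)
    have "rec_nat 0 (\<lambda>y r. if prod_encode (m, y) = z then 1 else r) b = R b m z"
      unfolding R_def by (induction b) (auto simp: less_Suc_eq)
    moreover have "(\<lambda>y r. ?h (y # r # tl xs)) = (\<lambda>y r. if prod_encode (m, y) = z then 1 else r)"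
      unfolding xs by (simp add: fun_eq_iff)
    moreover have "hd xs = b" "xs ! 0 = b" "xs ! 1 = m" "xs ! 2 = z" unfolding xs by simp_all
    ultimately show "rec_nat ((\<lambda>_. 0) (tl xs)) (\<lambda>y r. ?h (y # r # tl xs)) (hd xs) = R (xs ! 0) (xs ! 1) (xs ! 2)"
      by (simp only:)
  qed
  have "recursive 2 (\<lambda>xs. R (Suc (xs ! 1)) (xs ! 0) (xs ! 1))"
    using recursive_comp3[OF r recursive_Suc[OF recursive2(2)] recursive2] by simp
  then have r2: "recursive 2 (\<lambda>xs. if \<exists>n<Suc (xs ! 1). prod_encode (xs ! 0, n) = xs ! 1 then 1 else 0)"
    unfolding R_def .
  have P: "(\<exists>n<Suc z. prod_encode (m, n) = z) \<longleftrightarrow> m = pfst z" for m z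
  proof
    assume "m = pfst z"
    then have "prod_encode (m, psnd z) = z" by simp
    moreover have "psnd z \<le> prod_encode (m, psnd z)" by (rule le_prod_encode_2)
    ultimately have "psnd z < Suc z" "prod_encode (m, psnd z) = z" by simp_all
    then show "\<exists>n<Suc z. prod_encode (m, n) = z" by blast
  qed auto
  have "computable (\<lambda>z. LEAST m. \<exists>n<Suc z. prod_encode (m, n) = z)"
    by (rule computable_mu_raw[OF r2]) (simp only: P, blast)
  then have "computable pfst" unfolding P by (simp add: Least_equality)
  then show ?thesis using a by (rule computable_comp)
qed

lemma computable_psnd: "computable a \<Longrightarrow> computable (\<lambda>x. psnd (a x))"
proof -
  assume a: "computable a"
  have P: "recursive 2 (\<lambda>xs. if prod_encode (pfst (xs ! 1), xs ! 0) = xs ! 1 then 1 else 0)"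
    by (intro recursive_eq recursive_pair recursive2 recursive_computable[OF computable_pfst[OF computable_id]])
  have "computable (\<lambda>z. LEAST n. prod_encode (pfst z, n) = z)"
    by (rule computable_mu_raw[OF P]) (rule exI[of _ "psnd x" for x], rule pair_pfst_psnd)
  moreover have "prod_encode (pfst z, n) = z \<longleftrightarrow> n = psnd z" for n z
  proof
    assume "prod_encode (pfst z, n) = z"
    then have "psnd (prod_encode (pfst z, n)) = psnd z" by simp
    then show "n = psnd z" by simp
  qed simp
  ultimately have "computable (\<lambda>z. LEAST n. n = psnd z)" by simp
  then have "computable psnd" by (simp add: Least_equality)
  then show ?thesis using a by (rule computable_comp)
qed

subsection \<open>Closure rules for packed arguments\<close>

lemma recursive_unpack2: "computable (\<lambda>z. f (pfst z) (psnd z)) \<Longrightarrow> recursive 2 (\<lambda>xs. f (xs ! 0) (xs ! 1))"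
  using recursive_computable[OF _ recursive_pair[OF recursive2], of "\<lambda>z. f (pfst z) (psnd z)"] by simp

lemma recursive_unpack3:
  "computable (\<lambda>z. f (pfst z) (pfst (psnd z)) (psnd (psnd z))) \<Longrightarrow> recursive 3 (\<lambda>xs. f (xs ! 0) (xs ! 1) (xs ! 2))"
  using recursive_computable[OF _ recursive_pair[OF recursive3(1) recursive_pair[OF recursive3(2) recursive3(3)]],
      of "\<lambda>z. f (pfst z) (pfst (psnd z)) (psnd (psnd z))"] by simp

lemma computable_mu:
  assumes "decidable (\<lambda>z. P (pfst z) (psnd z))" "\<And>x. \<exists>y. P y x"
  shows "computable (\<lambda>x. LEAST y. P y x)"
  by (rule computable_mu_raw[OF recursive_unpack2 assms(2)]) (use assms(1) in \<open>simp add: decidable_def\<close>)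

lemma computable_rec_nat:
  assumes n: "computable n" and a: "computable a" and h: "computable (\<lambda>z. h (pfst z) (pfst (psnd z)) (psnd (psnd z)))"
  shows "computable (\<lambda>x. rec_nat (a x) (\<lambda>y r. h y r x) (n x))"
proof -
  have "recursive 1 (\<lambda>xs. (\<lambda>m x. rec_nat (a x) (\<lambda>y r. h y r x) m) (n (xs ! 0)) (xs ! 0))"
    by (rule recursive_rec2[OF a[unfolded computable_def] recursive_unpack3[OF h] _ _ n[unfolded computable_def] computable_id[unfolded computable_def]])
      simp_all
  then show ?thesis unfolding computable_def .
qed

lemma decidable_bex_less:
  assumes "decidable (\<lambda>z. P (pfst z) (psnd z))" "computable b"
  shows "decidable (\<lambda>x. \<exists>y<b x. P y x)"
proof -
  have "computable (\<lambda>x. rec_nat 0 (\<lambda>y r. if P y x then 1 else r) (b x))"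
    by (rule computable_rec_nat[OF assms(2) computable_const])
      (intro computable_if computable_const computable_pfst computable_psnd computable_id, use decidable_comp[OF assms(1), of "\<lambda>z. prod_encode (pfst z, psnd (psnd z))"]
        in \<open>simp add: computable_pair computable_pfst computable_psnd computable_id\<close>)
  moreover have e: "rec_nat 0 (\<lambda>y r. if P y x then 1 else r) m = (if \<exists>y<m. P y x then 1 else 0)" for m x
    by (induction m) (auto simp: less_Suc_eq)
  ultimately show ?thesis unfolding decidable_def by (simp only: e)
qed

lemma decidable_ball_less:
  assumes "decidable (\<lambda>z. P (pfst z) (psnd z))" "computable b"
  shows "decidable (\<lambda>x. \<forall>y<b x. P y x)"
  by (rule decidable_cong[OF decidable_not[OF decidable_bex_less[OF decidable_not[OF assms(1)] assms(2)]]]) simp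

lemma computable_power2: "computable a \<Longrightarrow> computable (\<lambda>x. 2 ^ a x)"
proof -
  assume a: "computable a"
  have "computable (\<lambda>x. rec_nat 1 (\<lambda>y r. r + r) (a x))"
    by (rule computable_rec_nat[OF a computable_const]) (intro computable_plus computable_pfst computable_psnd computable_id)
  moreover have e: "rec_nat 1 (\<lambda>y r. r + r) m = (2 ^ m :: nat)" for m by (induction m) auto
  ultimately show ?thesis by (simp only: e)
qed

lemma decidable_mem: "computable a \<Longrightarrow> computable s \<Longrightarrow> decidable (\<lambda>x. a x \<in> els (s x))"
proof -
  assume a: "computable a" and s: "computable s"
  \<comment> \<open>Bit \<open>a\<close> of \<open>s\<close> is set if the quotient of \<open>s\<close> by \<open>2 ^
    a\<close> is an odd number \<open>2 * h + 1\<close>.\<close>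
  have e: "a \<in> els s \<longleftrightarrow> (\<exists>h<Suc s. (2 * h + 1) * 2 ^ a \<le> s \<and> s < (2 * h + 2) * 2 ^ a)" for a s :: nat
  proof
    assume "a \<in> els s"
    then obtain h where h: "s div 2 ^ a = 2 * h + 1" unfolding set_decode_def by (auto elim: oddE)
    define r where "r = s mod 2 ^ a"
    have "s = (s div 2 ^ a) * 2 ^ a + r" unfolding r_def by (rule div_mult_mod_eq[symmetric])
    then have "s = (2 * h + 1) * 2 ^ a + r" unfolding h .
    moreover have "r < 2 ^ a" unfolding r_def by simp
    ultimately have "(2 * h + 1) * 2 ^ a \<le> s" "s < (2 * h + 2) * 2 ^ a" by (simp_all add: algebra_simps)
    moreover have "h < Suc s" using h div_le_dividend[of s "2 ^ a"] by linarith
    ultimately show "\<exists>h<Suc s. (2 * h + 1) * 2 ^ a \<le> s \<and> s < (2 * h + 2) * 2 ^ a" by blast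
  next
    assume "\<exists>h<Suc s. (2 * h + 1) * 2 ^ a \<le> s \<and> s < (2 * h + 2) * 2 ^ a"
    then obtain h where h: "(2 * h + 1) * 2 ^ a \<le> s" "s < (2 * h + 2) * 2 ^ a" by blast
    have "s div 2 ^ a = 2 * h + 1"
      by (rule div_nat_eqI) (use h in \<open>simp_all add: mult.commute add.commute\<close>)
    then show "a \<in> els s" unfolding set_decode_def by simp
  qed
  show ?thesis unfolding e
    by (intro decidable_bex_less decidable_conj decidable_le decidable_less computable_times computable_plus computable_power2 computable_const computable_pfst computable_id computable_Suc
        computable_comp[OF a] computable_comp[OF s] s computable_psnd)
qed

subsection \<open>Finite sets\<close>

lemma els_less: "y \<in> els n \<Longrightarrow> y < n"
proof -
  assume "y \<in> els n"
  then have "n div 2 ^ y \<noteq> 0" unfolding set_decode_def by (metis even_zero mem_Collect_eq)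
  then have "2 ^ y \<le> n" by (metis div_less not_le)
  moreover have "y < 2 ^ y" by simp
  ultimately show ?thesis by linarith
qed

lemma decidable_bex_els:
  assumes "decidable (\<lambda>z. P (pfst z) (psnd z))" "computable s"
  shows "decidable (\<lambda>x. \<exists>y\<in>els (s x). P y x)"
proof -
  have "decidable (\<lambda>x. \<exists>y<s x. y \<in> els (s x) \<and> P y x)"
    by (intro decidable_bex_less decidable_conj decidable_mem computable_pfst computable_psnd computable_id computable_comp[OF assms(2)] assms)
  then show ?thesis by (rule decidable_cong) (use els_less in blast)
qed

lemma decidable_ball_els:
  assumes "decidable (\<lambda>z. P (pfst z) (psnd z))" "computable s"
  shows "decidable (\<lambda>x. \<forall>y\<in>els (s x). P y x)"
proof -
  have "decidable (\<lambda>x. \<forall>y<s x. y \<in> els (s x) \<longrightarrow> P y x)"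
    by (intro decidable_ball_less decidable_imp decidable_mem computable_pfst computable_psnd computable_id computable_comp[OF assms(2)] assms)
  then show ?thesis by (rule decidable_cong) (use els_less in blast)
qed

lemma Least_superset: "finite F \<Longrightarrow> (LEAST y. F \<subseteq> els y) = set_encode F"
proof (rule Least_equality)
  assume F: "finite F"
  then show "F \<subseteq> els (set_encode F)" by (simp add: set_encode_inverse)
  show "set_encode F \<le> y" if "F \<subseteq> els y" for y
    using set_encode_mono[OF that] by (simp add: set_decode_inverse)
qed

text \<open>
  The workhorse for set comprehensions: a finite set is computable as soon as it is decidable
  which codes denote a superset of it. No bound on its elements has to be given.
\<close>

lemma computable_set_encode:
  assumes "\<And>x. finite (F x)" "decidable (\<lambda>z. F (psnd z) \<subseteq> els (pfst z))"
  shows "computable (\<lambda>x. set_encode (F x))"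
proof -
  have "computable (\<lambda>x. LEAST y. F x \<subseteq> els y)"
  proof (rule computable_mu[OF assms(2)])
    show "\<exists>y. F x \<subseteq> els y" for x
      using set_encode_inverse[OF assms(1)[of x]] by (intro exI[of _ "set_encode (F x)"]) simp
  qed
  then show ?thesis using Least_superset[OF assms(1)] by simp
qed

lemma computable_UN:
  assumes "computable (\<lambda>z. f (pfst z) (psnd z))" "computable s"
  shows "computable (\<lambda>x. set_encode (\<Union>w\<in>els (s x). els (f w x)))"
proof (rule computable_set_encode)
  have 1: "computable (\<lambda>z. f (pfst z) (psnd (psnd z)))"
    using computable_comp[OF assms(1) computable_pair[OF computable_pfst[OF computable_id] computable_psnd[OF computable_psnd[OF computable_id]]]] by simp
  have "decidable (\<lambda>z. \<forall>w\<in>els (s (psnd z)). \<forall>v\<in>els (f w (psnd z)). v \<in> els (pfst z))"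
    by (intro decidable_ball_els decidable_mem computable_pfst computable_psnd computable_id computable_comp[OF assms(2)] 1)
  then show "decidable (\<lambda>z. (\<Union>w\<in>els (s (psnd z)). els (f w (psnd z))) \<subseteq> els (pfst z))"
    by (rule decidable_cong) blast
qed simp

lemma computable_image:
  assumes "computable (\<lambda>z. f (pfst z) (psnd z))" "computable s"
  shows "computable (\<lambda>x. set_encode ((\<lambda>w. f w x) ` els (s x)))"
proof (rule computable_set_encode)
  have 1: "computable (\<lambda>z. f (pfst z) (psnd (psnd z)))"
    using computable_comp[OF assms(1) computable_pair[OF computable_pfst[OF computable_id] computable_psnd[OF computable_psnd[OF computable_id]]]] by simp
  have "decidable (\<lambda>z. \<forall>w\<in>els (s (psnd z)). f w (psnd z) \<in> els (pfst z))"
    by (intro decidable_ball_els decidable_mem computable_pfst computable_psnd computable_id computable_comp[OF assms(2)] 1)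
  then show "decidable (\<lambda>z. (\<lambda>w. f w (psnd z)) ` els (s (psnd z)) \<subseteq> els (pfst z))"
    by (rule decidable_cong) blast
qed simp

lemma computable_Un:
  assumes "computable a" "computable b"
  shows "computable (\<lambda>x. set_encode (els (a x) \<union> els (b x)))"
proof (rule computable_set_encode)
  have "decidable (\<lambda>z. (\<forall>w\<in>els (a (psnd z)). w \<in> els (pfst z)) \<and> (\<forall>w\<in>els (b (psnd z)). w \<in> els (pfst z)))"
    by (intro decidable_conj decidable_ball_els decidable_mem computable_pfst computable_psnd computable_id computable_comp[OF assms(1)] computable_comp[OF assms(2)])
  then show "decidable (\<lambda>z. els (a (psnd z)) \<union> els (b (psnd z)) \<subseteq> els (pfst z))"
    by (rule decidable_cong) blast
qed simp

lemma computable_single: "computable a \<Longrightarrow> computable (\<lambda>x. set_encode {a x})"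
  using computable_power2[of a] by (simp add: set_encode_def)

lemma computable_cut: "computable a \<Longrightarrow> computable b \<Longrightarrow> computable c \<Longrightarrow> computable (\<lambda>x. cut (a x) (b x) (c x))"
  unfolding cut_def by (intro computable_pair)

lemma computable_cut_left: "computable a \<Longrightarrow> computable (\<lambda>x. cut_left (a x))" and computable_cut_color: "computable a \<Longrightarrow> computable (\<lambda>x. cut_color (a x))"
  and computable_cut_right: "computable a \<Longrightarrow> computable (\<lambda>x. cut_right (a x))"
  unfolding cut_left_def cut_color_def cut_right_def by (intro computable_pfst computable_psnd, assumption)+

subsection \<open>Recursion on levels\<close>

text \<open>
  The value at \<open>z\<close> in a finite table of pairs. The second alternative makes the search total.
\<close>

definition lookup :: "nat \<Rightarrow> nat \<Rightarrow> nat" where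
  "lookup t z = (LEAST y. prod_encode (z, y) \<in> els t \<or> t \<le> y)"

lemma computable_lookup:
  assumes t: "computable t" and a: "computable a"
  shows "computable (\<lambda>x. lookup (t x) (a x))"
  unfolding lookup_def
proof (rule computable_mu)
  show "decidable (\<lambda>z. prod_encode (a (psnd z), pfst z) \<in> els (t (psnd z)) \<or> t (psnd z) \<le> pfst z)"
    by (intro decidable_disj decidable_mem decidable_le computable_pair computable_pfst computable_id computable_comp[OF t] computable_comp[OF a] computable_psnd)
qed blast

lemma lookup_table:
  assumes "finite A" "z \<in> A"
  shows "lookup (set_encode ((\<lambda>z. prod_encode (z, F z)) ` A)) z = F z"
proof -
  let ?t = "set_encode ((\<lambda>z. prod_encode (z, F z)) ` A)"
  have t: "els ?t = (\<lambda>z. prod_encode (z, F z)) ` A" using assms(1) by (simp add: set_encode_inverse)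
  have "prod_encode (z, F z) < ?t" by (rule els_less) (use t assms(2) in blast)
  moreover have "F z \<le> prod_encode (z, F z)" by (rule le_prod_encode_2)
  ultimately have lt: "F z < ?t" by linarith
  show ?thesis unfolding lookup_def
  proof (rule Least_equality)
    show "prod_encode (z, F z) \<in> els ?t \<or> ?t \<le> F z" using t assms(2) by blast
    fix y assume "prod_encode (z, y) \<in> els ?t \<or> ?t \<le> y"
    then show "F z \<le> y" using lt unfolding t by auto
  qed
qed

text \<open>
  Recursion on \<open>k\<close> in which the other argument changes: \<open>f (k + 1) x\<close> may use \<open>f k z\<close> for all \<open>z\<close> in a
  computable finite set \<open>dep k x\<close>. Primitive recursion with fixed parameters suffices to
  compute the sets \<open>D\<close> of arguments needed at each level from the top downwards, and then the
  tables \<open>T\<close> of values at these arguments from level \<open>0\<close> upwards.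
\<close>

lemma computable_level:
  fixes f :: "nat \<Rightarrow> nat \<Rightarrow> nat"
  assumes f0: "\<And>x. f 0 x = g x" and fS: "\<And>k x. f (Suc k) x = H k x (f k)"
    and cong: "\<And>k x F F'. (\<And>z. z \<in> els (dep k x) \<Longrightarrow> F z = F' z) \<Longrightarrow> H k x F = H k x F'"
    and g: "computable g" and dep: "computable (\<lambda>z. dep (pfst z) (psnd z))"
    and H: "computable (\<lambda>z. H (pfst z) (pfst (psnd z)) (lookup (psnd (psnd z))))"
    and a: "computable a" and b: "computable b"
  shows "computable (\<lambda>x. f (a x) (b x))"
proof -
  define D where "D w i = rec_nat (set_encode {psnd w})
     (\<lambda>i r. set_encode (\<Union>z\<in>els r. els (dep (pfst w - Suc i) z))) i" for w i
  define T where "T w j = rec_nat (set_encode ((\<lambda>z. prod_encode (z, g z)) ` els (D w (pfst w))))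
     (\<lambda>j r. set_encode ((\<lambda>z. prod_encode (z, H j z (lookup r))) ` els (D w (pfst w - Suc j)))) j" for w j
  have D0: "els (D w 0) = {psnd w}" and DS: "els (D w (Suc i)) = (\<Union>z\<in>els (D w i). els (dep (pfst w - Suc i) z))" for w i
    unfolding D_def by (simp_all add: set_encode_inverse del: set_encode_insert)
  have T: "T w j = set_encode ((\<lambda>z. prod_encode (z, f j z)) ` els (D w (pfst w - j)))" if "j \<le> pfst w" for w j
    using that
  proof (induction j)
    case 0 show ?case unfolding T_def by (simp add: f0)
  next
    case (Suc j)
    define i where "i = pfst w - Suc j"
    have i: "pfst w - j = Suc i" "pfst w - Suc i = j" unfolding i_def using Suc.prems by auto
    have eq: "H j z (lookup (T w j)) = f (Suc j) z" if "z \<in> els (D w i)" for z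
      unfolding fS
    proof (rule cong)
      fix v assume "v \<in> els (dep j z)"
      then have "v \<in> els (D w (pfst w - j))" unfolding i(1) DS i(2) using that by blast
      then show "lookup (T w j) v = f j v" using Suc by (simp add: lookup_table)
    qed
    have "T w (Suc j) = set_encode ((\<lambda>z. prod_encode (z, H j z (lookup (T w j)))) ` els (D w i))"
      unfolding T_def i_def by simp
    also have "(\<lambda>z. prod_encode (z, H j z (lookup (T w j)))) ` els (D w i) = (\<lambda>z. prod_encode (z, f (Suc j) z)) ` els (D w i)"
      by (rule image_cong) (simp_all add: eq)
    finally show ?case unfolding i_def .
  qed
  have fT: "f (pfst w) (psnd w) = lookup (T w (pfst w)) (psnd w)" for w
  proof -
    have "T w (pfst w) = set_encode ((\<lambda>z. prod_encode (z, f (pfst w) z)) ` {psnd w})"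
      unfolding T[OF le_refl] diff_self_eq_0 D0 ..
    moreover have "lookup (set_encode ((\<lambda>z. prod_encode (z, f (pfst w) z)) ` {psnd w})) (psnd w) = f (pfst w) (psnd w)"
      by (rule lookup_table) simp_all
    ultimately show ?thesis by simp
  qed
  have rD: "computable (\<lambda>x. D (u x) (v x))" if u: "computable u" and v: "computable v" for u v
  proof -
    have d: "computable (\<lambda>x. dep (u' x) (v' x))" if "computable u'" "computable v'" for u' v'
      using computable_comp[OF dep computable_pair[OF that]] by simp
    show ?thesis unfolding D_def
      by (intro computable_rec_nat computable_single computable_UN d computable_minus computable_Suc computable_pfst computable_psnd computable_id computable_comp[OF u] v u)
  qed
  have rT: "computable (\<lambda>w. T w (pfst w))"
  proof -
    have h: "computable (\<lambda>x. H (u x) (v x) (lookup (t x)))" if "computable u" "computable v" "computable t" for u v t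
      using computable_comp[OF H computable_pair[OF that(1) computable_pair[OF that(2,3)]]] by simp
    show ?thesis unfolding T_def
      by (intro computable_rec_nat computable_image computable_pair h rD computable_comp[OF g] computable_minus computable_Suc computable_pfst computable_psnd computable_id)
  qed
  have "computable (\<lambda>w. f (pfst w) (psnd w))" unfolding fT by (intro computable_lookup rT computable_psnd computable_id)
  from computable_comp[OF this computable_pair[OF a b]] show ?thesis by simp
qed

subsection \<open>The operations on types\<close>

lemma computable_trunc: "computable a \<Longrightarrow> computable b \<Longrightarrow> computable (\<lambda>x. trunc (a x) (b x))"
proof (rule computable_level[where f=trunc and g="\<lambda>_. 0" and dep="\<lambda>k t. set_encode (els (set_encode (cut_left ` els t)) \<union> els (set_encode (cut_right ` els t)))"
    and H="\<lambda>k t F. set_encode ((\<lambda>w. cut (F (cut_left w)) (cut_color w) (F (cut_right w))) ` els t)"])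
  show "computable (\<lambda>z. set_encode (els (set_encode (cut_left ` els (psnd z))) \<union> els (set_encode (cut_right ` els (psnd z)))))"
    by (intro computable_Un computable_image computable_cut_left computable_cut_right computable_pfst computable_psnd computable_id)
  show "computable (\<lambda>z. set_encode ((\<lambda>w. cut (lookup (psnd (psnd z)) (cut_left w)) (cut_color w) (lookup (psnd (psnd z)) (cut_right w))) ` els (pfst (psnd z))))"
    by (intro computable_image computable_cut computable_lookup computable_cut_left computable_cut_color computable_cut_right computable_pfst computable_psnd computable_id)
  fix k x and F F' :: "nat \<Rightarrow> nat"
  assume F: "\<And>z. z \<in> els (set_encode (els (set_encode (cut_left ` els x)) \<union> els (set_encode (cut_right ` els x)))) \<Longrightarrow> F z = F' z"
  have "F (cut_left w) = F' (cut_left w)" "F (cut_right w) = F' (cut_right w)" if "w \<in> els x" for w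
    by (rule F, simp add: set_encode_inverse that)+
  then show "set_encode ((\<lambda>w. cut (F (cut_left w)) (cut_color w) (F (cut_right w))) ` els x) =
     set_encode ((\<lambda>w. cut (F' (cut_left w)) (cut_color w) (F' (cut_right w))) ` els x)" by simp
qed (simp_all add: trunc.simps computable_const)

lemma computable_tadd: assumes "computable a" "computable b" "computable c" shows "computable (\<lambda>x. tadd (a x) (b x) (c x))"
proof -
  let ?dep = "\<lambda>k x. set_encode (els (set_encode ((\<lambda>w. prod_encode (cut_right w, trunc k (psnd x))) ` els (pfst x)))
     \<union> els (set_encode ((\<lambda>w. prod_encode (trunc k (pfst x), cut_left w)) ` els (psnd x))))"
  let ?H = "\<lambda>k x F. set_encode (els (set_encode
     ((\<lambda>w. cut (cut_left w) (cut_color w) (F (prod_encode (cut_right w, trunc k (psnd x))))) ` els (pfst x))) \<union> els (set_encode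
      ((\<lambda>w. cut (F (prod_encode (trunc k (pfst x), cut_left w))) (cut_color w) (cut_right w)) ` els (psnd x))))"
  have "computable (\<lambda>x. (\<lambda>k x. tadd k (pfst x) (psnd x)) (a x) (prod_encode (b x, c x)))"
  proof (rule computable_level[where f="\<lambda>k x. tadd k (pfst x) (psnd x)" and g="\<lambda>_. 0" and dep="?dep" and H="?H"])
    show "computable (\<lambda>z. ?dep (pfst z) (psnd z))"
      by (intro computable_Un computable_image computable_pair computable_cut_left computable_cut_right computable_trunc computable_pfst computable_psnd computable_id)
    show "computable (\<lambda>z. ?H (pfst z) (pfst (psnd z)) (lookup (psnd (psnd z))))"
      by (intro computable_Un computable_image computable_cut computable_lookup computable_pair computable_trunc computable_cut_left computable_cut_color computable_cut_right computable_pfst computable_psnd computable_id)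
    fix k x and F F' :: "nat \<Rightarrow> nat"
    assume F: "\<And>z. z \<in> els (?dep k x) \<Longrightarrow> F z = F' z"
    have "F (prod_encode (cut_right w, trunc k (psnd x))) = F' (prod_encode (cut_right w, trunc k (psnd x)))" if "w \<in> els (pfst x)" for w
      by (rule F) (simp add: set_encode_inverse that)
    moreover have "F (prod_encode (trunc k (pfst x), cut_left w)) = F' (prod_encode (trunc k (pfst x), cut_left w))" if "w \<in> els (psnd x)" for w
      by (rule F) (simp add: set_encode_inverse that)
    ultimately show "?H k x F = ?H k x F'" by simp
  next
    show "computable a" "computable (\<lambda>x. prod_encode (b x, c x))" by (intro computable_pair assms)+
  qed (simp_all add: tadd.simps computable_const set_encode_inverse)
  then show ?thesis by simp
qed

lemma computable_universe: assumes "computable a" "computable b" shows "computable (\<lambda>x. universe (a x) (b x))"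
proof -
  let ?V = "\<lambda>r C. {w. cut_left w \<in> els r \<and> cut_color w \<in> els C \<and> cut_right w \<in> els r}"
  have V: "computable (\<lambda>x. set_encode (?V (r x) (C x)))" if r: "computable r" and C: "computable C" for r C
  proof (rule computable_set_encode[OF finite_triples])
    have "decidable (\<lambda>z. \<forall>l\<in>els (r (psnd z)). \<forall>c\<in>els (C (psnd z)). \<forall>t\<in>els (r (psnd z)). cut l c t \<in> els (pfst z))"
      by (intro decidable_ball_els decidable_mem computable_cut computable_pfst computable_psnd computable_id computable_comp[OF r] computable_comp[OF C])
    then show "decidable (\<lambda>z. ?V (r (psnd z)) (C (psnd z)) \<subseteq> els (pfst z))"
    proof (rule decidable_cong)
      fix z
      show "(\<forall>l\<in>els (r (psnd z)). \<forall>c\<in>els (C (psnd z)). \<forall>t\<in>els (r (psnd z)). cut l c t \<in> els (pfst z)) \<longleftrightarrow>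
        ?V (r (psnd z)) (C (psnd z)) \<subseteq> els (pfst z)" (is "?L \<longleftrightarrow> ?R")
      proof
        assume L: ?L
        show ?R
        proof
          fix w assume "w \<in> ?V (r (psnd z)) (C (psnd z))"
          then have "cut (cut_left w) (cut_color w) (cut_right w) \<in> els (pfst z)" using L by blast
          then show "w \<in> els (pfst z)" by simp
        qed
      qed auto
    qed
  qed
  let ?P = "\<lambda>v. {y. els y \<subseteq> els v}"
  have P: "computable (\<lambda>x. set_encode (?P (v x)))" if v: "computable v" for v
  proof (rule computable_set_encode[OF finite_codes])
    have "decidable (\<lambda>z. \<forall>y<Suc (v (psnd z)). (\<forall>w\<in>els y. w \<in> els (v (psnd z))) \<longrightarrow> y \<in> els (pfst z))"
      by (intro decidable_ball_less decidable_imp decidable_ball_els decidable_mem computable_Suc computable_pfst computable_psnd computable_id computable_comp[OF v])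
    then show "decidable (\<lambda>z. ?P (v (psnd z)) \<subseteq> els (pfst z))"
    proof (rule decidable_cong)
      fix z
      have "y < Suc (v (psnd z))" if "els y \<subseteq> els (v (psnd z))" for y
        using set_encode_mono[OF that] by (simp add: set_decode_inverse)
      then show "(\<forall>y<Suc (v (psnd z)). (\<forall>w\<in>els y. w \<in> els (v (psnd z))) \<longrightarrow> y \<in> els (pfst z)) \<longleftrightarrow>
        ?P (v (psnd z)) \<subseteq> els (pfst z)" by blast
    qed
  qed simp
  have eq: "universe C k = rec_nat (set_encode {0}) (\<lambda>_ r. set_encode (?P (set_encode (?V r C)))) k" for C k
    by (induction k) (simp_all add: universe.simps set_encode_inverse[OF finite_triples])
  show ?thesis unfolding eq
    by (intro computable_rec_nat computable_const P V computable_pfst computable_psnd computable_id computable_comp[OF assms(1)] assms)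
qed

lemma computable_tclosure: assumes C: "computable C" and k: "computable k" and A: "computable A" shows "computable (\<lambda>x. tclosure (C x) (k x) (A x))"
  unfolding tclosure_def
proof (rule computable_mu)
  have "decidable (\<lambda>z. (\<forall>w\<in>els (A (psnd z)). w \<in> els (pfst z)) \<and>
     (\<forall>s\<in>els (pfst z). \<forall>t\<in>els (A (psnd z)). tadd (k (psnd z)) s t \<in> els (universe (C (psnd z)) (k (psnd z))) \<longrightarrow> tadd (k (psnd z)) s t \<in> els (pfst z)))"
    by (intro decidable_conj decidable_ball_els decidable_imp decidable_mem computable_tadd computable_universe computable_pfst computable_psnd computable_id
        computable_comp[OF C] computable_comp[OF k] computable_comp[OF A])
  then show "decidable (\<lambda>z. els (A (psnd z)) \<subseteq> els (pfst z) \<and>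
     (\<forall>s\<in>els (pfst z). \<forall>t\<in>els (A (psnd z)). tadd (k (psnd z)) s t \<in> els (universe (C (psnd z)) (k (psnd z))) \<longrightarrow> tadd (k (psnd z)) s t \<in> els (pfst z)))"
    by (rule decidable_cong) blast
  fix x
  let ?y = "set_encode (els (A x) \<union> els (universe (C x) (k x)))"
  have "els ?y = els (A x) \<union> els (universe (C x) (k x))" by (rule set_encode_inverse) simp
  then show "\<exists>y. els (A x) \<subseteq> els y \<and> (\<forall>s\<in>els y. \<forall>t\<in>els (A x).
       tadd (k x) s t \<in> els (universe (C x) (k x)) \<longrightarrow> tadd (k x) s t \<in> els y)"
    by (intro exI[of _ ?y]) simp
qed

lemma computable_tomega: assumes "computable a" "computable b" "computable c" shows "computable (\<lambda>x. tomega (a x) (b x) (c x))"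
proof -
  let ?arg = "\<lambda>k x. prod_encode (pfst x, trunc k (psnd x))"
  let ?dep = "\<lambda>k x. set_encode {?arg k x}"
  let ?S = "\<lambda>k x. set_encode (els (set_encode {0}) \<union> els (tclosure (pfst x) k (set_encode {trunc k (psnd x)})))"
  let ?H = "\<lambda>k x F. set_encode (\<Union>s\<in>els (?S k x). els (set_encode
      ((\<lambda>w. cut (tadd k s (cut_left w)) (cut_color w) (tadd k (cut_right w) (F (?arg k x)))) ` els (psnd x))))"
  have S: "els (?S k x) = insert 0 (els (tclosure (pfst x) k (set_encode {trunc k (psnd x)})))" for k x
    by (simp add: set_encode_inverse els_universe_0[unfolded universe.simps] del: set_encode_insert)
  have "computable (\<lambda>x. (\<lambda>k x. tomega (pfst x) k (psnd x)) (b x) (prod_encode (a x, c x)))"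
  proof (rule computable_level[where f="\<lambda>k x. tomega (pfst x) k (psnd x)" and g="\<lambda>_. 0" and dep="?dep" and H="?H"])
    show "computable (\<lambda>z. ?dep (pfst z) (psnd z))"
      by (intro computable_single computable_pair computable_trunc computable_pfst computable_psnd computable_id)
    show "computable (\<lambda>z. ?H (pfst z) (pfst (psnd z)) (lookup (psnd (psnd z))))"
      by (intro computable_UN computable_image computable_Un computable_single computable_tclosure computable_const computable_cut computable_tadd computable_lookup computable_pair computable_trunc
          computable_cut_left computable_cut_color computable_cut_right computable_pfst computable_psnd computable_id)
    fix k x and F F' :: "nat \<Rightarrow> nat"
    assume F: "\<And>z. z \<in> els (?dep k x) \<Longrightarrow> F z = F' z"
    have "F (?arg k x) = F' (?arg k x)"
      by (rule F) (simp add: set_encode_inverse del: set_encode_insert)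
    then show "?H k x F = ?H k x F'" by simp
  next
    fix k x
    show "tomega (pfst x) (Suc k) (psnd x) = ?H k x (\<lambda>x. tomega (pfst x) k (psnd x))"
      unfolding S tomega.simps by (simp add: set_encode_inverse)
    show "computable b" "computable (\<lambda>x. prod_encode (a x, c x))" by (intro computable_pair assms)+
  qed (simp_all add: computable_const)
  then show ?thesis by simp
qed

lemma computable_point_type: assumes "computable a" "computable b" shows "computable (\<lambda>x. point_type (a x) (b x))"
proof -
  have "computable (\<lambda>x. if a x = 0 then 0 else set_encode {cut 0 (b x) 0})"
    by (intro computable_if decidable_eq computable_single computable_cut computable_const assms)
  moreover have "point_type k c = (if k = 0 then 0 else set_encode {cut 0 c 0})" for k c by (cases k) simp_all
  ultimately show ?thesis by simp
qed

subsection \<open>The sets of types\<close>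

lemma computable_filter:
  assumes "decidable (\<lambda>z. P (pfst z) (psnd z))" "computable s"
  shows "computable (\<lambda>x. set_encode {w \<in> els (s x). P w x})"
proof (rule computable_set_encode)
  have 1: "decidable (\<lambda>z. P (pfst z) (psnd (psnd z)))"
    using decidable_comp[OF assms(1) computable_pair[OF computable_pfst[OF computable_id] computable_psnd[OF computable_psnd[OF computable_id]]]] by simp
  have "decidable (\<lambda>z. \<forall>w\<in>els (s (psnd z)). P w (psnd z) \<longrightarrow> w \<in> els (pfst z))"
    by (intro decidable_ball_els decidable_imp 1 decidable_mem computable_pfst computable_psnd computable_id computable_comp[OF assms(2)])
  then show "decidable (\<lambda>z. {w \<in> els (s (psnd z)). P w (psnd z)} \<subseteq> els (pfst z))"
    by (rule decidable_cong) blast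
qed simp

definition set_tadd_code :: "nat \<Rightarrow> nat \<Rightarrow> nat \<Rightarrow> nat" where
  "set_tadd_code k A B = set_encode (\<Union>s\<in>els A. els (set_encode ((\<lambda>t. tadd k s t) ` els B)))"

definition set_tomega_code :: "nat \<Rightarrow> nat \<Rightarrow> nat \<Rightarrow> nat" where
  "set_tomega_code C k A = set_tadd_code k (tclosure C k A) (set_encode ((\<lambda>e. tomega C k e) ` els (tclosure C k A)))"

definition power_types_code :: "nat \<Rightarrow> nat \<Rightarrow> nat \<Rightarrow> nat" where
  "power_types_code C k n = rec_nat (set_encode ((\<lambda>c. point_type k c) ` els C)) (\<lambda>_ r. set_tomega_code C k r) n"

definition stable_exponent :: "nat \<Rightarrow> nat \<Rightarrow> nat" where
  "stable_exponent C k = (LEAST N. power_types_code C k (Suc N) = power_types_code C k N)"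

definition uncountable_types_code :: "nat \<Rightarrow> nat \<Rightarrow> nat \<Rightarrow> nat" where
  "uncountable_types_code C k E = set_tadd_code k E (set_encode {g \<in> els E. tomega C k g = g})"

definition repeat_tadd_code :: "nat \<Rightarrow> nat \<Rightarrow> nat \<Rightarrow> nat \<Rightarrow> nat" where
  "repeat_tadd_code k B n A = rec_nat A (\<lambda>_ r. set_tadd_code k r B) n"

text \<open>
  The state consists of a set of types and the list of terms still to be added. An empty
  list is left alone, so the step may be iterated too often: the code of a list bounds its length.
\<close>

definition theta_step :: "nat \<Rightarrow> nat \<Rightarrow> nat \<Rightarrow> nat" where
  "theta_step C k st = (if psnd st = 0 then st else
     prod_encode (repeat_tadd_code k (power_types_code C k (pfst (pfst (psnd st - 1)))) (psnd (pfst (psnd st - 1))) (pfst st), psnd (psnd st - 1)))"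

definition theta_fold :: "nat \<Rightarrow> nat \<Rightarrow> nat \<Rightarrow> nat \<Rightarrow> nat" where
  "theta_fold C k A l = pfst (rec_nat (prod_encode (A, l)) (\<lambda>_ r. theta_step C k r) l)"

lemma els_set_tadd_code: "els (set_tadd_code k A B) = set_tadd k (els A) (els B)"
proof -
  have "els (set_tadd_code k A B) = (\<Union>s\<in>els A. els (set_encode ((\<lambda>t. tadd k s t) ` els B)))"
    unfolding set_tadd_code_def by (rule set_encode_inverse) simp
  also have "\<dots> = (\<Union>s\<in>els A. (\<lambda>t. tadd k s t) ` els B)" by (simp add: set_encode_inverse)
  finally show ?thesis unfolding set_tadd_def by blast
qed

lemma computable_set_tadd_code:
  assumes "computable a" "computable b" "computable c" shows "computable (\<lambda>x. set_tadd_code (a x) (b x) (c x))"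
  unfolding set_tadd_code_def
  by (intro computable_UN computable_image computable_tadd computable_pfst computable_psnd computable_id computable_comp[OF assms(1)] computable_comp[OF assms(3)] assms)

lemma computable_set_tomega_code:
  assumes "computable a" "computable b" "computable c" shows "computable (\<lambda>x. set_tomega_code (a x) (b x) (c x))"
  unfolding set_tomega_code_def
  by (intro computable_set_tadd_code computable_image computable_tomega computable_tclosure computable_pfst computable_psnd computable_id computable_comp[OF assms(1)] computable_comp[OF assms(2)] assms)

lemma computable_power_types_code:
  assumes "computable a" "computable b" "computable c" shows "computable (\<lambda>x. power_types_code (a x) (b x) (c x))"
  unfolding power_types_code_def
  by (intro computable_rec_nat computable_image computable_point_type computable_set_tomega_code computable_pfst computable_psnd computable_id computable_comp[OF assms(1)] computable_comp[OF assms(2)] assms)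

lemma point_type_universe: "c \<in> els C \<Longrightarrow> point_type k c \<in> els (universe C k)"
  using rat_ord.qtype_singleton[of "\<lambda>_. c" k 0] qtype_universe[of "\<lambda>_. c" "{0::rat}" C "(<)" k] by simp

lemma tomega_universe: "e \<in> els (universe C k) \<Longrightarrow> tomega C k e \<in> els (universe C k)"
proof (induction k arbitrary: e)
  case 0 show ?case by (simp add: els_universe_0)
next
  case (Suc k)
  have t: "trunc k e \<in> els (universe C k)" by (rule trunc_universe[OF Suc.prems])
  have s: "s \<in> els (universe C k)" if "s \<in> insert 0 (tsums k {trunc k e})" for s
    using that zero_universe tsums_universe[of s k "{trunc k e}" C] t by blast
  have "els (tomega C (Suc k) e) \<subseteq> {w. cut_left w \<in> els (universe C k) \<and> cut_color w \<in> els C \<and> cut_right w \<in> els (universe C k)}"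
    unfolding rat_ord.els_tomega[OF Suc.prems]
  proof (intro UN_least image_subsetI CollectI)
    fix s w assume "s \<in> insert 0 (tsums k {trunc k e})" "w \<in> els e"
    then show "cut_left (cut (tadd k s (cut_left w)) (cut_color w) (tadd k (cut_right w) (tomega C k (trunc k e)))) \<in> els (universe C k) \<and>
       cut_color (cut (tadd k s (cut_left w)) (cut_color w) (tadd k (cut_right w) (tomega C k (trunc k e)))) \<in> els C \<and>
       cut_right (cut (tadd k s (cut_left w)) (cut_color w) (tadd k (cut_right w) (tomega C k (trunc k e)))) \<in> els (universe C k)"
      using universe_parts[OF Suc.prems] s Suc.IH[OF t] by (simp add: tadd_universe)
  qed
  then show ?case unfolding els_universe_Suc by simp
qed

lemma power_types_universe: "power_types C k n \<subseteq> els (universe C k)"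
proof (induction n)
  case 0 show ?case using point_type_universe by auto
next
  case (Suc n)
  show ?case
  proof
    fix t assume "t \<in> power_types C k (Suc n)"
    then obtain s e where "t = tadd k s (tomega C k e)" "s \<in> tsums k (power_types C k n)" "e \<in> tsums k (power_types C k n)"
      unfolding power_types.simps set_tomega_def by blast
    then show "t \<in> els (universe C k)" using tsums_universe Suc by (simp add: tadd_universe tomega_universe)
  qed
qed

lemma els_power_types_code: "els (power_types_code C k n) = power_types C k n"
proof (induction n)
  case 0 show ?case unfolding power_types_code_def by (simp add: set_encode_inverse)
next
  case (Suc n)
  have cl: "els (tclosure C k (power_types_code C k n)) = tsums k (power_types C k n)"
    using els_tclosure[of "power_types_code C k n" C k] power_types_universe unfolding Suc by simp
  have im: "els (set_encode ((\<lambda>e. tomega C k e) ` els B)) = (\<lambda>e. tomega C k e) ` els B" for B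
    by (rule set_encode_inverse) simp
  have "power_types_code C k (Suc n) = set_tomega_code C k (power_types_code C k n)" unfolding power_types_code_def by simp
  then have "els (power_types_code C k (Suc n)) = set_tadd k (tsums k (power_types C k n)) ((\<lambda>e. tomega C k e) ` tsums k (power_types C k n))"
    unfolding set_tomega_code_def by (simp only: els_set_tadd_code im[of "tclosure C k (power_types_code C k n)", unfolded cl] cl)
  moreover have "set_tadd k P ((\<lambda>e. tomega C k e) ` P) = {tadd k s (tomega C k e) | s e. s \<in> P \<and> e \<in> P}" for P
    unfolding set_tadd_def by auto
  ultimately show ?case by (simp add: set_tomega_def)
qed

text \<open>
  The claim includes the degenerate case without colors, since the minimization in
  \<open>stable_exponent\<close> has to be total.
\<close>

lemma stable_exponent_ex: "\<exists>N. power_types_code C k (Suc N) = power_types_code C k N"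
proof (cases "els C = {}")
  case True
  have "x \<notin> tsums k {}" for x
  proof
    assume "x \<in> tsums k {}" then show False by induction auto
  qed
  then have "power_types C k (Suc 0) = power_types C k 0" using True unfolding power_types.simps set_tomega_def by simp
  then show ?thesis unfolding els_power_types_code[symmetric] els_eq_iff by blast
next
  case False
  obtain N where "power_types C k (Suc N) = power_types C k N" using power_types_stable[OF False] by blast
  then show ?thesis unfolding els_power_types_code[symmetric] els_eq_iff by blast
qed

lemma computable_stable_exponent:
  assumes "computable a" "computable b" shows "computable (\<lambda>x. stable_exponent (a x) (b x))"
  unfolding stable_exponent_def
  by (rule computable_mu) (intro decidable_eq computable_power_types_code computable_Suc computable_pfst computable_psnd computable_id computable_comp[OF assms(1)] computable_comp[OF assms(2)], rule stable_exponent_ex)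

lemma stable_stable_exponent: "els C \<noteq> {} \<Longrightarrow> stable C k (power_types C k (stable_exponent C k))"
proof (rule stable_power_types)
  have "power_types_code C k (Suc (stable_exponent C k)) = power_types_code C k (stable_exponent C k)" unfolding stable_exponent_def by (rule LeastI_ex[OF stable_exponent_ex])
  then show "power_types C k (Suc (stable_exponent C k)) = power_types C k (stable_exponent C k)" unfolding els_power_types_code[symmetric] by simp
qed

lemma computable_uncountable_types_code:
  assumes "computable a" "computable b" "computable c" shows "computable (\<lambda>x. uncountable_types_code (a x) (b x) (c x))"
  unfolding uncountable_types_code_def
  by (intro computable_set_tadd_code computable_filter decidable_eq computable_tomega computable_pfst computable_psnd computable_id computable_comp[OF assms(1)] computable_comp[OF assms(2)] assms)

lemma els_uncountable_types_code: "stable C k (els E) \<Longrightarrow> els (uncountable_types_code C k E) = stable.U C k (els E)"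
proof -
  assume st: "stable C k (els E)"
  have "els (set_encode {g \<in> els E. tomega C k g = g}) = {g \<in> els E. tomega C k g = g}"
    by (rule set_encode_inverse) simp
  then show ?thesis unfolding uncountable_types_code_def els_set_tadd_code stable.U_def[OF st] set_tadd_def by blast
qed

lemma computable_repeat_tadd_code:
  assumes "computable a" "computable b" "computable c" "computable e" shows "computable (\<lambda>x. repeat_tadd_code (a x) (b x) (c x) (e x))"
  unfolding repeat_tadd_code_def
  by (intro computable_rec_nat computable_set_tadd_code computable_pfst computable_psnd computable_id computable_comp[OF assms(1)] computable_comp[OF assms(2)] assms)

lemma els_repeat_tadd_code: "els (repeat_tadd_code k B n A) = repeat_tadd k (els B) n (els A)"
  by (induction n) (simp_all add: repeat_tadd_code_def repeat_tadd_def els_set_tadd_code)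

lemma computable_theta_step:
  assumes "computable a" "computable b" "computable c" shows "computable (\<lambda>x. theta_step (a x) (b x) (c x))"
  unfolding theta_step_def
  by (intro computable_if decidable_eq computable_pair computable_repeat_tadd_code computable_power_types_code computable_minus computable_const computable_pfst computable_psnd assms)

lemma computable_theta_fold:
  assumes "computable a" "computable b" "computable c" "computable e" shows "computable (\<lambda>x. theta_fold (a x) (b x) (c x) (e x))"
  unfolding theta_fold_def
  by (intro computable_pfst computable_rec_nat computable_pair computable_theta_step computable_psnd computable_id computable_comp[OF assms(1)] computable_comp[OF assms(2)] assms)

lemma els_theta_fold:
  "els (theta_fold C k A (list_encode (map prod_encode th))) =
    foldl (\<lambda>A (n, c). repeat_tadd k (power_types C k n) c A) (els A) th"
proof -
  have it: "\<exists>A'. (theta_step C k ^^ m) (prod_encode (A, list_encode (map prod_encode th))) = prod_encode (A', 0) \<and>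
     els A' = foldl (\<lambda>A (n, c). repeat_tadd k (power_types C k n) c A) (els A) th" if "length th \<le> m" for m
    using that
  proof (induction th arbitrary: A m)
    case Nil
    have "(theta_step C k ^^ m) (prod_encode (A, 0)) = prod_encode (A, 0)"
      by (induction m) (simp_all add: theta_step_def)
    then show ?case by simp
  next
    case (Cons a th)
    obtain n c where a: "a = (n, c)" by (cases a)
    obtain m' where m: "m = Suc m'" using Cons.prems by (cases m) auto
    let ?A = "repeat_tadd_code k (power_types_code C k n) c A"
    have "theta_step C k (prod_encode (A, list_encode (map prod_encode (a # th)))) =
       prod_encode (?A, list_encode (map prod_encode th))"
      unfolding theta_step_def a by simp
    then have "(theta_step C k ^^ m) (prod_encode (A, list_encode (map prod_encode (a # th)))) =
       (theta_step C k ^^ m') (prod_encode (?A, list_encode (map prod_encode th)))"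
      unfolding m by (simp only: funpow_Suc_right comp_apply)
    then show ?case using Cons.IH[of m' ?A] Cons.prems unfolding m a by (simp add: els_repeat_tadd_code els_power_types_code)
  qed
  have len: "length xs \<le> list_encode xs" for xs
  proof (induction xs)
    case (Cons x xs)
    then show ?case using le_prod_encode_2[of "list_encode xs" x] by simp
  qed simp
  have rec: "rec_nat s (\<lambda>_ r. theta_step C k r) m = (theta_step C k ^^ m) s" for s m
    by (induction m) simp_all
  let ?l = "list_encode (map prod_encode th)"
  have "length th \<le> ?l" using len[of "map prod_encode th"] by simp
  then obtain A' where A': "(theta_step C k ^^ ?l) (prod_encode (A, ?l)) = prod_encode (A', 0)"
    "els A' = foldl (\<lambda>A (n, c). repeat_tadd k (power_types C k n) c A) (els A) th" using it[of ?l] by auto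
  show ?thesis unfolding theta_fold_def rec A'(1) pfst_pair by (rule A'(2))
qed

subsection \<open>Evaluating formulas on types\<close>

text \<open>
  Assignments are represented by marks. Colors are codes of sets of unary predicates, of
  which the first \<open>d\<close> are the given ones; the predicate \<open>d + m\<close> marks the value of the variable that was
  introduced by the quantifier at depth \<open>m\<close>. Inside \<open>n\<close> quantifiers, the de Bruijn index \<open>a\<close> refers to depth
  \<open>n - 1 - a\<close>.
\<close>

definition mark :: "nat \<Rightarrow> nat \<Rightarrow> nat \<Rightarrow> nat" where
  "mark d n a = d + (n - 1 - a)"

definition query :: "nat \<Rightarrow> nat \<Rightarrow> nat \<Rightarrow> nat \<Rightarrow> nat \<Rightarrow> nat" where
  "query d n k p t = prod_encode (prod_encode (d, n), prod_encode (k, prod_encode (p, t)))"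

text \<open>
  The type, one rank lower, of the order in which the point of the cut \<open>w\<close> carries an additional
  mark: it is put together from the left part, the recolored point and the right part.
\<close>

definition mark_point :: "nat \<Rightarrow> nat \<Rightarrow> nat \<Rightarrow> nat \<Rightarrow> nat" where
  "mark_point d n k w = tadd (k - 1) (tadd (k - 1) (cut_left w) (point_type (k - 1) (2 ^ (d + n) + cut_color w))) (cut_right w)"

text \<open>
  One step of the evaluation of the formula with code \<open>p\<close> at the type \<open>t\<close> of rank \<open>k\<close>. The cases are the
  tags of \<open>fm_encode\<close>.
\<close>

definition truth_step :: "nat \<Rightarrow> nat \<Rightarrow> nat \<Rightarrow> nat \<Rightarrow> nat \<Rightarrow> (nat \<Rightarrow> nat) \<Rightarrow> nat" where
  "truth_step d n k p t F =
    (if pfst p = 0 then 0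
     else if pfst p = 1 then (if \<exists>w\<in>els t. mark d n (pfst (psnd p)) \<in> els (cut_color w) \<and> mark d n (psnd (psnd p)) \<in> els (cut_color w) then 1 else 0)
     else if pfst p = 2 then (if \<exists>w\<in>els t. mark d n (pfst (psnd p)) \<in> els (cut_color w) \<and>
        (\<exists>v\<in>els (cut_right w). mark d n (psnd (psnd p)) \<in> els (cut_color v)) then 1 else 0)
     else if pfst p = 3 then (if \<exists>w\<in>els t. pfst (psnd p) \<in> els (cut_color w) \<and> mark d n (psnd (psnd p)) \<in> els (cut_color w) then 1 else 0)
     else if pfst p = 4 then 1 - F (query d n k (psnd p) t)
     else if pfst p = 5 then F (query d n k (pfst (psnd p)) t) * F (query d n k (psnd (psnd p)) t)
     else (if \<exists>w\<in>els t. F (query d (Suc n) (k - 1) (psnd p) (mark_point d n k w)) = 1 then 1 else 0))"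

abbreviation "xd x \<equiv> pfst (pfst x)"
abbreviation "xn x \<equiv> psnd (pfst x)"
abbreviation "xk x \<equiv> pfst (psnd x)"
abbreviation "xp x \<equiv> pfst (psnd (psnd x))"
abbreviation "xt x \<equiv> psnd (psnd (psnd x))"

text \<open>
  The first argument bounds the recursion depth. Any number above the code of the formula is enough.
\<close>

primrec truth :: "nat \<Rightarrow> nat \<Rightarrow> nat" where
  "truth 0 x = 0"
| "truth (Suc m) x = truth_step (xd x) (xn x) (xk x) (xp x) (xt x) (truth m)"

lemma truth_query: "truth (Suc m) (query d n k p t) = truth_step d n k p t (truth m)"
  by (simp add: query_def)

declare truth.simps(2) [simp del]

definition truth_dep :: "nat \<Rightarrow> nat" where
  "truth_dep x = set_encode (els (set_encode
      ((\<lambda>w. query (xd x) (Suc (xn x)) (xk x - 1) (psnd (xp x)) (mark_point (xd x) (xn x) (xk x) w)) ` els (xt x))) \<union>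
     els (set_encode (els (set_encode {query (xd x) (xn x) (xk x) (psnd (xp x)) (xt x)}) \<union>
       els (set_encode (els (set_encode {query (xd x) (xn x) (xk x) (pfst (psnd (xp x))) (xt x)}) \<union>
         els (set_encode {query (xd x) (xn x) (xk x) (psnd (psnd (xp x))) (xt x)}))))))"

lemma els_truth_dep: "els (truth_dep x) =
   (\<lambda>w. query (xd x) (Suc (xn x)) (xk x - 1) (psnd (xp x)) (mark_point (xd x) (xn x) (xk x) w)) ` els (xt x) \<union>
    {query (xd x) (xn x) (xk x) (psnd (xp x)) (xt x), query (xd x) (xn x) (xk x) (pfst (psnd (xp x))) (xt x),
     query (xd x) (xn x) (xk x) (psnd (psnd (xp x))) (xt x)}"
proof -
  have i: "els (set_encode A) = A" if "finite A" for A using that by (rule set_encode_inverse)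
  show ?thesis unfolding truth_dep_def by (subst i, simp)+ auto
qed

lemma computable_mark_point:
  "computable a \<Longrightarrow> computable b \<Longrightarrow> computable c \<Longrightarrow> computable e \<Longrightarrow> computable (\<lambda>x. mark_point (a x) (b x) (c x) (e x))"
  unfolding mark_point_def by (intro computable_tadd computable_cut_left computable_cut_right computable_cut_color computable_point_type computable_plus computable_power2 computable_minus computable_const)

lemma computable_mark: "computable a \<Longrightarrow> computable b \<Longrightarrow> computable c \<Longrightarrow> computable (\<lambda>x. mark (a x) (b x) (c x))"
  unfolding mark_def by (intro computable_plus computable_minus computable_const)

lemma computable_query: "computable a \<Longrightarrow> computable b \<Longrightarrow> computable c \<Longrightarrow> computable e \<Longrightarrow> computable f \<Longrightarrow> computable (\<lambda>x. query (a x) (b x) (c x) (e x) (f x))"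
  unfolding query_def by (intro computable_pair)

lemma computable_truth: assumes "computable a" "computable b" shows "computable (\<lambda>x. truth (a x) (b x))"
proof (rule computable_level[where f=truth and g="\<lambda>_. 0" and dep="\<lambda>k x. truth_dep x"
      and H="\<lambda>k x F. truth_step (xd x) (xn x) (xk x) (xp x) (xt x) F"])
  show "computable (\<lambda>z. truth_dep (psnd z))" unfolding truth_dep_def
    by (intro computable_Un computable_image computable_single computable_query computable_mark_point computable_Suc computable_minus computable_const computable_pfst computable_psnd computable_id)
  show "computable (\<lambda>z. truth_step (xd (pfst (psnd z))) (xn (pfst (psnd z))) (xk (pfst (psnd z))) (xp (pfst (psnd z))) (xt (pfst (psnd z)))
     (lookup (psnd (psnd z))))" unfolding truth_step_def
    by (intro computable_if decidable_eq decidable_conj decidable_bex_els decidable_mem computable_mark computable_lookup computable_query computable_mark_point computable_times computable_minus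
        computable_cut_color computable_cut_right computable_Suc computable_const computable_pfst computable_psnd computable_id)
  fix k x and F F' :: "nat \<Rightarrow> nat"
  assume "\<And>z. z \<in> els (truth_dep x) \<Longrightarrow> F z = F' z"
  note F = this[unfolded els_truth_dep]
  have "F (query (xd x) (Suc (xn x)) (xk x - 1) (psnd (xp x)) (mark_point (xd x) (xn x) (xk x) w)) =
        F' (query (xd x) (Suc (xn x)) (xk x - 1) (psnd (xp x)) (mark_point (xd x) (xn x) (xk x) w))"
    if "w \<in> els (xt x)" for w by (rule F) (use that in blast)
  moreover have "F (query (xd x) (xn x) (xk x) (psnd (xp x)) (xt x)) = F' (query (xd x) (xn x) (xk x) (psnd (xp x)) (xt x))"
    "F (query (xd x) (xn x) (xk x) (pfst (psnd (xp x))) (xt x)) = F' (query (xd x) (xn x) (xk x) (pfst (psnd (xp x))) (xt x))"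
    "F (query (xd x) (xn x) (xk x) (psnd (psnd (xp x))) (xt x)) = F' (query (xd x) (xn x) (xk x) (psnd (psnd (xp x))) (xt x))"
    by (rule F; simp)+
  ultimately show "truth_step (xd x) (xn x) (xk x) (xp x) (xt x) F = truth_step (xd x) (xn x) (xk x) (xp x) (xt x) F'"
    unfolding truth_step_def by (simp cong: bex_cong)
qed (simp_all add: computable_const assms truth.simps(2))

lemma less_prod_encode: "0 < a \<Longrightarrow> b < prod_encode (a, b)"
  using le_prod_encode_2[of "a + b" 0] by (simp add: prod_encode_def)

lemma mark_iff:
  assumes "\<And>i. i \<in> els b \<longleftrightarrow> i < d \<and> Q i \<or> (\<exists>m<n. i = d + m \<and> e (n - 1 - m) = a)" "x < n"
  shows "mark d n x \<in> els b \<longleftrightarrow> e x = a"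
proof -
  have "mark d n x \<in> els b \<longleftrightarrow> (\<exists>m<n. n - 1 - x = m \<and> e (n - 1 - m) = a)"
    unfolding assms(1) mark_def by simp
  also have "\<dots> \<longleftrightarrow> e (n - 1 - (n - 1 - x)) = a" using assms(2) by auto
  also have "n - 1 - (n - 1 - x) = x" using assms(2) by simp
  finally show ?thesis .
qed

text \<open>
  Two ranks beyond the quantifier rank are needed for atomic formulas: \<open>Less\<close> speaks about a
  point in the right part of another one.
\<close>

lemma truth_correct:
  fixes M :: "'a struct"
  assumes W: "Well_order (fst M)"
  shows "formula d n \<phi> \<Longrightarrow> (\<And>x. x < n \<Longrightarrow> e x \<in> Field (fst M)) \<Longrightarrow> finite (range c) \<Longrightarrow>
    (\<And>x i. x \<in> Field (fst M) \<Longrightarrow> i \<in> els (c x) \<longleftrightarrow> i < d \<and> x \<in> snd M i \<or> (\<exists>m<n. i = d + m \<and> e (n - 1 - m) = x)) \<Longrightarrow>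
    qrank \<phi> + 2 \<le> k \<Longrightarrow> fm_encode \<phi> < m \<Longrightarrow>
    truth m (query d n k (fm_encode \<phi>) (qtype (slt (fst M)) c k (Field (fst M)))) = (if sat M e \<phi> then 1 else 0)"
proof (induction \<phi> arbitrary: n e c k m)
  case Bot
  then obtain m' where "m = Suc m'" by (cases m) auto
  then show ?case by (simp add: truth_query truth_step_def)
next
  case (Eq x y)
  interpret strict_order "slt (fst M)" by (rule strict_order_slt[OF W])
  obtain m' k' where mk: "m = Suc m'" "k = Suc k'" using Eq.prems by (cases m, simp, cases k) auto
  have xy: "x < n" "y < n" using Eq.prems(1) by auto
  have fin: "finite (c ` X)" for X by (rule finite_subset[OF _ Eq.prems(3)]) auto
  have mk': "mark d n x \<in> els (c a) \<longleftrightarrow> e x = a" if "x < n" "a \<in> Field (fst M)" for x a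
    by (rule mark_iff[OF Eq.prems(4)[OF that(2)] that(1)])
  have "(\<exists>a\<in>Field (fst M). mark d n x \<in> els (c a) \<and> mark d n y \<in> els (c a)) \<longleftrightarrow> e x = e y"
    using mk' xy Eq.prems(2)[OF xy(1)] by auto
  then show ?case unfolding mk truth_query by (simp add: truth_step_def els_qtype_Suc[OF fin])
next
  case (Less x y)
  interpret strict_order "slt (fst M)" by (rule strict_order_slt[OF W])
  obtain m' k' where mk: "m = Suc m'" "k = Suc (Suc k')"
  proof -
    have "m = Suc (m - 1)" "k = Suc (Suc (k - 2))" using Less.prems(5,6) by auto
    then show thesis by (rule that)
  qed
  have xy: "x < n" "y < n" using Less.prems(1) by auto
  have fin: "finite (c ` X)" for X by (rule finite_subset[OF _ Less.prems(3)]) auto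
  have mk': "mark d n x \<in> els (c a) \<longleftrightarrow> e x = a" if "x < n" "a \<in> Field (fst M)" for x a
    by (rule mark_iff[OF Less.prems(4)[OF that(2)] that(1)])
  have "(\<exists>a\<in>Field (fst M). mark d n x \<in> els (c a) \<and>
      (\<exists>b\<in>Field (fst M). slt (fst M) a b \<and> mark d n y \<in> els (c b))) \<longleftrightarrow> slt (fst M) (e x) (e y)"
    using mk' xy Less.prems(2)[OF xy(1)] Less.prems(2)[OF xy(2)] by auto
  moreover have "(\<exists>w\<in>els (qtype (slt (fst M)) c k (Field (fst M))). mark d n x \<in> els (cut_color w) \<and> (\<exists>v\<in>els (cut_right w). mark d n y \<in> els (cut_color v))) \<longleftrightarrow>
     (\<exists>a\<in>Field (fst M). mark d n x \<in> els (c a) \<and>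
      (\<exists>b\<in>Field (fst M). slt (fst M) a b \<and> mark d n y \<in> els (c b)))"
  proof -
    have 1: "els (qtype (slt (fst M)) c k (Field (fst M))) = (\<lambda>x. cut (qtype (slt (fst M)) c (Suc k') {y\<in>Field (fst M). slt (fst M) y x})
       (c x) (qtype (slt (fst M)) c (Suc k') {y\<in>Field (fst M). slt (fst M) x y})) ` Field (fst M)"
      unfolding mk by (rule els_qtype_Suc[OF fin])
    have 2: "(\<exists>v\<in>els (qtype (slt (fst M)) c (Suc k') Y). mark d n y \<in> els (cut_color v)) \<longleftrightarrow> (\<exists>b\<in>Y. mark d n y \<in> els (c b))" for Y
      unfolding els_qtype_Suc[OF fin] by simp
    show ?thesis unfolding 1 by (simp add: 2) blast
  qed
  ultimately show ?case unfolding mk(1) truth_query by (simp add: truth_step_def slt_def)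
next
  case (Color i x)
  interpret strict_order "slt (fst M)" by (rule strict_order_slt[OF W])
  obtain m' k' where mk: "m = Suc m'" "k = Suc k'" using Color.prems by (cases m, simp, cases k) auto
  have ix: "i < d" "x < n" using Color.prems(1) by auto
  have fin: "finite (c ` X)" for X by (rule finite_subset[OF _ Color.prems(3)]) auto
  have mk': "mark d n x \<in> els (c a) \<longleftrightarrow> e x = a" "i \<in> els (c a) \<longleftrightarrow> a \<in> snd M i" if "a \<in> Field (fst M)" for a
    using mark_iff[OF Color.prems(4)[OF that] ix(2)] Color.prems(4)[OF that] ix(1) by auto
  have "(\<exists>a\<in>Field (fst M). i \<in> els (c a) \<and> mark d n x \<in> els (c a)) \<longleftrightarrow> e x \<in> snd M i"
    using mk' Color.prems(2)[OF ix(2)] by auto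
  then show ?case unfolding mk truth_query by (simp add: truth_step_def els_qtype_Suc[OF fin])
next
  case (Neg \<phi>)
  obtain m' where m: "m = Suc m'" using Neg.prems(6) by (cases m) auto
  have "fm_encode \<phi> < fm_encode (Neg \<phi>)" unfolding fm_encode.simps by (rule less_prod_encode) simp
  then have "truth m' (query d n k (fm_encode \<phi>) (qtype (slt (fst M)) c k (Field (fst M)))) = (if sat M e \<phi> then 1 else 0)"
    by (intro Neg.IH) (use Neg.prems m in auto)
  then show ?case unfolding m truth_query by (simp add: truth_step_def)
next
  case (Conj \<phi> \<psi>)
  obtain m' where m: "m = Suc m'" using Conj.prems(6) by (cases m) auto
  have "prod_encode (fm_encode \<phi>, fm_encode \<psi>) < fm_encode (Conj \<phi> \<psi>)"
    unfolding fm_encode.simps by (rule less_prod_encode) simp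
  then have l: "fm_encode \<phi> < fm_encode (Conj \<phi> \<psi>)" "fm_encode \<psi> < fm_encode (Conj \<phi> \<psi>)"
    using le_prod_encode_1[of "fm_encode \<phi>" "fm_encode \<psi>"] le_prod_encode_2[of "fm_encode \<psi>" "fm_encode \<phi>"]
    by linarith+
  have "truth m' (query d n k (fm_encode \<phi>) (qtype (slt (fst M)) c k (Field (fst M)))) = (if sat M e \<phi> then 1 else 0)"
    by (rule Conj.IH(1)) (use Conj.prems m l in auto)
  moreover have "truth m' (query d n k (fm_encode \<psi>) (qtype (slt (fst M)) c k (Field (fst M)))) = (if sat M e \<psi> then 1 else 0)"
    by (rule Conj.IH(2)) (use Conj.prems m l in auto)
  ultimately show ?case unfolding m truth_query by (simp add: truth_step_def)
next
  case (Ex \<phi>)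
  interpret strict_order "slt (fst M)" by (rule strict_order_slt[OF W])
  let ?X = "Field (fst M)" and ?lt = "slt (fst M)"
  obtain m' k' where mk: "m = Suc m'" "k = Suc k'" using Ex.prems(5,6) by (cases m, simp, cases k) auto
  have l: "fm_encode \<phi> < fm_encode (Ex \<phi>)" unfolding fm_encode.simps by (rule less_prod_encode) simp
  have fin: "finite (c ` X)" for X by (rule finite_subset[OF _ Ex.prems(3)]) auto
  have key: "truth m' (query d (Suc n) k' (fm_encode \<phi>) (mark_point d n k
       (cut (qtype ?lt c k' {y\<in>?X. ?lt y a}) (c a) (qtype ?lt c k' {y\<in>?X. ?lt a y})))) =
     (if sat M (case_nat a e) \<phi> then 1 else 0)" if a: "a \<in> ?X" for a
  proof -
    \<comment> \<open>The chosen point receives the mark of the new variable.\<close>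
    define c' where "c' = c(a := 2 ^ (d + n) + c a)"
    have "range c' \<subseteq> insert (2 ^ (d + n) + c a) (range c)" unfolding c'_def by auto
    then have finc': "finite (range c')" by (rule finite_subset) (simp add: Ex.prems(3))
    have "d + n \<notin> els (c a)" using Ex.prems(4)[OF a] by auto
    then have elsa: "els (c' a) = insert (d + n) (els (c a))"
      unfolding c'_def by (simp add: set_decode_plus_power_2)
    have X: "?X = ({y\<in>?X. ?lt y a} \<union> {a}) \<union> {y\<in>?X. ?lt a y}"
      using a slt_total[OF W] by blast
    have b: "before ?lt {y\<in>?X. ?lt y a} {a}" "before ?lt ({y\<in>?X. ?lt y a} \<union> {a}) {y\<in>?X. ?lt a y}"
      unfolding before_def using tr by blast+
    have cc: "qtype ?lt c' k' {y\<in>?X. ?lt y a} = qtype ?lt c k' {y\<in>?X. ?lt y a}"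
      "qtype ?lt c' k' {y\<in>?X. ?lt a y} = qtype ?lt c k' {y\<in>?X. ?lt a y}"
      by (rule qtype_cong; use irr in \<open>auto simp: c'_def\<close>)+
    have "qtype ?lt c' k' ?X = tadd k' (tadd k' (qtype ?lt c' k' {y\<in>?X. ?lt y a}) (qtype ?lt c' k' {a})) (qtype ?lt c' k' {y\<in>?X. ?lt a y})"
      by (rule trans[OF arg_cong[OF X, of "qtype ?lt c' k'"]]) (simp only: qtype_Un[OF finc' b(2)] qtype_Un[OF finc' b(1)])
    also have "\<dots> = mark_point d n k (cut (qtype ?lt c k' {y\<in>?X. ?lt y a}) (c a) (qtype ?lt c k' {y\<in>?X. ?lt a y}))"
      unfolding cc qtype_singleton mark_point_def mk(2) by (simp add: c'_def)
    finally have t: "mark_point d n k (cut (qtype ?lt c k' {y\<in>?X. ?lt y a}) (c a) (qtype ?lt c k' {y\<in>?X. ?lt a y})) = qtype ?lt c' k' ?X" ..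
    have marks: "i \<in> els (c' x) \<longleftrightarrow> i < d \<and> x \<in> snd M i \<or> (\<exists>j<Suc n. i = d + j \<and> case_nat a e (Suc n - 1 - j) = x)"
      if x: "x \<in> ?X" for x i
    proof -
      have "(\<exists>j<Suc n. i = d + j \<and> case_nat a e (Suc n - 1 - j) = x) \<longleftrightarrow>
         i = d + n \<and> x = a \<or> (\<exists>j<n. i = d + j \<and> e (n - 1 - j) = x)"
      proof -
        have "case_nat a e (n - j) = e (n - 1 - j)" if "j < n" for j
        proof -
          have "n - j = Suc (n - 1 - j)" using that by simp
          then show ?thesis by simp
        qed
        then show ?thesis by (auto simp: less_Suc_eq)
      qed
      moreover have "i \<in> els (c' x) \<longleftrightarrow> i = d + n \<and> x = a \<or> i \<in> els (c x)"
        using elsa unfolding c'_def by auto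
      ultimately show ?thesis using Ex.prems(4)[OF x, of i] by blast
    qed
    show ?thesis unfolding t
    proof (rule Ex.IH)
      show "case_nat a e x \<in> ?X" if "x < Suc n" for x
        using that a Ex.prems(2) by (cases x) auto
      show "i \<in> els (c' x) \<longleftrightarrow> i < d \<and> x \<in> snd M i \<or> (\<exists>j<Suc n. i = d + j \<and> case_nat a e (Suc n - 1 - j) = x)"
        if "x \<in> ?X" for x i by (rule marks[OF that])
    qed (use Ex.prems l mk finc' in auto)
  qed
  define \<tau> where "\<tau> a = cut (qtype ?lt c k' {y\<in>?X. ?lt y a}) (c a) (qtype ?lt c k' {y\<in>?X. ?lt a y})" for a
  have kk: "truth m' (query d (Suc n) (k - 1) (fm_encode \<phi>) (mark_point d n k (\<tau> a))) = 1 \<longleftrightarrow> sat M (case_nat a e) \<phi>"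
    if "a \<in> ?X" for a
    using key[OF that] unfolding \<tau>_def mk(2) by simp
  have "els (qtype ?lt c k ?X) = \<tau> ` ?X"
    unfolding mk(2) \<tau>_def by (rule els_qtype_Suc[OF fin])
  then have "(\<exists>w\<in>els (qtype ?lt c k ?X). truth m' (query d (Suc n) (k - 1) (fm_encode \<phi>) (mark_point d n k w)) = 1) \<longleftrightarrow>
      (\<exists>a\<in>?X. sat M (case_nat a e) \<phi>)"
    using kk by auto
  then show ?case unfolding mk(1) truth_query by (simp add: truth_step_def)
qed

section \<open>The decision procedure\<close>

text \<open>
  A point of color \<open>i\<close> satisfies exactly the predicate \<open>i\<close>, so its color code is that of \<open>{i}\<close>.
\<close>

definition base_colors :: "nat \<Rightarrow> nat" where "base_colors d = set_encode ((\<lambda>i. 2 ^ i) ` {..<d})"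

lemma els_base_colors: "els (base_colors d) = (\<lambda>i. 2 ^ i) ` {..<d}"
  unfolding base_colors_def by (rule set_encode_inverse) simp

lemma computable_base_colors: assumes "computable a" shows "computable (\<lambda>x. base_colors (a x))"
  unfolding base_colors_def
proof (rule computable_set_encode)
  have "decidable (\<lambda>z. \<forall>i<a (psnd z). 2 ^ i \<in> els (pfst z))"
    by (intro decidable_ball_less decidable_mem computable_power2 computable_pfst computable_psnd computable_id computable_comp[OF assms])
  then show "decidable (\<lambda>z. (\<lambda>i. 2 ^ i) ` {..<a (psnd z)} \<subseteq> els (pfst z))" by (rule decidable_cong) blast
qed simp

lemma els_power2: "els (2 ^ i) = {i}"
  using set_decode_plus_power_2[of i 0] by simp

lemma truth_sentence:
  fixes M :: "'a struct"
  assumes "Well_order (fst M)" "\<sigma> \<in> sentences d q" "finite (range c)"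
    and "\<And>x i. x \<in> Field (fst M) \<Longrightarrow> i \<in> els (c x) \<longleftrightarrow> i < d \<and> x \<in> snd M i"
  shows "truth (Suc (fm_encode \<sigma>)) (query d 0 (q + 2) (fm_encode \<sigma>) (qtype (slt (fst M)) c (q + 2) (Field (fst M)))) =
    (if M \<Turnstile> \<sigma> then 1 else 0)"
  unfolding models_def
proof (rule truth_correct[OF assms(1) _ _ assms(3)])
  show "formula d 0 \<sigma>" "qrank \<sigma> + 2 \<le> q + 2" using assms(2) unfolding sentences_def by simp_all
  show "i \<in> els (c x) \<longleftrightarrow> i < d \<and> x \<in> snd M i \<or> (\<exists>m<0. i = d + m \<and> (undefined :: 'a) = x)"
    if "x \<in> Field (fst M)" for x i
    using assms(4)[OF that] by simp
qed simp_all

lemma colored_type: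
  fixes M :: "'a struct"
  assumes M: "colored_ordinal d M" and d: "d \<ge> 1" and \<sigma>: "\<sigma> \<in> sentences d q"
  shows "\<exists>c. range c \<subseteq> els (base_colors d) \<and>
    (M \<Turnstile> \<sigma> \<longleftrightarrow> truth (Suc (fm_encode \<sigma>)) (query d 0 (q + 2) (fm_encode \<sigma>) (qtype (slt (fst M)) c (q + 2) (Field (fst M)))) = 1)"
proof -
  have W: "Well_order (fst M)" and un: "(\<Union>i<d. snd M i) = Field (fst M)" and dis: "disjoint_family_on (snd M) {..<d}"
    using M unfolding colored_ordinal_def by auto
  \<comment> \<open>Elements of the type that are not points also receive a color, since \<open>c\<close> is total.\<close>
  have "\<exists>i<d. x \<in> Field (fst M) \<longrightarrow> x \<in> snd M i" for x
  proof (cases "x \<in> Field (fst M)")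
    case True then show ?thesis using un by blast
  qed (use d in \<open>auto intro!: exI[of _ 0]\<close>)
  then obtain col where col: "\<And>x. col x < d" "\<And>x. x \<in> Field (fst M) \<Longrightarrow> x \<in> snd M (col x)" by metis
  define c where "c x = (2 :: nat) ^ col x" for x
  have rng: "range c \<subseteq> els (base_colors d)" unfolding els_base_colors c_def using col(1) by auto
  have "i \<in> els (c x) \<longleftrightarrow> i < d \<and> x \<in> snd M i" if x: "x \<in> Field (fst M)" for x i
  proof -
    have "i = col x" if "i < d" "x \<in> snd M i"
      using dis that col(1)[of x] col(2)[OF x] unfolding disjoint_family_on_def by blast
    then show ?thesis unfolding c_def els_power2 using col(1)[of x] col(2)[OF x] by blast
  qed
  from truth_sentence[OF W \<sigma> fin_col[OF rng] this]
  have "M \<Turnstile> \<sigma> \<longleftrightarrow> truth (Suc (fm_encode \<sigma>)) (query d 0 (q + 2) (fm_encode \<sigma>) (qtype (slt (fst M)) c (q + 2) (Field (fst M)))) = 1"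
    by simp
  then show ?thesis using rng by blast
qed

lemma type_colored:
  fixes r :: "'a rel"
  assumes W: "Well_order r" and c: "range c \<subseteq> els (base_colors d)" and d: "d \<ge> 1" and \<sigma>: "\<sigma> \<in> sentences d q"
    and truth: "truth (Suc (fm_encode \<sigma>)) (query d 0 (q + 2) (fm_encode \<sigma>) (qtype (slt r) c (q + 2) (Field r))) = 1"
  shows "\<exists>M :: 'a struct. colored_ordinal d M \<and> fst M = r \<and> M \<Turnstile> \<sigma>"
proof -
  define M where "M = (r, \<lambda>i. {x \<in> Field r. c x = 2 ^ i})"
  have fM: "fst M = r" and sM: "snd M i = {x \<in> Field r. c x = 2 ^ i}" for i unfolding M_def by simp_all
  have ex: "\<exists>i<d. c x = 2 ^ i" for x using c unfolding els_base_colors by auto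
  have ordM: "colored_ordinal d M" unfolding colored_ordinal_def fM
  proof (intro conjI W)
    show "(\<Union>i<d. snd M i) = Field r" using ex by (auto simp: sM)
    show "disjoint_family_on (snd M) {..<d}" unfolding disjoint_family_on_def sM by auto
  qed
  have "i \<in> els (c x) \<longleftrightarrow> i < d \<and> x \<in> snd M i" if x: "x \<in> Field (fst M)" for x i
  proof -
    obtain j where j: "j < d" "c x = 2 ^ j" using ex by blast
    have "els (c x) = {j}" "c x = 2 ^ i \<longleftrightarrow> j = i" unfolding j(2) els_power2 by simp_all
    then show ?thesis using x j(1) unfolding sM fM by auto
  qed
  from truth_sentence[OF W[folded fM] \<sigma> fin_col[OF c] this]
  have "(if M \<Turnstile> \<sigma> then 1 else 0) = (1 :: nat)" unfolding fM truth by (rule sym)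
  then have "M \<Turnstile> \<sigma>" by (simp split: if_splits)
  then show ?thesis using ordM fM by blast
qed

lemma qtypes_ordIso:
  assumes "r =o r'"
  shows "qtypes (slt r) C k (Field r) \<subseteq> qtypes (slt r') C k (Field r')"
proof
  fix t assume "t \<in> qtypes (slt r) C k (Field r)"
  then obtain c where c: "range c \<subseteq> els C" "t = qtype (slt r) c k (Field r)" unfolding qtypes_def by blast
  obtain h where h: "iso r r' h" using assms unfolding ordIso_def by auto
  have bij: "bij_betw h (Field r) (Field r')" and ord: "\<And>a b. a \<in> Field r \<Longrightarrow> b \<in> Field r \<Longrightarrow> (a, b) \<in> r \<longleftrightarrow> (h a, h b) \<in> r'"
    using h unfolding iso_iff2 by auto
  have inj: "inj_on h (Field r)" and im: "h ` Field r = Field r'"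
    using bij unfolding bij_betw_def by auto
  let ?c = "\<lambda>y. c (inv_into (Field r) h y)"
  have "qtype (slt r) c k (Field r) = qtype (slt r') ?c k (h ` Field r)"
  proof (rule qtype_iso[OF inj])
    show "slt r x y \<longleftrightarrow> slt r' (h x) (h y)" if "x \<in> Field r" "y \<in> Field r" for x y
      unfolding slt_def using ord[OF that] inj_on_eq_iff[OF inj that] by simp
  qed (simp add: inv_into_f_f[OF inj])
  moreover have "range ?c \<subseteq> els C" using c(1) by auto
  ultimately show "t \<in> qtypes (slt r') C k (Field r')" unfolding c(2) im by (auto intro: qtypes_I)
qed

text \<open>
  Types do not depend on the representation of the ordinal, so the coloring can be moved
  from \<open>r\<close> to the Cantor normal form and back.
\<close>

lemma satisfiable_iff:
  fixes r :: "'a rel" and s :: "'b rel"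
  assumes iso: "r =o s" and d: "d \<ge> 1" and \<sigma>: "\<sigma> \<in> sentences d q"
  shows "(\<exists>M :: 'a struct. colored_ordinal d M \<and> fst M =o r \<and> M \<Turnstile> \<sigma>) \<longleftrightarrow>
    (\<exists>t\<in>qtypes (slt s) (base_colors d) (q + 2) (Field s). truth (Suc (fm_encode \<sigma>)) (query d 0 (q + 2) (fm_encode \<sigma>) t) = 1)"
    (is "?L \<longleftrightarrow> ?R")
proof
  assume ?L
  then obtain M :: "'a struct" where M: "colored_ordinal d M" "fst M =o r" "M \<Turnstile> \<sigma>" by blast
  obtain c where c: "range c \<subseteq> els (base_colors d)"
    "truth (Suc (fm_encode \<sigma>)) (query d 0 (q + 2) (fm_encode \<sigma>) (qtype (slt (fst M)) c (q + 2) (Field (fst M)))) = 1"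
    using colored_type[OF M(1) d \<sigma>] M(3) by blast
  have "qtype (slt (fst M)) c (q + 2) (Field (fst M)) \<in> qtypes (slt (fst M)) (base_colors d) (q + 2) (Field (fst M))"
    by (rule qtypes_I[OF c(1)])
  then have "qtype (slt (fst M)) c (q + 2) (Field (fst M)) \<in> qtypes (slt s) (base_colors d) (q + 2) (Field s)"
    using qtypes_ordIso[OF ordIso_transitive[OF M(2) iso]] by blast
  then show ?R using c(2) by blast
next
  assume ?R
  then obtain t where t: "t \<in> qtypes (slt s) (base_colors d) (q + 2) (Field s)"
    "truth (Suc (fm_encode \<sigma>)) (query d 0 (q + 2) (fm_encode \<sigma>) t) = 1" by blast
  have "t \<in> qtypes (slt r) (base_colors d) (q + 2) (Field r)"
    using qtypes_ordIso[OF ordIso_symmetric[OF iso]] t(1) by blast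
  then obtain c where c: "range c \<subseteq> els (base_colors d)" "t = qtype (slt r) c (q + 2) (Field r)" unfolding qtypes_def by blast
  have W: "Well_order r" using iso unfolding ordIso_def by auto
  obtain M :: "'a struct" where M: "colored_ordinal d M" "fst M = r" "M \<Turnstile> \<sigma>"
    using type_colored[OF W c(1) d \<sigma>] t(2) unfolding c(2) by blast
  then have "fst M =o r" using ordIso_reflexive[OF W] by simp
  then show ?L using M by blast
qed

text \<open>
  The code of the set of types of the colorings of an ordinal, computed from the data of its
  presentation: the code \<open>th\<close> of \<open>\<theta>\<close>, the flag \<open>z\<close> for \<open>\<alpha>\<^sub>0 = 0\<close>, and the flag \<open>\<kappa>\<close> for uncountable cofinality.
\<close>

definition ordinal_types_code :: "nat \<Rightarrow> nat \<Rightarrow> nat \<Rightarrow> nat \<Rightarrow> nat \<Rightarrow> nat" where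
  "ordinal_types_code C k th z \<kappa> = theta_fold C k (if z = 1 then set_encode {0} else
     if \<kappa> = 0 then power_types_code C k (stable_exponent C k) else uncountable_types_code C k (power_types_code C k (stable_exponent C k))) th"

lemma computable_ordinal_types_code: "computable a \<Longrightarrow> computable b \<Longrightarrow> computable c \<Longrightarrow> computable e \<Longrightarrow> computable f \<Longrightarrow> computable (\<lambda>x. ordinal_types_code (a x) (b x) (c x) (e x) (f x))"
  unfolding ordinal_types_code_def
  by (intro computable_theta_fold computable_if decidable_eq computable_const computable_power_types_code computable_stable_exponent computable_uncountable_types_code)

lemma els_ordinal_types_code:
  assumes cnf: "is_cnf cs" and wo: "Well_order (cnf_ord cs)" and C: "els C \<noteq> {}" and k: "k > 0"
    and z: "z = (if Field (cnf_ord (infinite_terms cs)) = {} then 1 else 0)"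
    and \<kappa>: "Field (cnf_ord (infinite_terms cs)) \<noteq> {} \<Longrightarrow>
          (cofinality (cnf_ord (infinite_terms cs)) =o natLeq \<longrightarrow> \<kappa> = 0) \<and>
          (natLeq <o cofinality (cnf_ord (infinite_terms cs)) \<longrightarrow> \<kappa> = 1)"
  shows "els (ordinal_types_code C k (theta_code cs) z \<kappa>) = qtypes (slt (cnf_ord cs)) C k (Field (cnf_ord cs))"
proof -
  let ?r = "cnf_ord (infinite_terms cs)"
  note st = stable_stable_exponent[OF C, of k]
  have "els (if z = 1 then set_encode {0} else if \<kappa> = 0 then power_types_code C k (stable_exponent C k) else uncountable_types_code C k (power_types_code C k (stable_exponent C k)))
     = base_types C k (stable_exponent C k) cs"
  proof (cases "Field ?r = {}")
    case True
    have "els (set_encode {0}) = {0}" by (rule set_encode_inverse) simp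
    then show ?thesis using True z unfolding base_types_def by simp
  next
    case False
    have U: "els (uncountable_types_code C k (power_types_code C k (stable_exponent C k))) = stable.U C k (power_types C k (stable_exponent C k))"
      using els_uncountable_types_code[of C k "power_types_code C k (stable_exponent C k)"] st unfolding els_power_types_code .
    have "cofinality ?r =o natLeq \<or> natLeq <o cofinality ?r"
      by (rule us_cofinality(1)[OF cnf wo refl refl st k False])
    moreover have "\<not> natLeq <o cofinality ?r" if "cofinality ?r =o natLeq"
      using that not_ordLess_ordIso ordIso_symmetric by blast
    ultimately show ?thesis using False z \<kappa>[OF False] U unfolding base_types_def by (auto simp: els_power_types_code)
  qed
  then show ?thesis unfolding ordinal_types_code_def theta_code_def els_theta_fold Field_cnf_ord
    using qtypes_cnf[OF cnf wo refl refl st k] by simp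
qed

theorem theorem13:
  fixes Sigma :: "nat \<Rightarrow> nat \<Rightarrow> fm set"
    and P :: "nat set"
    and \<alpha> :: "nat \<Rightarrow> 'a rel"
    and cnf :: "nat \<Rightarrow> 'a cnf"
  assumes "infinite (UNIV :: 'a set)"
    and "\<And>d q. d \<ge> 1 \<Longrightarrow> characteristic_set TYPE('a) d q (Sigma d q)"
    and "effective_presentation P \<alpha> cnf"
  shows "\<exists>D. recursive 4 D \<and>
    (\<forall>d q \<sigma> p. d \<ge> 1 \<and> \<sigma> \<in> Sigma d q \<and> p \<in> P \<longrightarrow>
       D [d, q, fm_encode \<sigma>, p] =
         (if \<exists>M :: 'a struct. colored_ordinal d M \<and> fst M =o \<alpha> p \<and> M \<Turnstile> \<sigma> then 1 else 0))"
proof -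
  have pres: "is_cnf (cnf p)" "\<alpha> p =o cnf_ord (cnf p)" if "p \<in> P" for p
    using assms(3) that unfolding effective_presentation_def by auto
  obtain T where T: "recursive 1 T" "\<And>p. p \<in> P \<Longrightarrow> T [p] = theta_code (cnf p)"
    using assms(3) unfolding effective_presentation_def by blast
  obtain Z where Z: "recursive 1 Z"
    "\<And>p. p \<in> P \<Longrightarrow> Z [p] = (if Field (cnf_ord (infinite_terms (cnf p))) = {} then 1 else 0)"
    using assms(3) unfolding effective_presentation_def by blast
  obtain K where K: "recursive 1 K"
    "\<And>p. p \<in> P \<Longrightarrow> Field (cnf_ord (infinite_terms (cnf p))) \<noteq> {} \<Longrightarrow>
          (cofinality (cnf_ord (infinite_terms (cnf p))) =o natLeq \<longrightarrow> K [p] = 0) \<and>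
          (natLeq <o cofinality (cnf_ord (infinite_terms (cnf p))) \<longrightarrow> K [p] = 1)"
    using assms(3) unfolding effective_presentation_def by blast
  have un: "computable (\<lambda>x. G [a x])" if "recursive 1 G" "computable a" for G a
    using recursive_comp1[OF that(1) that(2)[unfolded computable_def]] unfolding computable_def .
  \<comment> \<open>Rank \<open>q + 2\<close> is what the evaluation needs; the code of the sentence bounds its
    recursion depth.\<close>
  define dec where "dec d q s p = (if \<exists>t\<in>els (ordinal_types_code (base_colors d) (q + 2) (T [p]) (Z [p]) (K [p])).
     truth (Suc s) (query d 0 (q + 2) s t) = 1 then 1 else (0::nat))" for d q s p
  have dec: "computable (\<lambda>x. dec (pfst x) (pfst (psnd x)) (pfst (psnd (psnd x))) (psnd (psnd (psnd x))))"
    unfolding dec_def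
    by (intro computable_if decidable_bex_els decidable_eq computable_truth computable_query computable_ordinal_types_code computable_base_colors computable_plus computable_Suc computable_const computable_pfst computable_psnd computable_id
        un[OF T(1)] un[OF Z(1)] un[OF K(1)])
  define D where "D xs = dec (xs ! 0) (xs ! 1) (xs ! 2) (xs ! 3)" for xs
  have p: "recursive 4 (\<lambda>xs. xs ! i)" if "i < 4" for i by (rule recursive.proj[OF that])
  have "recursive 4 (\<lambda>xs. prod_encode (xs ! 0, prod_encode (xs ! 1, prod_encode (xs ! 2, xs ! 3))))"
    by (intro recursive_pair p) simp_all
  from recursive_computable[OF dec this] have "recursive 4 D" unfolding D_def by simp
  moreover have "D [d, q, fm_encode \<sigma>, p] =
         (if \<exists>M :: 'a struct. colored_ordinal d M \<and> fst M =o \<alpha> p \<and> M \<Turnstile> \<sigma> then 1 else 0)"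
    if d: "d \<ge> 1" and \<sigma>: "\<sigma> \<in> Sigma d q" and p: "p \<in> P" for d q \<sigma> p
  proof -
    have "\<sigma> \<in> sentences d q"
      using assms(2)[OF d, of q] \<sigma> unfolding characteristic_set_def characteristic_of_def by blast
    note sat = satisfiable_iff[OF pres(2)[OF p] d this]
    have wo: "Well_order (cnf_ord (cnf p))" using pres(2)[OF p] unfolding ordIso_def by auto
    have C: "els (base_colors d) \<noteq> {}" using d unfolding els_base_colors by (auto simp: lessThan_empty_iff)
    have "els (ordinal_types_code (base_colors d) (q + 2) (T [p]) (Z [p]) (K [p])) =
        qtypes (slt (cnf_ord (cnf p))) (base_colors d) (q + 2) (Field (cnf_ord (cnf p)))"
      unfolding T(2)[OF p] by (rule els_ordinal_types_code[OF pres(1)[OF p] wo C _ Z(2)[OF p] K(2)[OF p]]) simp_all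
    then show ?thesis unfolding sat D_def dec_def by simp
  qed
  ultimately show ?thesis by blast
qed

end
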